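(* Let $d,n\geq 1$ be integers and let $\tau>d/n$. Then \[ \dim_F E(\tau,d,n)=\frac{2d}{1+\tau}. \] In particular, $E(\tau,d,n)$ is not a Salem set unless $n=d=1$.
   Context: For a Borel probability measure $\mu$ on $\mathbb{R}^m$, its Fourier transform is $\hat\mu(\xi)=\int e^{-2\pi i x\cdot\xi}\,d\mu(x)$, and its Fourier dimension is $\dim_F\mu=\sup\{s\in[0,m]: |\hat\mu(\xi)|\ll|\xi|^{-s/2}\}$. For a set $E\subset\mathbb{R}^m$, $\dim_F E=\sup\{\dim_F\mu:\mu\in\mathcal P(E)\}$, where $\mathcal P(E)$ is the set of Borel probability measures $\mu$ on $\mathbb{R}^m$ whose support (the largest closed set $C$ with $\mu(\mathbb{R}^m\setminus C)=0$) is a compact subset of $E$. A Borel set $E\subset\mathbb{R}^m$ is a Salem set if $\dim_{\mathrm H}E=\dim_F E$ (Hausdorff dimension equals Fourier dimension). For integers $d,n\ge1$ and $\tau>0$, \[ E(\tau,d,n)=\{x\in\mathbb{R}^{nd}: |xq-r|_\infty<|q|_\infty^{-\tau}\text{ for infinitely many }(q,r)\in\mathbb{Z}^d\times\mathbb{Z}^n\}, \] where $x\in\mathbb{R}^{nd}$ is regarded as an $n\times d$ real matrix and $|\cdot|_\infty$ is the maximum norm. It is known that for $\tau>d/n$, $\dim_{\mathrm H}E(\tau,d,n)=n(d-1)+\frac{n+d}{\tau+1}$.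
   Formalization: The support of a measure is taken to be the smallest (not "largest") closed set whose complement has measure zero, and q = 0, for which |q|^{-τ} is undefined, is excluded in the definition of E(τ,d,n). *)

theory Defs
  imports "HOL-Probability.Probability"
begin

section \<open>Fourier dimension\<close>

definition fourier_transform :: "'a::euclidean_space measure \<Rightarrow> 'a \<Rightarrow> complex" where
  "fourier_transform \<mu> \<xi> = (LINT x|\<mu>. exp (- 2 * of_real pi * \<i> * of_real (x \<bullet> \<xi>)))"

text \<open>The bound is imposed for all nonzero frequencies. For a probability measure and
  \<open>s \<ge> 0\<close> this is the same as imposing it for all large frequencies.\<close>

definition fourier_dim_measure :: "'a::euclidean_space measure \<Rightarrow> real" where
  "fourier_dim_measure \<mu> =
     Sup {s \<in> {0..real DIM('a)}.
       \<exists>C. \<forall>\<xi>. \<xi> \<noteq> 0 \<longrightarrow> norm (fourier_transform \<mu> \<xi>) \<le> C * norm \<xi> powr (- s / 2)}"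

definition measure_support :: "'a::topological_space measure \<Rightarrow> 'a set" where
  "measure_support \<mu> = \<Inter>{C. closed C \<and> emeasure \<mu> (UNIV - C) = 0}"

definition prob_measures_on :: "'a::euclidean_space set \<Rightarrow> 'a measure set" where
  "prob_measures_on E =
     {\<mu>. prob_space \<mu> \<and> sets \<mu> = sets borel \<and>
          compact (measure_support \<mu>) \<and> measure_support \<mu> \<subseteq> E}"

text \<open>All Fourier dimensions of measures are nonnegative, so the inserted \<open>0\<close> only fixes the
  value for the empty set.\<close>

definition fourier_dim :: "'a::euclidean_space set \<Rightarrow> real" where
  "fourier_dim E = Sup (insert 0 (fourier_dim_measure ` prob_measures_on E))"

section \<open>Hausdorff dimension and Salem sets\<close>

text \<open>The power \<open>(diam U)\<^sup>s\<close> with the usual conventions that the empty set has weight \<open>0\<close>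
  and that \<open>0\<^sup>0 = 1\<close> for nonempty \<open>U\<close> (whereas \<open>0 powr 0 = 0\<close>).\<close>

definition diam_power :: "real \<Rightarrow> 'a::metric_space set \<Rightarrow> ennreal" where
  "diam_power s U =
     (if U = {} then 0 else if s = 0 then 1 else ennreal (diameter U powr s))"

definition hausdorff_premeasure ::
  "real \<Rightarrow> real \<Rightarrow> 'a::metric_space set \<Rightarrow> ennreal" where
  "hausdorff_premeasure s \<delta> E =
     Inf {(\<Sum>i. diam_power s (U i)) | U :: nat \<Rightarrow> 'a set.
       E \<subseteq> (\<Union>i. U i) \<and> (\<forall>i. bounded (U i) \<and> diameter (U i) \<le> \<delta>)}"

definition hausdorff_measure :: "real \<Rightarrow> 'a::metric_space set \<Rightarrow> ennreal" where
  "hausdorff_measure s E = (SUP \<delta>\<in>{0<..}. hausdorff_premeasure s \<delta> E)"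

definition hausdorff_dim :: "'a::euclidean_space set \<Rightarrow> real" where
  "hausdorff_dim E = Inf {s. 0 \<le> s \<and> hausdorff_measure s E = 0}"

definition salem_set :: "'a::euclidean_space set \<Rightarrow> bool" where
  "salem_set E \<longleftrightarrow> E \<in> sets borel \<and> hausdorff_dim E = fourier_dim E"

section \<open>Well approximable matrices\<close>

definition real_vec :: "int ^ 'k \<Rightarrow> real ^ 'k" where
  "real_vec v = (\<chi> i. real_of_int (v $ i))"

text \<open>The type \<open>real ^ 'd ^ 'n\<close> is the space of matrices with \<open>n\<close> rows and \<open>d\<close> columns, with the
  Euclidean structure of \<open>\<real>\<close> to the power \<open>n d\<close>. The vector \<open>q = 0\<close>, for which the power of
  the norm is undefined, is excluded.\<close>

definition well_approximable :: "real \<Rightarrow> (real ^ 'd ^ 'n) set" where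
  "well_approximable \<tau> =
     {x. infinite {(q :: int ^ 'd, r :: int ^ 'n).
        q \<noteq> 0 \<and> infnorm (x *v real_vec q - real_vec r) < infnorm (real_vec q) powr (- \<tau>)}}"

lemma well_approximable_borel: "(well_approximable \<tau> :: (real ^ 'd ^ 'n) set) \<in> sets borel"
proof -
  define A :: "(int ^ 'd) \<times> (int ^ 'n) \<Rightarrow> (real ^ 'd ^ 'n) set" where
    "A p = {x. fst p \<noteq> 0 \<and> infnorm (x *v real_vec (fst p) - real_vec (snd p))
                 < infnorm (real_vec (fst p)) powr (- \<tau>)}" for p
  have "open (A p)" for p
  proof -
    have "continuous_on UNIV (\<lambda>x :: real ^ 'd ^ 'n. x *v real_vec (fst p))"
      unfolding matrix_vector_mult_def by (intro continuous_intros)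
    then have "continuous_on UNIV
        (\<lambda>x :: real ^ 'd ^ 'n. infnorm (x *v real_vec (fst p) - real_vec (snd p)))"
      by (intro continuous_intros)
    then show ?thesis
      unfolding A_def by (cases "fst p = 0") (auto intro: open_Collect_less continuous_on_const)
  qed
  then have borel: "A p \<in> sets borel" for p by simp
  have "(well_approximable \<tau> :: (real ^ 'd ^ 'n) set) = {x. infinite {p. x \<in> A p}}"
    unfolding well_approximable_def A_def by (simp add: case_prod_unfold)
  also have "\<dots> = (\<Inter>F\<in>{F. finite F}. \<Union>p\<in>-F. A p)"
  proof (intro set_eqI iffI)
    fix x assume "x \<in> {x. infinite {p. x \<in> A p}}"
    then have "\<not> {p. x \<in> A p} \<subseteq> F" if "finite F" for F
      using that finite_subset by auto
    then show "x \<in> (\<Inter>F\<in>{F. finite F}. \<Union>p\<in>-F. A p)" by blast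
  next
    fix x assume x: "x \<in> (\<Inter>F\<in>{F. finite F}. \<Union>p\<in>-F. A p)"
    show "x \<in> {x. infinite {p. x \<in> A p}}"
    proof (intro CollectI notI)
      assume "finite {p. x \<in> A p}"
      with x have "x \<in> (\<Union>p\<in>-{p. x \<in> A p}. A p)" by blast
      then show False by blast
    qed
  qed
  also have "\<dots> \<in> sets borel"
    by (intro sets.countable_INT'' sets.countable_INT' sets.countable_UN' borel)
       (auto intro: countable_Collect_finite borel sets.countable_UN')
  finally show ?thesis .
qed

end

theory Submission
  imports Defs "HOL-Computational_Algebra.Primes"
begin

text \<open>
  \<^bold>\<open>Upper bound.\<close> Let \<open>\<mu>\<close> live on the set and have Fourier transform \<open>O(|\<xi>|\<^bsup>-\<sigma>\<^esup>)\<close>. Majorising the indicator of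
  \<open>{y. \<parallel>y\<parallel> < |q|\<^bsup>-\<tau>\<^esup>}\<close> on the torus by a product of Fejer kernels of degree \<open>N \<approx> |q|\<^bsup>\<tau>\<^esup>\<close> bounds the
  \<open>\<mu>\<close>-measure of the matrices approximable with denominator \<open>q\<close> by
  \<open>N\<^bsup>-n\<^esup> + |q|\<^bsup>-\<sigma>\<^esup> N\<^bsup>\<epsilon>-\<sigma>\<^esup>\<close>. This is summable over \<open>q\<close> when \<open>\<tau> n > d\<close> and \<open>(1 + \<tau>) \<sigma> > d\<close>, so the
  Borel--Cantelli lemma forces \<open>\<sigma> \<le> d / (1 + \<tau>)\<close>.

  \<^bold>\<open>Lower bound.\<close> Start with a smooth measure and multiply it successively by functions \<open>F\<^sub>M\<close>, the
  average over the \<open>M\<^sup>d\<close> vectors \<open>q \<in> [M, 2M)\<^sup>d\<close> of a periodised bump of width \<open>M\<^bsup>-\<tau>\<^esup>\<close> evaluated at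
  \<open>x q\<close>. The nonconstant Fourier modes of \<open>F\<^sub>M\<close> sit at the integer matrices \<open>k \<otimes> q\<close>. By the divisor
  bound each matrix \<open>l\<close> has at most \<open>|l|\<^sup>\<epsilon>\<close> such representations, so the coefficients are at most
  \<open>M\<^bsup>-d\<^esup> |l|\<^sup>\<epsilon>\<close> up to \<open>|l| \<approx> M\<^bsup>1+\<tau>\<^esup>\<close>, hence roughly \<open>|l|\<^bsup>-d/(1+\<tau>)\<^esup>\<close>. If \<open>M\<close> grows fast enough, every
  weak limit keeps this decay and is supported on the set.

  \<^bold>\<open>Hausdorff dimension.\<close> There are only about \<open>M\<^sup>d (R/M)\<^sup>n\<close> modes \<open>k \<otimes> q\<close> of norm at most \<open>R\<close>, so the same measure
  has finite \<open>s\<close>-energy for all \<open>s < n (d - 1) + (n + d) / (1 + \<tau>)\<close>, which exceeds \<open>2 d / (1 + \<tau>)\<close>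
  unless \<open>n = d = 1\<close>.
\<close>

text \<open>The decay wanted for the limit is too slow to sum perturbations over all integer
  frequencies. The iteration therefore runs inside the class of measures whose transform decays with
  a large exponent \<open>A\<close>. Multiplication by a bump product preserves this class, with a
  constant that may grow without control; the next \<open>M\<close> is chosen only after that
  constant is known. Smallness is asked of the increments alone, in two norms at once: a weighted
  supremum for the Fourier dimension and a weighted square sum over the integer lattice for the
  energy. At frequency 0 the increments add up to at most 1/2, so the total mass never falls below
  1/2 and the limit is not zero.

  The bumps must vanish exactly away from the integers and still have coefficients of fast decay,
  hence the repeated averaging. Their Fourier series are never summed: each bump is a uniform limit
  of trigonometric polynomials with coefficient bounds uniform along the sequence, and every
  estimate concerns finite sums and survives the limit.\<close>

section \<open>Characters and elementary facts on Fourier transforms of finite measures\<close>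

definition unit_exp :: "real \<Rightarrow> complex" where
  "unit_exp t = cis (2 * pi * t)"

lemma unit_exp_add: "unit_exp (s + t) = unit_exp s * unit_exp t"
  by (simp add: unit_exp_def cis_mult distrib_left)

lemma unit_exp_0 [simp]: "unit_exp 0 = 1"
  by (simp add: unit_exp_def)

lemma norm_unit_exp [simp]: "norm (unit_exp t) = 1"
  by (simp add: unit_exp_def)

lemma unit_exp_minus: "unit_exp (- t) = cnj (unit_exp t)"
  by (simp add: unit_exp_def cis_cnj)

lemma unit_exp_of_int [simp]: "unit_exp (of_int k) = 1"
  using cis_multiple_2pi[of "of_int k"] by (simp add: unit_exp_def)

lemma unit_exp_half: "unit_exp (1 / 2) = - 1"
  by (simp add: unit_exp_def)

lemma unit_exp_sum: "finite A \<Longrightarrow> unit_exp (\<Sum>i\<in>A. f i) = (\<Prod>i\<in>A. unit_exp (f i))"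
  by (induction A rule: finite_induct) (auto simp: unit_exp_add)

lemma continuous_on_unit_exp [continuous_intros]:
  "continuous_on A f \<Longrightarrow> continuous_on A (\<lambda>x. unit_exp (f x))"
  unfolding unit_exp_def by (intro continuous_intros)

lemma borel_measurable_unit_exp [measurable]: "unit_exp \<in> borel_measurable borel"
  by (intro borel_measurable_continuous_onI continuous_intros)

lemma fourier_transform_unit_exp: "fourier_transform \<mu> \<xi> = (LINT x|\<mu>. unit_exp (- (x \<bullet> \<xi>)))"
proof -
  have "exp (- 2 * of_real pi * \<i> * of_real (x \<bullet> \<xi>)) = unit_exp (- (x \<bullet> \<xi>))" for x
    by (simp add: unit_exp_def cis_conv_exp mult_ac)
  then show ?thesis by (simp add: fourier_transform_def)
qed

lemma norm_fourier_transform_le: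
  assumes "finite_measure \<mu>"
  shows "norm (fourier_transform \<mu> \<xi>) \<le> measure \<mu> (space \<mu>)"
proof -
  have "norm (fourier_transform \<mu> \<xi>) \<le> (LINT x|\<mu>. norm (unit_exp (- (x \<bullet> \<xi>))))"
    unfolding fourier_transform_unit_exp by (rule integral_norm_bound)
  also have "\<dots> = measure \<mu> (space \<mu>)" by simp
  finally show ?thesis .
qed

lemma fourier_transform_0:
  assumes "finite_measure \<mu>"
  shows "fourier_transform \<mu> 0 = of_real (measure \<mu> (space \<mu>))"
  by (simp add: fourier_transform_unit_exp of_real_def)

lemma integrable_bounded_continuous:
  fixes f :: "'a::euclidean_space \<Rightarrow> 'b::{banach, second_countable_topology}"
  assumes "finite_measure \<mu>" and "sets \<mu> = sets borel" and "f \<in> borel_measurable borel"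
    and "\<And>x. norm (f x) \<le> B"
  shows "integrable \<mu> f"
  using assms by (intro finite_measure.integrable_const_bound[where B = B])
    (auto cong: measurable_cong_sets)

lemma integrable_unit_exp:
  fixes f :: "'a::euclidean_space \<Rightarrow> real"
  assumes "finite_measure \<mu>" and "sets \<mu> = sets borel" and "continuous_on UNIV f"
  shows "integrable \<mu> (\<lambda>x. unit_exp (f x))"

  by (rule integrable_bounded_continuous[where B = 1])
    (use assms in \<open>auto intro!: borel_measurable_continuous_onI continuous_intros\<close>)

section \<open>Lattice sums\<close>

text \<open>Integrality is tested on the basis, so that one notion serves denominators in
  \<open>real ^ 'd\<close>, coefficient vectors in \<open>real ^ 'n\<close> and frequency
  matrices.\<close>

definition int_lattice :: "'a::euclidean_space set" where
  "int_lattice = {v. \<forall>b\<in>Basis. v \<bullet> b \<in> \<int>}"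

lemma int_lattice_diff: "u \<in> int_lattice \<Longrightarrow> v \<in> int_lattice \<Longrightarrow> u - v \<in> int_lattice"
  by (auto simp: int_lattice_def inner_diff_left)

lemma norm_ge_1_int_lattice:
  assumes "v \<in> int_lattice" "v \<noteq> 0"
  shows "norm v \<ge> 1"
proof -
  obtain b where b: "b \<in> Basis" "v \<bullet> b \<noteq> 0"
    using assms(2) euclidean_all_zero_iff by blast
  then have "v \<bullet> b \<in> \<int>" using assms(1) by (auto simp: int_lattice_def)
  then have "\<bar>v \<bullet> b\<bar> \<ge> 1" using b(2) Ints_nonzero_abs_ge1 by blast
  then show ?thesis using Basis_le_norm[OF b(1), of v] by linarith
qed

text \<open>Uniformity in \<open>t\<close> comes from replacing \<open>t\<close> by its floor:
  \<open>1 + \<bar>k - \<lfloor>t\<rfloor>\<bar>\<close> is at most twice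
  \<open>1 + \<bar>t - k\<bar>\<close>, so a shifted sum costs only the factor
  \<open>2 powr p\<close>.\<close>

lemma int_powr_sum_bound:
  fixes p :: real
  assumes "p > 1"
  obtains C where "C > 0" and "\<And>t T. finite T \<Longrightarrow> (\<Sum>k\<in>T. (1 + \<bar>t - real_of_int k\<bar>) powr (- p)) \<le> C"
proof -
  have s: "summable (\<lambda>n. (1 + real n) powr (- p))"
  proof -
    have "summable (\<lambda>n. real n powr (- p))" using assms by (simp add: summable_real_powr_iff)
    then have "summable (\<lambda>n. real (Suc n) powr (- p))" by (subst summable_Suc_iff)
    then show ?thesis by (simp add: add.commute)
  qed
  define D where "D = (\<Sum>n. (1 + real n) powr (- p))"
  have nat_sum: "(\<Sum>n\<in>A. (1 + real n) powr (- p)) \<le> D" if "finite A" for A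
    unfolding D_def by (intro sum_le_suminf s that) auto
  have D0: "D \<ge> 0" using nat_sum[of "{}"] by simp
  have half: "(\<Sum>k\<in>T. (1 + \<bar>real_of_int k\<bar>) powr (- p)) \<le> 2 * D" if T: "finite T" for T
  proof -
    have split: "T = (T \<inter> {0..}) \<union> (T \<inter> {..<0})" by auto
    have "(\<Sum>k\<in>T. (1 + \<bar>real_of_int k\<bar>) powr (- p)) =
      (\<Sum>k\<in>T \<inter> {0..}. (1 + \<bar>real_of_int k\<bar>) powr (- p)) + (\<Sum>k\<in>T \<inter> {..<0}. (1 + \<bar>real_of_int k\<bar>) powr (- p))"
      by (subst split, rule sum.union_disjoint) (use T in auto)
    also have "(\<Sum>k\<in>T \<inter> {0..}. (1 + \<bar>real_of_int k\<bar>) powr (- p)) =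
        (\<Sum>n\<in>nat ` (T \<inter> {0..}). (1 + real n) powr (- p))"
      by (subst sum.reindex) (auto simp: inj_on_def)
    also have "(\<Sum>k\<in>T \<inter> {..<0}. (1 + \<bar>real_of_int k\<bar>) powr (- p)) =
        (\<Sum>n\<in>(\<lambda>k. nat (- k)) ` (T \<inter> {..<0}). (1 + real n) powr (- p))"
      by (subst sum.reindex) (auto simp: inj_on_def)
    also have "(\<Sum>n\<in>nat ` (T \<inter> {0..}). (1 + real n) powr (- p)) +
        (\<Sum>n\<in>(\<lambda>k. nat (- k)) ` (T \<inter> {..<0}). (1 + real n) powr (- p)) \<le> D + D"
      using T by (intro add_mono nat_sum) auto
    finally show ?thesis by simp
  qed
  have *: "(\<Sum>k\<in>T. (1 + \<bar>t - real_of_int k\<bar>) powr (- p)) \<le> 2 powr p * (2 * D)" if T: "finite T" for t T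
  proof -
    have "(1 + \<bar>t - real_of_int k\<bar>) powr (- p) \<le> 2 powr p * (1 + \<bar>real_of_int (k - \<lfloor>t\<rfloor>)\<bar>) powr (- p)" for k
    proof -
      have "(1 + \<bar>real_of_int (k - \<lfloor>t\<rfloor>)\<bar>) \<le> 2 * (1 + \<bar>t - real_of_int k\<bar>)" 
      proof -
        have "\<bar>t - real_of_int \<lfloor>t\<rfloor>\<bar> \<le> 1"
          using of_int_floor_le[of t] real_of_int_floor_add_one_gt[of t] by (intro abs_leI) linarith+
        moreover have "\<bar>real_of_int (k - \<lfloor>t\<rfloor>)\<bar> \<le> \<bar>t - real_of_int k\<bar> + \<bar>t - real_of_int \<lfloor>t\<rfloor>\<bar>"
          using abs_triangle_ineq4[of "t - real_of_int \<lfloor>t\<rfloor>" "t - real_of_int k"] by simp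
        moreover have "1 + x \<le> 2 * (1 + y)" if "x \<le> y + z" "z \<le> 1" "y \<ge> 0" for x y z :: real
          using that by simp
        ultimately show ?thesis using abs_ge_zero by blast
      qed
      then have le: "(2 * (1 + \<bar>t - real_of_int k\<bar>)) powr (- p) \<le> (1 + \<bar>real_of_int (k - \<lfloor>t\<rfloor>)\<bar>) powr (- p)"
        using assms by (intro powr_mono2') auto
      have eq: "x powr (- p) = 2 powr p * (2 * x) powr (- p)" if "x \<ge> 0" for x :: real
        using that by (simp add: powr_mult powr_minus)
      have "0 \<le> 1 + \<bar>t - real_of_int k\<bar>" by simp
      from ord_eq_le_trans[OF eq[OF this] mult_left_mono[OF le powr_ge_zero]]
      show ?thesis .
    qed
    then have "(\<Sum>k\<in>T. (1 + \<bar>t - real_of_int k\<bar>) powr (- p)) \<le>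
        2 powr p * (\<Sum>k\<in>T. (1 + \<bar>real_of_int (k - \<lfloor>t\<rfloor>)\<bar>) powr (- p))"
      unfolding sum_distrib_left by (intro sum_mono)
    also have "(\<Sum>k\<in>T. (1 + \<bar>real_of_int (k - \<lfloor>t\<rfloor>)\<bar>) powr (- p)) =
        (\<Sum>k\<in>(\<lambda>k. k - \<lfloor>t\<rfloor>) ` T. (1 + \<bar>real_of_int k\<bar>) powr (- p))"
      by (subst sum.reindex) (auto simp: inj_on_def)
    also have "\<dots> \<le> 2 * D" using T by (intro half) auto
    finally show ?thesis by simp
  qed
  show ?thesis
  proof (rule that[of "2 powr p * (2 * D) + 1"])
    show "2 powr p * (2 * D) + 1 > 0" using D0 by (intro add_nonneg_pos) auto
    show "(\<Sum>k\<in>T. (1 + \<bar>t - real_of_int k\<bar>) powr (- p)) \<le> 2 powr p * (2 * D) + 1" if "finite T" for t T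
      using *[OF that, of t] by linarith
  qed
qed

text \<open>The exponent is shared evenly between the coordinates: the norm dominates each of them,
  so the summand is at most a product of one-dimensional factors with exponent
  \<open>p / m > 1\<close>. After \<open>T\<close> is enlarged to a box, the sum of products
  factorises.\<close>

lemma lattice_powr_sum_bound:
  fixes p :: real
  assumes "p > real DIM('a::euclidean_space)"
  obtains C where "C > 0"
    and "\<And>(\<xi>::'a) T. finite T \<Longrightarrow> T \<subseteq> int_lattice \<Longrightarrow> (\<Sum>l\<in>T. (1 + norm (\<xi> - l)) powr (- p)) \<le> C"
proof -
  define m where "m = real DIM('a)"
  have m: "m > 0" by (simp add: m_def)
  have "p / m > 1" using assms m by (simp add: m_def)
  then obtain C where C: "C > 0"
    "\<And>t T. finite T \<Longrightarrow> (\<Sum>k\<in>T. (1 + \<bar>t - real_of_int k\<bar>) powr (- (p / m))) \<le> C"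
    using int_powr_sum_bound by metis
  have "(\<Sum>l\<in>T. (1 + norm (\<xi> - l)) powr (- p)) \<le> C ^ DIM('a)"
    if T: "finite T" "T \<subseteq> int_lattice" for \<xi> :: 'a and T
  proof -
    define S where "S = (\<lambda>(l, b). \<lfloor>l \<bullet> b\<rfloor>) ` (T \<times> Basis)"
    define c where "c l = restrict (\<lambda>b. \<lfloor>l \<bullet> b\<rfloor>) Basis" for l :: 'a
    have fin: "finite S" using T by (auto simp: S_def)
    have fl: "real_of_int \<lfloor>l \<bullet> b\<rfloor> = l \<bullet> b" if "l \<in> T" "b \<in> Basis" for l b
      using that T(2) by (auto simp: int_lattice_def elim!: Ints_cases)
    have le: "(1 + norm (\<xi> - l)) powr (- p) \<le> (\<Prod>b\<in>Basis. (1 + \<bar>\<xi> \<bullet> b - real_of_int (c l b)\<bar>) powr (- (p / m)))"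
      if l: "l \<in> T" for l
    proof -
      have "(\<Prod>b\<in>(Basis::'a set). (1 + norm (\<xi> - l)) powr (- (p / m))) \<le>
          (\<Prod>b\<in>Basis. (1 + \<bar>\<xi> \<bullet> b - real_of_int (c l b)\<bar>) powr (- (p / m)))"
      proof (rule prod_mono, rule conjI)
        fix b :: 'a assume b: "b \<in> Basis"
        have "1 + \<bar>\<xi> \<bullet> b - real_of_int (c l b)\<bar> \<le> 1 + norm (\<xi> - l)"

          using Basis_le_norm[OF b, of "\<xi> - l"] b unfolding c_def restrict_def
          by (simp only: if_True fl[OF l b] inner_diff_left)
        then show "(1 + norm (\<xi> - l)) powr (- (p / m)) \<le> (1 + \<bar>\<xi> \<bullet> b - real_of_int (c l b)\<bar>) powr (- (p / m))"
          using assms m by (intro powr_mono2') (auto simp: m_def)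
      qed simp
      also have "(\<Prod>b\<in>(Basis::'a set). (1 + norm (\<xi> - l)) powr (- (p / m))) = (1 + norm (\<xi> - l)) powr (- p)"

      proof -
        have "1 + norm (\<xi> - l) > 0" by (simp add: add_pos_nonneg)
        then show ?thesis using m by (simp add: powr_power m_def)
      qed
      finally show ?thesis .
    qed
    have inj: "inj_on c T"
    proof (rule inj_onI)
      fix l l' assume l: "l \<in> T" "l' \<in> T" and eq: "c l = c l'"
      show "l = l'"
      proof (rule euclidean_eqI)
        fix b :: 'a assume b: "b \<in> Basis"
        have "c l b = c l' b" using eq by simp
        then have "\<lfloor>l \<bullet> b\<rfloor> = \<lfloor>l' \<bullet> b\<rfloor>" using b by (simp add: c_def)
        then show "l \<bullet> b = l' \<bullet> b" using fl[OF l(1) b] fl[OF l(2) b] by metis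
      qed
    qed
    have "(\<Sum>l\<in>T. (1 + norm (\<xi> - l)) powr (- p)) \<le>
        (\<Sum>l\<in>T. (\<Prod>b\<in>Basis. (1 + \<bar>\<xi> \<bullet> b - real_of_int (c l b)\<bar>) powr (- (p / m))))"
      by (intro sum_mono le)
    also have "\<dots> = (\<Sum>f\<in>c ` T. (\<Prod>b\<in>Basis. (1 + \<bar>\<xi> \<bullet> b - real_of_int (f b)\<bar>) powr (- (p / m))))"
      by (subst sum.reindex[OF inj]) simp
    also have "\<dots> \<le> (\<Sum>f\<in>PiE Basis (\<lambda>_. S). (\<Prod>b\<in>Basis. (1 + \<bar>\<xi> \<bullet> b - real_of_int (f b)\<bar>) powr (- (p / m))))"
    proof (rule sum_mono2)
      show "finite (PiE (Basis :: 'a set) (\<lambda>_. S))" using fin by (intro finite_PiE) auto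
      show "c ` T \<subseteq> PiE Basis (\<lambda>_. S)" by (auto simp: c_def S_def PiE_def)
    qed (auto intro: prod_nonneg)
    also have "\<dots> = (\<Prod>b\<in>(Basis::'a set). \<Sum>k\<in>S. (1 + \<bar>\<xi> \<bullet> b - real_of_int k\<bar>) powr (- (p / m)))"
      by (subst prod_sum_PiE) (use fin in auto)
    also have "\<dots> \<le> (\<Prod>b\<in>(Basis::'a set). C)"
      using fin by (intro prod_mono conjI C sum_nonneg) auto
    finally show ?thesis by simp
  qed
  with C(1) show ?thesis by (intro that[of "C ^ DIM('a)"]) auto
qed

lemma one_plus_norm_submult:
  fixes x y :: "'a::real_normed_vector"
  shows "1 + norm x \<le> (1 + norm y) * (1 + norm (x - y))"
  using norm_triangle_sub[of x y] mult_nonneg_nonneg[OF norm_ge_zero[of y] norm_ge_zero[of "x - y"]]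
  unfolding distrib_left distrib_right mult_1_left mult_1_right by linarith

text \<open>Peetre's inequality: a weight moves from one point to another at the price of a power of
  their distance. The perturbation estimates use it to exchange decay between a frequency \<xi> and
  a lattice point.\<close>

lemma Peetre_powr:
  fixes x y :: "'a::real_normed_vector"
  assumes "a \<ge> 0"
  shows "(1 + norm y) powr (- a) \<le> (1 + norm x) powr (- a) * (1 + norm (x - y)) powr a"
proof -
  have "((1 + norm y) * (1 + norm (x - y))) powr (- a) \<le> (1 + norm x) powr (- a)"
    using one_plus_norm_submult[of x y] assms by (intro powr_mono2') (auto intro: add_pos_nonneg)
  then have "(1 + norm y) powr (- a) * (1 + norm (x - y)) powr (- a) * (1 + norm (x - y)) powr a
      \<le> (1 + norm x) powr (- a) * (1 + norm (x - y)) powr a"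
    by (intro mult_right_mono) (auto simp: powr_mult)
  moreover have "(1 + norm (x - y)) powr (- a) * (1 + norm (x - y)) powr a = 1"

  proof -
    have "1 + norm (x - y) > 0" by (simp add: add_pos_nonneg)
    then show ?thesis by (simp add: powr_minus)
  qed
  ultimately show ?thesis by (simp add: mult.assoc)
qed

section \<open>The divisor bound\<close>

lemma card_divisors_prime_power_mult:
  fixes p m k :: nat
  assumes "prime p" "m > 0"
  shows "card {a. a dvd p ^ k * m} \<le> (k + 1) * card {a. a dvd m}"
proof -
  have "{a. a dvd p ^ k * m} \<subseteq> (\<lambda>(i, b). p ^ i * b) ` ({..k} \<times> {a. a dvd m})"
  proof
    fix a assume "a \<in> {a. a dvd p ^ k * m}"
    then obtain b c where "a = b * c" "b dvd p ^ k" "c dvd m" using division_decomp by blast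
    moreover from this obtain i where "i \<le> k" "b = p ^ i" using divides_primepow_nat[OF assms(1)] by blast
    ultimately show "a \<in> (\<lambda>(i, b). p ^ i * b) ` ({..k} \<times> {a. a dvd m})" by force
  qed
  then have "card {a. a dvd p ^ k * m} \<le> card ((\<lambda>(i, b). p ^ i * b) ` ({..k} \<times> {a. a dvd m}))"
    using assms by (intro card_mono) auto
  also have "\<dots> \<le> card ({..k} \<times> {a. a dvd m})" using assms by (intro card_image_le) auto
  finally show ?thesis by (simp add: card_cartesian_product)
qed

text \<open>The constant comes from \<open>1 + x \<le> exp x\<close> at
  \<open>x = \<epsilon> * ln 2 * k\<close>. It pays for the factor \<open>k + 1\<close> that a small
  prime contributes to a divisor count.\<close>

lemma nat_le_two_powr:
  assumes "\<epsilon> > 0"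
  shows "real k + 1 \<le> (1 + 1 / (\<epsilon> * ln 2)) * 2 powr (\<epsilon> * k)"
proof -
  have c: "\<epsilon> * ln 2 > 0" using assms by simp
  have "1 + (\<epsilon> * ln 2) * k \<le> exp ((\<epsilon> * ln 2) * k)" by (rule exp_ge_add_one_self)
  also have "\<dots> = 2 powr (\<epsilon> * k)" by (simp add: powr_def mult_ac)
  finally have e: "1 + (\<epsilon> * ln 2) * k \<le> 2 powr (\<epsilon> * k)" .
  have "real k + 1 \<le> (1 + 1 / (\<epsilon> * ln 2)) * (1 + (\<epsilon> * ln 2) * k)"
    using c assms by (simp add: distrib_left distrib_right)
  also have "\<dots> \<le> (1 + 1 / (\<epsilon> * ln 2)) * 2 powr (\<epsilon> * k)"
    using e c by (intro mult_left_mono) auto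
  finally show ?thesis .
qed

text \<open>Only the primes \<open>p < 2\<^bsup>1/\<epsilon>\<^esup>\<close> contribute a factor exceeding \<open>p\<^bsup>\<epsilon>k\<^esup>\<close>.\<close>

lemma divisor_bound:
  fixes \<epsilon> :: real
  assumes "\<epsilon> > 0"
  obtains C where "C > 0" "\<And>n::nat. n > 0 \<Longrightarrow> real (card {a::nat. a dvd n}) \<le> C * real n powr \<epsilon>"
proof -
  define D where "D = 1 + 1 / (\<epsilon> * ln 2)"
  have D: "D \<ge> 1" using assms by (simp add: D_def)
  define P where "P = {p::nat. prime p \<and> real p powr \<epsilon> < 2}"
  have finP: "finite P"
  proof (rule finite_subset)
    show "P \<subseteq> {..nat \<lceil>2 powr (1 / \<epsilon>)\<rceil>}"
    proof
      fix p assume p: "p \<in> P"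
      then have "(real p powr \<epsilon>) powr (1 / \<epsilon>) \<le> 2 powr (1 / \<epsilon>)"
        using assms by (intro powr_mono2) (auto simp: P_def)
      moreover have "real p > 0" using p by (auto simp: P_def prime_gt_0_nat)
      ultimately have "real p \<le> 2 powr (1 / \<epsilon>)" using assms by (simp add: powr_powr)
      then show "p \<in> {..nat \<lceil>2 powr (1 / \<epsilon>)\<rceil>}" by (simp add: le_nat_iff) linarith
    qed
  qed simp
  \<comment> \<open>Strong induction strips off a full prime power at a time. A factor
    \<open>D\<close> is paid only for primes in \<open>P\<close>, so its exponent is at most
    \<open>card P\<close>, whatever \<open>n\<close> is.\<close>
  have main: "real (card {a. a dvd n}) \<le> D ^ card (P \<inter> prime_factors n) * n powr \<epsilon>" if "n > 0" for n :: nat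
    using that
  proof (induction n rule: less_induct)
    case (less n)
    show ?case
    proof (cases "n = 1")
      case True
      then show ?thesis by simp
    next
      case False
      then obtain p where p: "prime p" "p dvd n" using prime_factor_nat by blast
      define k where "k = multiplicity p n"
      obtain m where n: "n = p ^ k * m" and pm: "\<not> p dvd m"
        unfolding k_def using multiplicity_decompose'[of n p] p less.prems by (metis not_gr_zero not_prime_unit)
      have m0: "m > 0" using n less.prems by (cases m) auto
      have k0: "k > 0" using p less.prems unfolding k_def by (simp add: prime_multiplicity_gt_zero_iff)
      have pk: "p ^ k > 1" by (rule one_less_power[OF prime_gt_1_nat[OF p(1)] k0])
      then have "m < n" using n m0 by simp
      then have IH: "real (card {a. a dvd m}) \<le> D ^ card (P \<inter> prime_factors m) * m powr \<epsilon>" using less.IH m0 by blast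
      have pf: "prime_factors n = insert p (prime_factors m)"

      proof -
        have "prime_factors n = prime_factors (p ^ k) \<union> prime_factors m"
          unfolding n using m0 prime_gt_0_nat[OF p(1)] by (intro prime_factors_product) auto
        also have "prime_factors (p ^ k) = {p}"
          using p k0 by (simp add: prime_factorization_prime_power)
        finally show ?thesis by simp
      qed
      have pnot: "p \<notin> prime_factors m" using pm by auto
      have pw: "real (p ^ k) powr \<epsilon> = (real p powr \<epsilon>) ^ k"
        using p prime_gt_0_nat by (simp add: powr_power powr_realpow[symmetric] powr_powr mult.commute)
      have "real (card {a. a dvd n}) \<le> real ((k + 1) * card {a. a dvd m})"
        unfolding n using card_divisors_prime_power_mult[OF p(1) m0, of k] by (simp only: of_nat_le_iff)
      also have "\<dots> = (real k + 1) * real (card {a. a dvd m})" by (simp add: distrib_right)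
      also have "\<dots> \<le> (D ^ (if p \<in> P then 1 else 0) * real (p ^ k) powr \<epsilon>) * (D ^ card (P \<inter> prime_factors m) * m powr \<epsilon>)"
      proof (intro mult_mono IH)
        show "real k + 1 \<le> D ^ (if p \<in> P then 1 else 0) * real (p ^ k) powr \<epsilon>"
        proof (cases "p \<in> P")
          case True
          have "2 powr (\<epsilon> * k) = (2 powr \<epsilon>) ^ k" by (simp add: powr_power mult.commute)
          also have "\<dots> \<le> (real p powr \<epsilon>) ^ k"
            using assms p prime_ge_2_nat[of p] by (intro power_mono powr_mono2) auto
          finally have "D * 2 powr (\<epsilon> * k) \<le> D * real (p ^ k) powr \<epsilon>" unfolding pw using D by (intro mult_left_mono) auto
          then show ?thesis using nat_le_two_powr[OF assms, of k] True by (simp add: D_def)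
        next
          case False
          then have "2 ^ k \<le> (real p powr \<epsilon>) ^ k" using p by (intro power_mono) (auto simp: P_def)
          moreover have "real k + 1 \<le> 2 ^ k"
          proof -
            have "Suc k \<le> 2 ^ k" using less_exp[of k] by (simp only: Suc_le_eq)
            then have "real (Suc k) \<le> real (2 ^ k)" by (simp only: of_nat_le_iff)
            then show ?thesis by simp
          qed
          ultimately show ?thesis using False pw by simp
        qed
      qed (use D in auto)
      also have "\<dots> = (D ^ (if p \<in> P then 1 else 0) * D ^ card (P \<inter> prime_factors m)) * (real (p ^ k) powr \<epsilon> * m powr \<epsilon>)"
        by (simp add: mult_ac)
      also have "real (p ^ k) powr \<epsilon> * m powr \<epsilon> = n powr \<epsilon>" unfolding n by (simp add: powr_mult)
      also have "D ^ (if p \<in> P then 1 else 0) * D ^ card (P \<inter> prime_factors m) = D ^ card (P \<inter> prime_factors n)"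
        unfolding pf using pnot finP by (auto simp: Int_insert_right)
      finally show ?thesis .
    qed
  qed
  have "real (card {a. a dvd n}) \<le> D ^ card P * n powr \<epsilon>" if "n > 0" for n :: nat
  proof -
    have "D ^ card (P \<inter> prime_factors n) \<le> D ^ card P"
      using D finP by (intro power_increasing card_mono) auto
    from order_trans[OF main[OF that] mult_right_mono[OF this powr_ge_zero]] show ?thesis .
  qed
  moreover have "D ^ card P > 0" using D by simp
  ultimately show ?thesis by (intro that[of "D ^ card P"])
qed

section \<open>Periodic bump functions\<close>

definition trig_poly :: "(int \<Rightarrow> complex) \<Rightarrow> real \<Rightarrow> complex" where
  "trig_poly c t = (\<Sum>k | c k \<noteq> 0. c k * unit_exp (of_int k * t))"

lemma trig_poly_superset:
  assumes "finite S" "{k. c k \<noteq> 0} \<subseteq> S"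
  shows "trig_poly c t = (\<Sum>k\<in>S. c k * unit_exp (of_int k * t))"
  unfolding trig_poly_def using assms by (intro sum.mono_neutral_left) auto

definition is_trig_poly :: "(real \<Rightarrow> complex) \<Rightarrow> bool" where
  "is_trig_poly f \<longleftrightarrow> (\<exists>c. finite {k. c k \<noteq> 0} \<and> (\<forall>t. f t = trig_poly c t))"

lemma is_trig_poly_const: "is_trig_poly (\<lambda>t. a)"
proof -
  let ?c = "\<lambda>k::int. if k = 0 then a else 0"
  have sub: "{k. ?c k \<noteq> 0} \<subseteq> {0}" by auto
  then have "finite {k. ?c k \<noteq> 0}" by (rule finite_subset) simp
  moreover have "a = trig_poly ?c t" for t
    by (subst trig_poly_superset[OF _ sub]) auto
  ultimately show ?thesis unfolding is_trig_poly_def by (intro exI[of _ ?c]) simp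
qed

lemma is_trig_poly_add:
  assumes "is_trig_poly f" "is_trig_poly g"
  shows "is_trig_poly (\<lambda>t. f t + g t)"
proof -
  obtain c d where c: "finite {k. c k \<noteq> 0}" "\<And>t. f t = trig_poly c t"
    and d: "finite {k. d k \<noteq> 0}" "\<And>t. g t = trig_poly d t"
    using assms unfolding is_trig_poly_def by metis
  let ?S = "{k. c k \<noteq> 0} \<union> {k. d k \<noteq> 0}"
  have S: "finite ?S" using c d by simp
  have "{k. c k + d k \<noteq> 0} \<subseteq> ?S" by auto
  then have "f t + g t = trig_poly (\<lambda>k. c k + d k) t" for t
    using S by (simp add: c(2) d(2) trig_poly_superset[of ?S] sum.distrib distrib_right)
  moreover have "finite {k. c k + d k \<noteq> 0}" by (rule finite_subset[OF _ S]) auto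
  ultimately show ?thesis unfolding is_trig_poly_def by (intro exI[of _ "\<lambda>k. c k + d k"]) simp
qed

lemma is_trig_poly_mult_unit_exp:
  assumes "is_trig_poly f"
  shows "is_trig_poly (\<lambda>t. a * unit_exp (of_int j * t) * f t)"
proof -
  obtain c where c: "finite {k. c k \<noteq> 0}" "\<And>t. f t = trig_poly c t"
    using assms unfolding is_trig_poly_def by metis
  let ?S = "{k. c k \<noteq> 0}" and ?d = "\<lambda>k. a * c (k - j)"
  have sub: "{k. ?d k \<noteq> 0} \<subseteq> (\<lambda>k. k + j) ` ?S"
  proof
    fix k assume "k \<in> {k. ?d k \<noteq> 0}"
    then show "k \<in> (\<lambda>k. k + j) ` ?S" by (intro image_eqI[of _ _ "k - j"]) auto
  qed
  have "a * unit_exp (of_int j * t) * f t = trig_poly ?d t" for t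
  proof -
    have "trig_poly ?d t = (\<Sum>k\<in>(\<lambda>k. k + j) ` ?S. ?d k * unit_exp (of_int k * t))"
      using c(1) sub by (intro trig_poly_superset) auto
    also have "\<dots> = (\<Sum>k\<in>?S. a * c k * unit_exp (of_int (k + j) * t))"
      by (subst sum.reindex) auto
    also have "\<dots> = a * unit_exp (of_int j * t) * f t"
      unfolding c(2) trig_poly_def sum_distrib_left of_int_add distrib_right unit_exp_add by (simp add: mult_ac)
    finally show ?thesis by simp
  qed
  moreover have "finite {k. ?d k \<noteq> 0}" using finite_subset[OF sub] c(1) by blast
  ultimately show ?thesis unfolding is_trig_poly_def by (intro exI[of _ ?d]) simp
qed

lemma is_trig_poly_cmult: "is_trig_poly f \<Longrightarrow> is_trig_poly (\<lambda>t. a * f t)"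
  using is_trig_poly_mult_unit_exp[of f a 0] by simp

lemma is_trig_poly_sum:
  "finite A \<Longrightarrow> (\<And>i. i \<in> A \<Longrightarrow> is_trig_poly (f i)) \<Longrightarrow> is_trig_poly (\<lambda>t. \<Sum>i\<in>A. f i t)"
  by (induction A rule: finite_induct) (auto intro: is_trig_poly_add is_trig_poly_const)

lemma cos_unit_exp: "of_real (cos (2 * pi * t)) = (unit_exp t + unit_exp (- t)) / 2"
  by (simp add: unit_exp_minus) (simp add: unit_exp_def complex_eq_iff)

text \<open>The sign \<open>s\<close> will be 1 and -1: Bernstein polynomials contain both
  \<open>(1 + cos) / 2\<close> and its complement \<open>(1 - cos) / 2\<close>.\<close>

lemma is_trig_poly_mult_cos:
  assumes "is_trig_poly f"
  shows "is_trig_poly (\<lambda>t. of_real ((1 + s * cos (2 * pi * t)) / 2) * f t)"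
proof -
  have eq: "of_real ((1 + s * cos (2 * pi * t)) / 2) * f t =
      (1 / 2) * f t + (of_real s / 4 * unit_exp (of_int 1 * t) * f t + of_real s / 4 * unit_exp (of_int (- 1) * t) * f t)" for t
    unfolding of_real_divide of_real_add of_real_mult cos_unit_exp by (simp add: field_simps)
  show ?thesis
    unfolding eq by (intro is_trig_poly_add is_trig_poly_cmult is_trig_poly_mult_unit_exp assms)
qed

lemma is_trig_poly_cos_power:
  "is_trig_poly f \<Longrightarrow> is_trig_poly (\<lambda>t. of_real (((1 + s * cos (2 * pi * t)) / 2) ^ k) * f t)"
proof (induction k)
  case (Suc k)
  then have "is_trig_poly (\<lambda>t. of_real ((1 + s * cos (2 * pi * t)) / 2) * (of_real (((1 + s * cos (2 * pi * t)) / 2) ^ k) * f t))"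
    by (intro is_trig_poly_mult_cos) simp
  then show ?case by (simp add: mult_ac)
qed simp

text \<open>Bernstein polynomials in \<open>u = (1 + cos (2 * pi * t)) / 2\<close> are combinations
  of products of powers of \<open>u\<close> and \<open>1 - u\<close>, both of which are
  trigonometric polynomials. This reaches the initial bump because that bump depends on
  \<open>t\<close> only through the cosine.\<close>

lemma trig_poly_approx:
  fixes f :: "real \<Rightarrow> real"
  assumes "continuous_on {0..1} f" "\<eta> > 0"
  obtains c where "finite {k. c k \<noteq> 0}"
    and "\<And>t. norm (of_real (f ((1 + cos (2 * pi * t)) / 2)) - trig_poly c t) \<le> \<eta>"
proof -
  obtain n where n: "\<And>x. x \<in> {0..1} \<Longrightarrow> \<bar>f x - (\<Sum>k\<le>n. f (k / n) * Bernstein n k x)\<bar> < \<eta>"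
    using Bernstein_Weierstrass[OF assms] by auto
  let ?p = "\<lambda>t. \<Sum>k\<le>n. of_real (f (k / n)) * (of_nat (n choose k) * (of_real (((1 + 1 * cos (2 * pi * t)) / 2) ^ k) *
      (of_real (((1 + (- 1) * cos (2 * pi * t)) / 2) ^ (n - k)) * 1))) :: complex"
  have "is_trig_poly ?p"
    by (intro is_trig_poly_sum is_trig_poly_cmult is_trig_poly_cos_power is_trig_poly_const) auto
  then obtain c where c: "finite {k. c k \<noteq> 0}" "\<And>t. ?p t = trig_poly c t"
    unfolding is_trig_poly_def by metis
  have "norm (of_real (f ((1 + cos (2 * pi * t)) / 2)) - trig_poly c t) \<le> \<eta>" for t
  proof -
    define u where "u = (1 + cos (2 * pi * t)) / 2"
    have "u \<in> {0..1}"

    proof -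
      have "0 \<le> 1 + cos (2 * pi * t)" "1 + cos (2 * pi * t) \<le> 2"
        using cos_ge_minus_one[of "2 * pi * t"] cos_le_one[of "2 * pi * t"] by linarith+
      then show ?thesis by (simp add: u_def)
    qed
    then have "\<bar>f u - (\<Sum>k\<le>n. f (k / n) * Bernstein n k u)\<bar> \<le> \<eta>" using n[of u] by linarith
    moreover have "?p t = of_real (\<Sum>k\<le>n. f (k / n) * Bernstein n k u)"
    proof -
      have "(1 + (- 1) * cos (2 * pi * t)) / 2 = 1 - u" "(1 + 1 * cos (2 * pi * t)) / 2 = u"
        by (simp_all add: u_def field_simps)
      then show ?thesis by (simp only: Bernstein_def of_real_sum of_real_mult of_real_of_nat_eq mult_ac mult_1_right mult_1_left)
    qed
    ultimately show ?thesis
      unfolding c(2)[of t, symmetric] u_def[symmetric] by (simp only: of_real_diff[symmetric] norm_of_real)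
  qed
  with c(1) that show ?thesis by blast
qed

lemma unit_exp_has_vector_derivative:
  "((\<lambda>t. unit_exp (j * t)) has_vector_derivative unit_exp (j * t) * (2 * pi * \<i> * j)) (at t within A)"
proof -
  have eq: "unit_exp (j * t) = exp (t *\<^sub>R (2 * pi * \<i> * j))" for t
    by (simp add: unit_exp_def cis_conv_exp scaleR_conv_of_real mult_ac)
  show ?thesis unfolding eq by (rule exp_scaleR_has_vector_derivative_right)
qed

lemma unit_exp_has_integral:
  assumes "j \<noteq> 0" "a \<le> b"
  shows "((\<lambda>t. unit_exp (j * t)) has_integral (unit_exp (j * b) - unit_exp (j * a)) / (2 * pi * \<i> * j)) {a..b}"
proof -
  have "((\<lambda>t. unit_exp (j * t) * (2 * pi * \<i> * j)) has_integral (unit_exp (j * b) - unit_exp (j * a))) {a..b}"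
    by (rule fundamental_theorem_of_calculus[OF assms(2)]) (rule unit_exp_has_vector_derivative)
  then have "((\<lambda>t. unit_exp (j * t) * (2 * pi * \<i> * j) / (2 * pi * \<i> * j)) has_integral
      (unit_exp (j * b) - unit_exp (j * a)) / (2 * pi * \<i> * j)) {a..b}"
    by (rule has_integral_divide)
  then show ?thesis using assms(1) by simp
qed

text \<open>Orthogonality of characters. It turns uniform closeness to a bump into bounds on single
  coefficients.\<close>

lemma trig_poly_coeff_integral:
  assumes "finite {k. c k \<noteq> 0}"
  shows "((\<lambda>t. trig_poly c t * unit_exp (- (of_int k * t))) has_integral c k) {0..1}"
proof -
  let ?S = "insert k {k. c k \<noteq> 0}"
  have S: "finite ?S" using assms by simp
  have "((\<lambda>t. c j * unit_exp (of_int (j - k) * t)) has_integral (if j = k then c k else 0)) {0..1}" for j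
  proof (cases "j = k")
    case True
    then show ?thesis using has_integral_const_real[of "c k" 0 1] by simp
  next
    case False
    then have "((\<lambda>t. unit_exp (of_int (j - k) * t)) has_integral
        (unit_exp (of_int (j - k) * 1) - unit_exp (of_int (j - k) * 0)) / (2 * pi * \<i> * of_int (j - k))) {0..1}"
      using unit_exp_has_integral[of "of_int (j - k)" 0 1] by simp
    then have "((\<lambda>t. unit_exp (of_int (j - k) * t)) has_integral 0) {0..1}"
      unfolding mult_1_right unit_exp_of_int by simp
    from has_integral_mult_right[OF this, of "c j"] False show ?thesis by simp
  qed
  then have "((\<lambda>t. \<Sum>j\<in>?S. c j * unit_exp (of_int (j - k) * t)) has_integral (\<Sum>j\<in>?S. if j = k then c k else 0)) {0..1}"
    by (intro has_integral_sum S)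
  moreover have "(\<Sum>j\<in>?S. if j = k then c k else 0) = c k" using S by simp
  moreover have "trig_poly c t * unit_exp (- (of_int k * t)) = (\<Sum>j\<in>?S. c j * unit_exp (of_int (j - k) * t))" for t
    using S by (subst trig_poly_superset[of ?S])
      (auto simp: sum_distrib_right mult.assoc left_diff_distrib simp flip: unit_exp_add intro!: sum.cong)
  ultimately show ?thesis by simp
qed

lemma continuous_trig_poly: "continuous_on A (trig_poly c)"
  unfolding trig_poly_def by (intro continuous_intros)

lemma trig_poly_bounded: "norm (trig_poly c t) \<le> (\<Sum>k | c k \<noteq> 0. norm (c k))"
  unfolding trig_poly_def by (intro order_trans[OF norm_sum] sum_mono) (simp add: norm_mult)

text \<open>Uniform limits of continuous functions are continuous. An infinite support of
  \<open>c\<close> is harmless, since \<open>trig_poly c\<close> then has the default value 0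
  everywhere.\<close>

lemma continuous_if_trig_poly_approx:
  fixes \<psi> :: "real \<Rightarrow> real"
  assumes "\<And>\<eta>. \<eta> > 0 \<Longrightarrow> \<exists>c. \<forall>t. norm (of_real (\<psi> t) - trig_poly c t) \<le> \<eta>"
  shows "continuous_on UNIV \<psi>"
proof -
  have "\<exists>c. \<forall>t. norm (of_real (\<psi> t) - trig_poly c t) \<le> 1 / (1 + real N)" for N
    by (rule assms) simp
  then obtain c where c: "\<And>N t. norm (of_real (\<psi> t) - trig_poly (c N) t) \<le> 1 / (1 + real N)" by metis
  have "uniform_limit UNIV (\<lambda>N. trig_poly (c N)) (\<lambda>t. complex_of_real (\<psi> t)) sequentially"
  proof (rule uniform_limitI)
    fix e :: real assume "e > 0"
    then obtain N0 where N0: "N0 > 0" "1 / real N0 < e" using nat_approx_posE by (metis zero_less_Suc)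
    show "\<forall>\<^sub>F N in sequentially. \<forall>t\<in>UNIV. dist (trig_poly (c N) t) (complex_of_real (\<psi> t)) < e"
      unfolding eventually_sequentially
    proof (intro exI[of _ N0] allI impI ballI)
      fix N t assume "N0 \<le> N"
      then have "1 / (1 + real N) \<le> 1 / real N0" using N0 by (intro divide_left_mono) auto
      then show "dist (trig_poly (c N) t) (complex_of_real (\<psi> t)) < e"
        using c[of t N] N0 by (simp add: dist_norm norm_minus_commute)
    qed
  qed
  then have "continuous_on UNIV (\<lambda>t. complex_of_real (\<psi> t))"
    by (rule uniform_limit_theorem[rotated]) (auto intro!: always_eventually continuous_trig_poly)
  from continuous_on_Re[OF this] show ?thesis by simp
qed

section \<open>Nonnegative periodic bumps with controlled coefficients\<close>

text \<open>A cosine truncated at its value at \<delta> is periodic, continuous and zero beyond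
  distance \<delta> from the integers; dividing by its mean gives integral 1. Nonnegativity then
  bounds every coefficient by this integral, up to the approximation error.\<close>

lemma bump_base:
  fixes \<delta> :: real
  assumes "0 < \<delta>" "\<delta> \<le> 1 / 2"
  obtains \<psi> :: "real \<Rightarrow> real" where "\<And>t. \<psi> t \<ge> 0" and "\<And>t. \<psi> t \<noteq> 0 \<Longrightarrow> \<exists>r::int. \<bar>t - of_int r\<bar> \<le> \<delta>"
    and "\<And>\<eta>. \<eta> > 0 \<Longrightarrow> \<exists>c. finite {k. c k \<noteq> 0} \<and> c 0 = 1 \<and> (\<forall>k. norm (c k) \<le> 2) \<and>
      (\<forall>t. norm (of_real (\<psi> t) - trig_poly c t) \<le> \<eta>)"
proof -
  define g where "g t = max 0 (cos (2 * pi * t) - cos (2 * pi * \<delta>))" for t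
  define I where "I = integral {0..1} g"
  have cont: "continuous_on A g" for A unfolding g_def by (intro continuous_intros)
  have gpos: "g t \<ge> 0" for t by (simp add: g_def)
  have "cos (2 * pi * \<delta>) < cos 0" using assms by (intro cos_monotone_0_pi) auto
  then have g0: "g 0 > 0" by (simp add: g_def)
  have "I \<noteq> 0"
  proof
    assume "I = 0"
    then have "\<forall>x\<in>{0..1}. g x = 0"
      unfolding I_def by (subst (asm) integral_eq_0_iff) (auto intro: cont gpos)
    then show False using g0 by force
  qed
  moreover have "I \<ge> 0" unfolding I_def by (intro integral_nonneg integrable_continuous_real cont) (auto simp: g_def)
  ultimately have I: "I > 0" by simp
  define \<psi> where "\<psi> t = g t / I" for t
  have int_psi: "(\<psi> has_integral 1) {0..1}"
  proof -
    have "(g has_integral I) {0..1}" unfolding I_def by (intro integrable_integral integrable_continuous_real cont)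
    from has_integral_divide[OF this, of I] have "((\<lambda>t. g t / I) has_integral 1) {0..1}" using I by simp
    then show ?thesis by (rule has_integral_eq[rotated]) (simp add: \<psi>_def)
  qed
  have int_cpsi: "((\<lambda>t. complex_of_real (\<psi> t)) has_integral 1) {0..1}"
    using has_integral_linear[OF int_psi bounded_linear_of_real[where ?'a = complex]] by (simp add: o_def)
  show ?thesis
  proof (rule that[of \<psi>])
    show "\<psi> t \<ge> 0" for t using I by (simp add: \<psi>_def g_def)
    show "\<exists>r::int. \<bar>t - of_int r\<bar> \<le> \<delta>" if "\<psi> t \<noteq> 0" for t
    proof (rule exI[of _ "round t"], rule ccontr)
      define s where "s = \<bar>t - of_int (round t)\<bar>"
      assume "\<not> \<bar>t - of_int (round t)\<bar> \<le> \<delta>"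
      then have s: "s > \<delta>" "s \<le> 1 / 2" using of_int_round_abs_le[of t] by (auto simp: s_def abs_minus_commute)
      have "cos (2 * pi * t) = cos (2 * pi * s)"
      proof -
        have "cos (2 * pi * s) = cos (2 * pi * (t - of_int (round t)))"

        proof -
          have "2 * pi * s = \<bar>2 * pi * (t - of_int (round t))\<bar>" by (simp add: s_def abs_mult)
          then show ?thesis by (simp only: cos_abs_real)
        qed
        also have "\<dots> = Re (unit_exp (t - of_int (round t)))" by (simp add: unit_exp_def)
        also have "unit_exp (t - of_int (round t)) = unit_exp t"
          using unit_exp_add[of t "of_int (- round t)"] by (simp only: unit_exp_of_int) simp
        finally show ?thesis by (simp add: unit_exp_def)
      qed
      also have "\<dots> < cos (2 * pi * \<delta>)" using s assms by (intro cos_monotone_0_pi) auto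
      finally show False using that by (simp add: \<psi>_def g_def)
    qed
    fix \<eta> :: real assume eta: "\<eta> > 0"
    \<comment> \<open>Half of the error is spent on the approximation and half on resetting the
      constant coefficient to exactly 1; the cap at 1 keeps all coefficients at most 2.\<close>
    define \<eta>' where "\<eta>' = min (\<eta> / 2) 1"
    have eta': "\<eta>' > 0" "\<eta>' \<le> 1" "2 * \<eta>' \<le> \<eta>" using eta by (auto simp: \<eta>'_def)
    have contf: "continuous_on {0..1} (\<lambda>u. max 0 (2 * u - 1 - cos (2 * pi * \<delta>)) / I)"
      using I by (intro continuous_intros) auto
    obtain c where c: "finite {k. c k \<noteq> 0}"
      "\<And>t. norm (of_real (max 0 (2 * ((1 + cos (2 * pi * t)) / 2) - 1 - cos (2 * pi * \<delta>)) / I) - trig_poly c t) \<le> \<eta>'"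
      by (rule trig_poly_approx[OF contf eta'(1)]) (rule that)
    have app: "norm (of_real (\<psi> t) - trig_poly c t) \<le> \<eta>'" for t

    proof -
      have "2 * ((1 + y) / 2) - 1 - z = y - z" for y z :: real by (simp add: field_simps)
      from c(2)[of t, unfolded this] show ?thesis by (simp only: \<psi>_def g_def)
    qed
    have c0: "norm (1 - c 0) \<le> \<eta>'"
    proof -
      have "((\<lambda>t. of_real (\<psi> t) - trig_poly c t) has_integral (1 - c 0)) {0..1}"
        using has_integral_diff[OF int_cpsi trig_poly_coeff_integral[OF c(1), of 0]] by simp
      from has_integral_bound_real[OF _ _ this, of \<eta>' "{}"] show ?thesis using app eta' by auto
    qed
    have ck: "norm (c k) \<le> 2" for k
    proof -
      have "norm (integral {0..1} (\<lambda>t. trig_poly c t * unit_exp (- (of_int k * t)))) \<le> integral {0..1} (\<lambda>t. \<psi> t + \<eta>')"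
      proof (rule integral_norm_bound_integral)
        show "(\<lambda>t. trig_poly c t * unit_exp (- (of_int k * t))) integrable_on {0..1}"
          using trig_poly_coeff_integral[OF c(1)] by (rule has_integral_integrable)
        show "(\<lambda>t. \<psi> t + \<eta>') integrable_on {0..1}"
          using int_psi by (intro integrable_add integrable_const_ivl) (auto simp: has_integral_integrable)
        show "norm (trig_poly c t * unit_exp (- (of_int k * t))) \<le> \<psi> t + \<eta>'" for t
        proof -
          have "norm (trig_poly c t) \<le> norm (complex_of_real (\<psi> t)) + norm (of_real (\<psi> t) - trig_poly c t)"
            using norm_triangle_sub[of "trig_poly c t" "complex_of_real (\<psi> t)"] by (simp add: norm_minus_commute)
          moreover have "\<psi> t \<ge> 0" using I by (simp add: \<psi>_def g_def)
          ultimately show ?thesis using app[of t] by (simp add: norm_mult)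
        qed
      qed
      also have "integral {0..1} (\<lambda>t. \<psi> t + \<eta>') = 1 + \<eta>'"
        using has_integral_add[OF int_psi has_integral_const_real[of \<eta>' 0 1]] by (intro integral_unique) simp
      finally show ?thesis using trig_poly_coeff_integral[OF c(1), of k] eta' by (auto simp: integral_unique)
    qed
    define d where "d = c(0 := 1)"
    have fin: "finite {k. d k \<noteq> 0}" by (rule finite_subset[of _ "insert 0 {k. c k \<noteq> 0}"]) (use c(1) in \<open>auto simp: d_def split: if_splits\<close>)
    have "trig_poly d t = trig_poly c t + (1 - c 0)" for t
    proof -
      let ?S = "insert 0 {k. c k \<noteq> 0}"
      have S: "finite ?S" using c(1) by simp
      have "trig_poly d t = (\<Sum>k\<in>?S. d k * unit_exp (of_int k * t))"
        by (rule trig_poly_superset[OF S]) (auto simp: d_def split: if_splits)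
      also have "\<dots> = (\<Sum>k\<in>?S. c k * unit_exp (of_int k * t) + (if k = 0 then 1 - c 0 else 0))"
        by (intro sum.cong) (auto simp: d_def algebra_simps)
      also have "\<dots> = trig_poly c t + (1 - c 0)"

      proof -
        have "trig_poly c t = (\<Sum>k\<in>?S. c k * unit_exp (of_int k * t))"
          by (rule trig_poly_superset[OF S]) auto
        then show ?thesis using S by (simp add: sum.distrib)
      qed
      finally show ?thesis .
    qed
    then have eq: "of_real (\<psi> t) - trig_poly d t = (of_real (\<psi> t) - trig_poly c t) - (1 - c 0)" for t by simp
    have "norm (of_real (\<psi> t) - trig_poly d t) \<le> \<eta>" for t
      unfolding eq using norm_triangle_ineq4[of "of_real (\<psi> t) - trig_poly c t" "1 - c 0"] app[of t] c0 eta' by linarith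
    moreover have "d 0 = 1" "norm (d k) \<le> 2" for k using ck by (auto simp: d_def)
    ultimately show "\<exists>c. finite {k. c k \<noteq> 0} \<and> c 0 = 1 \<and> (\<forall>k. norm (c k) \<le> 2) \<and>
      (\<forall>t. norm (of_real (\<psi> t) - trig_poly c t) \<le> \<eta>)" using fin by blast
  qed
qed

text \<open>Averaging over a window of half-width \<open>h\<close> widens the support by
  \<open>h\<close> and multiplies the coefficient at \<open>k\<close> by a sinc factor of modulus at
  most \<open>1 / (2 * pi * h * \<bar>k\<bar>)\<close>; \<open>j\<close> averagings give decay of
  order \<open>j\<close>. The factor is applied to the approximants, so that all coefficient
  families stay finite.\<close>

lemma bump_smoothing:
  fixes \<delta> h :: real
  assumes "0 < \<delta>" "\<delta> \<le> 1 / 2" "h > 0"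
  shows "\<exists>\<psi> :: real \<Rightarrow> real. (\<forall>t. \<psi> t \<ge> 0) \<and> (\<forall>t. \<psi> t \<noteq> 0 \<longrightarrow> (\<exists>r::int. \<bar>t - of_int r\<bar> \<le> \<delta> + real j * h)) \<and>
    (\<forall>\<eta>>0. \<exists>c. finite {k. c k \<noteq> 0} \<and> c 0 = 1 \<and> (\<forall>k. norm (c k) \<le> 2) \<and>
      (\<forall>k. k \<noteq> 0 \<longrightarrow> norm (c k) \<le> 2 * (1 / (2 * pi * h * \<bar>of_int k\<bar>)) ^ j) \<and>
      (\<forall>t. norm (of_real (\<psi> t) - trig_poly c t) \<le> \<eta>))"
proof (induction j)
  case 0
  obtain \<psi> :: "real \<Rightarrow> real" where "\<And>t. \<psi> t \<ge> 0" and "\<And>t. \<psi> t \<noteq> 0 \<Longrightarrow> \<exists>r::int. \<bar>t - of_int r\<bar> \<le> \<delta>"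
    and "\<And>\<eta>. \<eta> > 0 \<Longrightarrow> \<exists>c. finite {k. c k \<noteq> 0} \<and> c 0 = 1 \<and> (\<forall>k. norm (c k) \<le> 2) \<and>
      (\<forall>t. norm (of_real (\<psi> t) - trig_poly c t) \<le> \<eta>)"
    using bump_base[OF assms(1,2)] by blast
  then show ?case by (intro exI[of _ \<psi>]) (simp, metis)
next
  case (Suc j)
  then obtain \<psi> :: "real \<Rightarrow> real" where psi: "(\<forall>t. \<psi> t \<ge> 0) \<and> (\<forall>t. \<psi> t \<noteq> 0 \<longrightarrow> (\<exists>r::int. \<bar>t - of_int r\<bar> \<le> \<delta> + real j * h)) \<and>
    (\<forall>\<eta>>0. \<exists>c. finite {k. c k \<noteq> 0} \<and> c 0 = 1 \<and> (\<forall>k. norm (c k) \<le> 2) \<and>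
      (\<forall>k. k \<noteq> 0 \<longrightarrow> norm (c k) \<le> 2 * (1 / (2 * pi * h * \<bar>of_int k\<bar>)) ^ j) \<and>
      (\<forall>t. norm (of_real (\<psi> t) - trig_poly c t) \<le> \<eta>))" by (rule exE)
  note pos = psi[THEN conjunct1, rule_format]
    and supp = psi[THEN conjunct2, THEN conjunct1, rule_format]
    and app = psi[THEN conjunct2, THEN conjunct2, rule_format]
  have "continuous_on UNIV \<psi>" by (rule continuous_if_trig_poly_approx) (use app in blast)
  then have cont: "continuous_on A (\<lambda>s. \<psi> (t + s))" for A t
    by (rule continuous_on_compose2) (auto intro!: continuous_intros)
  define \<psi>' where "\<psi>' t = integral {- h..h} (\<lambda>s. \<psi> (t + s)) / (2 * h)" for t
  define \<sigma> where "\<sigma> k = integral {- h..h} (\<lambda>s. unit_exp (of_int k * s)) / of_real (2 * h)" for k :: int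
  have avg_bound: "norm (integral {- h..h} f / of_real (2 * h)) \<le> B"
    if "continuous_on {- h..h} f" "\<And>s. s \<in> {- h..h} \<Longrightarrow> norm (f s) \<le> B" for f :: "real \<Rightarrow> complex" and B
  proof -
    have "norm (integral {- h..h} f) \<le> B * (h - (- h))"
      using assms that by (intro integral_bound) auto
    then show ?thesis using assms by (simp add: norm_divide field_simps)
  qed
  have pos': "\<psi>' t \<ge> 0" for t
    unfolding \<psi>'_def using assms pos by (intro divide_nonneg_pos integral_nonneg integrable_continuous_real cont) auto
  have supp': "\<exists>r::int. \<bar>t - of_int r\<bar> \<le> \<delta> + real (Suc j) * h" if "\<psi>' t \<noteq> 0" for t
  proof -
    have "\<exists>s\<in>{- h..h}. \<psi> (t + s) \<noteq> 0"
    proof (rule ccontr)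
      assume "\<not> ?thesis"
      then have "integral {- h..h} (\<lambda>s. \<psi> (t + s)) = integral {- h..h} (\<lambda>s. 0)" by (intro integral_cong) auto
      then show False using that by (simp add: \<psi>'_def)
    qed
    then obtain s r where s: "s \<in> {- h..h}" "\<bar>t + s - of_int r\<bar> \<le> \<delta> + real j * h" using supp by blast
    then show ?thesis by (intro exI[of _ r]) (auto simp: distrib_right abs_le_iff)
  qed
  have sig0: "\<sigma> 0 = 1" using assms by (simp add: \<sigma>_def scaleR_conv_of_real)
  have sig1: "norm (\<sigma> k) \<le> 1" for k
    unfolding \<sigma>_def by (rule avg_bound) (auto intro!: continuous_intros)
  have sigk: "norm (\<sigma> k) \<le> 1 / (2 * pi * h * \<bar>of_int k\<bar>)" if "k \<noteq> 0" for k
  proof -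
    have "integral {- h..h} (\<lambda>s. unit_exp (of_int k * s)) =
        (unit_exp (of_int k * h) - unit_exp (of_int k * (- h))) / (2 * pi * \<i> * of_int k)"
      using unit_exp_has_integral[of "of_int k" "- h" h] that assms by (intro integral_unique) auto
    then have "norm (\<sigma> k) = norm (unit_exp (of_int k * h) - unit_exp (of_int k * (- h))) / (2 * pi * \<bar>of_int k\<bar> * (2 * h))"
      using assms by (simp add: \<sigma>_def norm_divide norm_mult)
    also have "\<dots> \<le> 2 / (2 * pi * \<bar>of_int k\<bar> * (2 * h))"
      using norm_triangle_ineq4[of "unit_exp (of_int k * h)" "unit_exp (of_int k * (- h))"] assms
      by (intro divide_right_mono) auto
    also have "\<dots> = 1 / (2 * pi * h * \<bar>of_int k\<bar>)" by simp
    finally show ?thesis .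
  qed
  have app': "\<exists>c. finite {k. c k \<noteq> 0} \<and> c 0 = 1 \<and> (\<forall>k. norm (c k) \<le> 2) \<and>
      (\<forall>k. k \<noteq> 0 \<longrightarrow> norm (c k) \<le> 2 * (1 / (2 * pi * h * \<bar>of_int k\<bar>)) ^ Suc j) \<and>
      (\<forall>t. norm (of_real (\<psi>' t) - trig_poly c t) \<le> \<eta>)" if eta: "\<eta> > 0" for \<eta>
  proof -
    obtain c where c: "finite {k. c k \<noteq> 0}" "c 0 = 1" "\<And>k. norm (c k) \<le> 2"
      "\<And>k. k \<noteq> 0 \<Longrightarrow> norm (c k) \<le> 2 * (1 / (2 * pi * h * \<bar>of_int k\<bar>)) ^ j"
      "\<And>t. norm (of_real (\<psi> t) - trig_poly c t) \<le> \<eta>" using app[OF eta] by metis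
    define d where "d k = c k * \<sigma> k" for k
    have sub: "{k. d k \<noteq> 0} \<subseteq> {k. c k \<noteq> 0}" by (auto simp: d_def)
    then have fin: "finite {k. d k \<noteq> 0}" using c(1) finite_subset by blast
    have d2: "norm (d k) \<le> 2" for k
      using mult_mono[OF c(3)[of k] sig1[of k]] by (simp add: d_def norm_mult)
    have dk: "norm (d k) \<le> 2 * (1 / (2 * pi * h * \<bar>of_int k\<bar>)) ^ Suc j" if "k \<noteq> 0" for k
    proof -
      have "norm (d k) \<le> (2 * (1 / (2 * pi * h * \<bar>of_int k\<bar>)) ^ j) * (1 / (2 * pi * h * \<bar>of_int k\<bar>))"
        unfolding d_def norm_mult using assms by (intro mult_mono c(4) sigk that) auto
      then show ?thesis by (simp only: power_Suc2 mult.assoc)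
    qed
    have appr: "norm (of_real (\<psi>' t) - trig_poly d t) \<le> \<eta>" for t
    proof -
      have "((\<lambda>s. trig_poly c (t + s)) has_integral (\<Sum>k | c k \<noteq> 0. c k * unit_exp (of_int k * t) * integral {- h..h} (\<lambda>s. unit_exp (of_int k * s)))) {- h..h}"
      proof -
        have "((\<lambda>s. c k * unit_exp (of_int k * t) * unit_exp (of_int k * s)) has_integral
            c k * unit_exp (of_int k * t) * integral {- h..h} (\<lambda>s. unit_exp (of_int k * s))) {- h..h}" for k
          by (intro has_integral_mult_right integrable_integral integrable_continuous_real continuous_intros)
        from has_integral_sum[OF c(1) this] show ?thesis
          by (simp add: trig_poly_def distrib_left unit_exp_add mult.assoc)
      qed
      then have "integral {- h..h} (\<lambda>s. trig_poly c (t + s)) / of_real (2 * h) = 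
          (\<Sum>k | c k \<noteq> 0. c k * unit_exp (of_int k * t) * integral {- h..h} (\<lambda>s. unit_exp (of_int k * s))) / of_real (2 * h)"
        by (simp add: integral_unique)
      also have "\<dots> = trig_poly d t"
        unfolding trig_poly_superset[OF c(1) sub] sum_divide_distrib by (intro sum.cong) (auto simp: d_def \<sigma>_def)
      finally have 1: "trig_poly d t = integral {- h..h} (\<lambda>s. trig_poly c (t + s)) / of_real (2 * h)" by simp
      have ctp: "continuous_on {- h..h} (\<lambda>s. trig_poly c (t + s))"
        by (rule continuous_on_compose2[OF continuous_trig_poly[of UNIV]]) (auto intro!: continuous_intros)
      have 2: "complex_of_real (\<psi>' t) = integral {- h..h} (\<lambda>s. complex_of_real (\<psi> (t + s))) / of_real (2 * h)"

      proof -
        have "((\<lambda>s. \<psi> (t + s)) has_integral integral {- h..h} (\<lambda>s. \<psi> (t + s))) {- h..h}"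
          by (intro integrable_integral integrable_continuous_real cont)
        from integral_unique[OF has_integral_linear[OF this bounded_linear_of_real[where ?'a = complex]]]
        show ?thesis by (simp add: \<psi>'_def o_def)
      qed
      have "of_real (\<psi>' t) - trig_poly d t = integral {- h..h} (\<lambda>s. of_real (\<psi> (t + s)) - trig_poly c (t + s)) / of_real (2 * h)"
        unfolding 1 2 by (subst integral_diff)
          (auto intro!: integrable_continuous_real ctp continuous_on_of_real cont simp: diff_divide_distrib)
      also have "norm \<dots> \<le> \<eta>"
        by (rule avg_bound) (auto intro!: continuous_intros ctp cont c(5))
      finally show ?thesis .
    qed
    show ?thesis using fin d2 dk appr c(2) sig0 by (intro exI[of _ d]) (auto simp: d_def)
  qed
  show ?case by (intro exI[of _ \<psi>'] conjI allI impI pos' supp' app')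
qed

lemma periodic_bump:
  fixes \<delta> :: real and K :: nat
  assumes "0 < \<delta>" "\<delta> \<le> 1" "K > 0"
  obtains \<psi> :: "real \<Rightarrow> real" and c :: "nat \<Rightarrow> int \<Rightarrow> complex" and B :: real
  where "continuous_on UNIV \<psi>" and "\<And>t. \<psi> t \<ge> 0"
    and "\<And>t. \<psi> t \<noteq> 0 \<Longrightarrow> \<exists>r::int. \<bar>t - of_int r\<bar> \<le> \<delta>"
    and "\<And>N. finite {k. c N k \<noteq> 0}" and "\<And>N. c N 0 = 1" and "\<And>N k. norm (c N k) \<le> 2"
    and "\<And>N k. k \<noteq> 0 \<Longrightarrow> norm (c N k) \<le> 2 * (K / (\<delta> * \<bar>of_int k\<bar>)) ^ K"
    and "\<And>t. (\<lambda>N. trig_poly (c N) t) \<longlonglongrightarrow> of_real (\<psi> t)" and "\<And>N t. norm (trig_poly (c N) t) \<le> B"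
proof -
  \<comment> \<open>The \<open>K\<close> averagings may widen the support by \<delta>/2 in total;
    the other half is the width of the initial bump.\<close>
  define h where "h = \<delta> / (2 * K)"
  have h: "h > 0" using assms by (simp add: h_def)
  have Kh: "\<delta> / 2 + K * h = \<delta>" using assms by (simp add: h_def field_simps)
  obtain \<psi> :: "real \<Rightarrow> real" where pos: "\<And>t. \<psi> t \<ge> 0"
    and supp: "\<And>t. \<psi> t \<noteq> 0 \<Longrightarrow> (\<exists>r::int. \<bar>t - of_int r\<bar> \<le> \<delta> / 2 + K * h)"
    and app: "\<And>\<eta>. \<eta> > 0 \<Longrightarrow> \<exists>c. finite {k. c k \<noteq> 0} \<and> c 0 = 1 \<and> (\<forall>k. norm (c k) \<le> 2) \<and>
      (\<forall>k. k \<noteq> 0 \<longrightarrow> norm (c k) \<le> 2 * (1 / (2 * pi * h * \<bar>of_int k\<bar>)) ^ K) \<and>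
      (\<forall>t. norm (of_real (\<psi> t) - trig_poly c t) \<le> \<eta>)"
    using bump_smoothing[of "\<delta> / 2" h K] assms h by auto
  have cont: "continuous_on UNIV \<psi>" by (rule continuous_if_trig_poly_approx) (use app in blast)
  have "\<exists>c. finite {k. c k \<noteq> 0} \<and> c 0 = 1 \<and> (\<forall>k. norm (c k) \<le> 2) \<and>
      (\<forall>k. k \<noteq> 0 \<longrightarrow> norm (c k) \<le> 2 * (1 / (2 * pi * h * \<bar>of_int k\<bar>)) ^ K) \<and>
      (\<forall>t. norm (of_real (\<psi> t) - trig_poly c t) \<le> 1 / (1 + real N))" for N
    by (rule app) simp
  then obtain c where c: "\<And>N. finite {k. c N k \<noteq> 0}" "\<And>N. c N 0 = 1" "\<And>N k. norm (c N k) \<le> 2"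
    "\<And>N k. k \<noteq> 0 \<Longrightarrow> norm (c N k) \<le> 2 * (1 / (2 * pi * h * \<bar>of_int k\<bar>)) ^ K"
    "\<And>N t. norm (of_real (\<psi> t) - trig_poly (c N) t) \<le> 1 / (1 + real N)" by metis
  \<comment> \<open>Two errors of at most 1: \<psi> lies within 1 of the approximant with index 0,
    and every approximant lies within 1 of \<psi>. The bound is what dominated convergence will
    need.\<close>
  define B where "B = (\<Sum>k | c 0 k \<noteq> 0. norm (c 0 k)) + 2"
  have bound: "norm (trig_poly (c N) t) \<le> B" for N t
  proof -
    have "norm (trig_poly (c N) t) \<le> \<psi> t + 1 / (1 + real N)"
      using norm_triangle_sub[of "trig_poly (c N) t" "complex_of_real (\<psi> t)"] c(5)[of t N] pos[of t]
      by (simp add: norm_minus_commute)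
    moreover have "\<psi> t \<le> norm (trig_poly (c 0) t) + 1"
      using norm_triangle_sub[of "complex_of_real (\<psi> t)" "trig_poly (c 0) t"] c(5)[of t 0] pos[of t] by simp
    moreover have "1 / (1 + real N) \<le> 1" by simp
    ultimately show ?thesis using trig_poly_bounded[of "c 0" t] unfolding B_def by linarith
  qed
  have lim: "(\<lambda>N. trig_poly (c N) t) \<longlonglongrightarrow> of_real (\<psi> t)" for t
  proof (rule LIM_zero_cancel, rule Lim_null_comparison)
    show "\<forall>\<^sub>F N in sequentially. norm (trig_poly (c N) t - complex_of_real (\<psi> t)) \<le> 1 / (1 + real N)"
      using c(5)[of t] by (intro always_eventually allI) (auto simp: norm_minus_commute)
    show "(\<lambda>N. 1 / (1 + real N)) \<longlonglongrightarrow> 0"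
      using LIMSEQ_inverse_real_of_nat by (simp add: inverse_eq_divide add.commute)
  qed
  have ck: "norm (c N k) \<le> 2 * (K / (\<delta> * \<bar>of_int k\<bar>)) ^ K" if "k \<noteq> 0" for N k
  proof -
    have "1 / (2 * pi * h * \<bar>of_int k\<bar>) = (K / (\<delta> * \<bar>of_int k\<bar>)) / pi"
      using assms by (simp add: h_def field_simps)
    also have "\<dots> \<le> (K / (\<delta> * \<bar>of_int k\<bar>)) / 1"
      using assms pi_gt3 that by (intro divide_left_mono) auto
    finally have "(1 / (2 * pi * h * \<bar>of_int k\<bar>)) ^ K \<le> (K / (\<delta> * \<bar>of_int k\<bar>)) ^ K"
      using h by (intro power_mono) auto
    then show ?thesis using c(4)[OF that, of N] by linarith
  qed
  show ?thesis by (rule that[of \<psi> c B]) (use cont pos supp Kh c ck lim bound in auto)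
qed

section \<open>Weak compactness\<close>

text \<open>Schoenberg's space-filling curve \<open>\<psi>\<close> is continuous and has a Borel right inverse \<open>g\<close> given by
  interleaving binary digits. Pushing measures forward along \<open>g\<close> and back along \<open>\<psi>\<close> reduces the
  selection theorem for measures on a cube to Helly's theorem on the line.\<close>

definition schoenberg_wave :: "real \<Rightarrow> real" where
  "schoenberg_wave t = max 0 (min 1 (1 / 2 - cos (pi * t)))"

lemma schoenberg_wave_bounds: "0 \<le> schoenberg_wave t" "schoenberg_wave t \<le> 1"
  by (auto simp: schoenberg_wave_def)

lemma continuous_on_schoenberg_wave [continuous_intros]:
  fixes f :: "'a::t2_space \<Rightarrow> real"
  shows
  "continuous_on A f \<Longrightarrow> continuous_on A (\<lambda>x. schoenberg_wave (f x))"
  unfolding schoenberg_wave_def by (intro continuous_intros)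

text \<open>Modulo its period 2 the clamped wave is constantly 0 on [0, 1/3] and constantly 1 on
  [2/3, 1]. It therefore reads a ternary digit \<open>2 * a\<close> and ignores the tail
  \<open>s\<close> behind it.\<close>

lemma schoenberg_wave_digit:
  fixes a n :: int
  assumes "a \<in> {0, 1}" "0 \<le> s" "s \<le> 1 / 3"
  shows "schoenberg_wave (2 * of_int n + 2 * of_int a / 3 + s) = of_int a"
proof -
  define y where "y = 2 * of_int a / 3 + s"
  have "pi * (2 * of_int n + y) = pi * y + of_int n * (2 * pi)" by (simp add: algebra_simps)
  then have c: "cos (pi * (2 * of_int n + y)) = cos (pi * y)"
    using cos_int_2pin sin_int_2pin[of n] by (simp add: cos_add mult.commute mult.left_commute)
  show ?thesis
  proof (cases "a = 0")
    case True
    have "cos (pi * y) \<ge> cos (pi / 3)"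
      using assms True by (intro cos_monotone_0_pi_le) (auto simp: y_def field_simps)
    then show ?thesis using True c by (simp add: schoenberg_wave_def y_def cos_60 add.assoc)
  next
    case False
    then have a: "a = 1" using assms by auto
    have "cos (pi * y) \<le> cos (pi * (2 / 3))"
      using assms a pi_gt_zero by (intro cos_monotone_0_pi_le mult_left_mono) (auto simp: y_def)
    moreover have "cos (pi * (2 / 3)) = - (1 / 2)"
    proof -
      have "cos (pi * (2 / 3)) = cos (pi - pi / 3)" by (simp add: field_simps)
      then show ?thesis by (simp only: cos_pi_minus cos_60)
    qed
    ultimately have "1 / 2 - cos (pi * y) \<ge> 1" by linarith
    then show ?thesis using a c by (simp add: schoenberg_wave_def y_def add.assoc)
  qed
qed

lemma floor_double: "\<lfloor>2 * y\<rfloor> = 2 * \<lfloor>y::real\<rfloor> + \<lfloor>2 * y\<rfloor> mod 2"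
proof -
  have "\<lfloor>y\<rfloor> = \<lfloor>2 * y\<rfloor> div 2"
    using floor_divide_real_eq_div[of 2 "2 * y"] by simp
  then show ?thesis by simp
qed

text \<open>The partial sums telescope to
  \<open>\<lfloor>2 ^ J * x\<rfloor> / 2 ^ J\<close>.\<close>

lemma binary_digits_sums:
  fixes x :: real
  assumes "0 \<le> x" "x < 1"
  shows "(\<lambda>j. of_int (\<lfloor>2 ^ Suc j * x\<rfloor> mod 2) * (1 / 2) ^ Suc j) sums x"
proof -
  have part: "(\<Sum>j<J. real_of_int (\<lfloor>2 ^ Suc j * x\<rfloor> mod 2) * (1 / 2) ^ Suc j) = of_int \<lfloor>2 ^ J * x\<rfloor> / 2 ^ J" for J
  proof (induction J)
    case 0
    have "\<lfloor>x\<rfloor> = 0" using assms by (simp add: floor_eq_iff)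
    then show ?case by simp
  next
    case (Suc J)
    have "real_of_int \<lfloor>2 ^ Suc J * x\<rfloor> = 2 * of_int \<lfloor>2 ^ J * x\<rfloor> + of_int (\<lfloor>2 ^ Suc J * x\<rfloor> mod 2)"
      using arg_cong[OF floor_double[of "2 ^ J * x"], of real_of_int] by (simp add: mult.assoc)
    then have "of_int \<lfloor>2 ^ Suc J * x\<rfloor> / 2 ^ Suc J = of_int \<lfloor>2 ^ J * x\<rfloor> / 2 ^ J + real_of_int (\<lfloor>2 ^ Suc J * x\<rfloor> mod 2) * (1 / 2) ^ Suc J"
      by (simp only: add_divide_distrib) (simp add: power_one_over field_simps)
    then show ?case using Suc by (simp only: sum.lessThan_Suc)
  qed
  have "(\<lambda>J. of_int \<lfloor>2 ^ J * x\<rfloor> / 2 ^ J - x) \<longlonglongrightarrow> 0"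
  proof (rule Lim_null_comparison)
    show "\<forall>\<^sub>F J in sequentially. norm (of_int \<lfloor>2 ^ J * x\<rfloor> / 2 ^ J - x) \<le> (1 / 2) ^ J"
    proof (intro always_eventually allI)
      fix J
      have "\<bar>of_int \<lfloor>2 ^ J * x\<rfloor> - 2 ^ J * x\<bar> \<le> 1"
        using of_int_floor_le[of "2 ^ J * x"] real_of_int_floor_add_one_gt[of "2 ^ J * x"] by (intro abs_leI) linarith+
      then have "\<bar>of_int \<lfloor>2 ^ J * x\<rfloor> - 2 ^ J * x\<bar> / 2 ^ J \<le> 1 / 2 ^ J" by (intro divide_right_mono) auto
      moreover have "of_int \<lfloor>2 ^ J * x\<rfloor> / 2 ^ J - x = (of_int \<lfloor>2 ^ J * x\<rfloor> - 2 ^ J * x) / 2 ^ J"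
        by (simp add: diff_divide_distrib)
      ultimately show "norm (of_int \<lfloor>2 ^ J * x\<rfloor> / 2 ^ J - x) \<le> (1 / 2) ^ J" by (simp add: power_one_over)
    qed
    show "(\<lambda>J. (1 / 2 :: real) ^ J) \<longlonglongrightarrow> 0" by (rule LIMSEQ_power_zero) simp
  qed
  then show ?thesis unfolding sums_def part by (rule LIM_zero_cancel)
qed

text \<open>Since only the ternary digits 0 and 2 occur, multiplication by \<open>3 ^ k\<close>
  turns the digits before position \<open>k\<close> into an even integer, a multiple of the period
  of the wave; digit \<open>k\<close> becomes \<open>2 * a k / 3\<close> and the tail lies in
  [0, 1/3].\<close>

lemma ternary_digit:
  fixes a :: "nat \<Rightarrow> int"
  assumes "\<And>k. a k \<in> {0, 1}"
  defines "t \<equiv> (\<Sum>i. 2 * of_int (a i) / 3 ^ Suc i)"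
  shows "schoenberg_wave (3 ^ k * t) = of_int (a k)" and "0 \<le> t" and "t \<le> 1"
proof -
  have geo: "(\<lambda>i. 2 * (1 / 3) ^ Suc i :: real) sums 1"
    using sums_mult[OF geometric_sums[of "1 / 3 :: real"], of "2 / 3"] by (simp add: mult.assoc)
  have summ: "summable (\<lambda>i. 2 * real_of_int (b i) / 3 ^ Suc i)" and sum1: "(\<Sum>i. 2 * real_of_int (b i) / 3 ^ Suc i) \<le> 1"
    and sum0: "(\<Sum>i. 2 * real_of_int (b i) / 3 ^ Suc i) \<ge> 0" if b: "\<And>i. b i \<in> {0, 1}" for b :: "nat \<Rightarrow> int"
  proof -
    have b: "0 \<le> real_of_int (b i)" "real_of_int (b i) \<le> 1" for i using b[of i] by auto
    have le: "2 * real_of_int (b i) / 3 ^ Suc i \<le> 2 * (1 / 3) ^ Suc i" for i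
      using b[of i] by (simp add: power_one_over divide_simps)
    show s: "summable (\<lambda>i. 2 * real_of_int (b i) / 3 ^ Suc i)"
      by (rule summable_comparison_test'[OF sums_summable[OF geo], of 0]) (use b le in auto)
    show "(\<Sum>i. 2 * real_of_int (b i) / 3 ^ Suc i) \<le> 1"
      using suminf_le[OF le s sums_summable[OF geo]] sums_unique[OF geo] by simp
    show "(\<Sum>i. 2 * real_of_int (b i) / 3 ^ Suc i) \<ge> 0" by (intro suminf_nonneg s) (use b in auto)
  qed
  show "0 \<le> t" "t \<le> 1"
    unfolding t_def using sum0[of a] sum1[of a] assms(1) by auto
  define u where "u = (\<Sum>i. 2 * real_of_int (a (i + Suc k)) / 3 ^ Suc i)"
  have u: "0 \<le> u" "u \<le> 1" unfolding u_def using sum0[of "\<lambda>i. a (i + Suc k)"] sum1[of "\<lambda>i. a (i + Suc k)"] assms(1) by auto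
  have "3 ^ k * t = 3 ^ k * ((\<Sum>i. 2 * real_of_int (a (i + Suc k)) / 3 ^ Suc (i + Suc k)) + (\<Sum>i<Suc k. 2 * real_of_int (a i) / 3 ^ Suc i))"
    unfolding t_def by (subst suminf_split_initial_segment[OF summ[OF assms(1)], where k = "Suc k"]) simp
  also have "(\<Sum>i. 2 * real_of_int (a (i + Suc k)) / 3 ^ Suc (i + Suc k)) = u / 3 ^ Suc k"
    unfolding u_def using summ[of "\<lambda>i. a (i + Suc k)"] assms(1)
    by (subst suminf_divide[symmetric]) (auto simp: power_add mult_ac)
  also have "3 ^ k * (u / 3 ^ Suc k + (\<Sum>i<Suc k. 2 * real_of_int (a i) / 3 ^ Suc i)) =
      u / 3 + (\<Sum>i<k. 3 ^ k * (2 * real_of_int (a i) / 3 ^ Suc i)) + 2 * real_of_int (a k) / 3"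
    by (simp add: distrib_left sum_distrib_left)
  also have "(\<Sum>i<k. 3 ^ k * (2 * real_of_int (a i) / 3 ^ Suc i)) = 2 * of_int (\<Sum>i<k. a i * 3 ^ (k - Suc i))"
    unfolding of_int_sum sum_distrib_left
  proof (intro sum.cong refl)
    fix i assume "i \<in> {..<k}"
    then have "(3::real) ^ k = 3 ^ (k - Suc i) * 3 ^ Suc i" by (metis Suc_leI le_add_diff_inverse2 lessThan_iff power_add)
    then show "3 ^ k * (2 * real_of_int (a i) / 3 ^ Suc i) = 2 * real_of_int (a i * 3 ^ (k - Suc i))" by simp
  qed
  finally have "3 ^ k * t = 2 * of_int (\<Sum>i<k. a i * 3 ^ (k - Suc i)) + 2 * real_of_int (a k) / 3 + u / 3" by simp
  then show "schoenberg_wave (3 ^ k * t) = of_int (a k)"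
    using schoenberg_wave_digit[OF assms(1)[of k], of "u / 3" "\<Sum>i<k. a i * 3 ^ (k - Suc i)"] u by simp
qed

lemma schoenberg_curve:
  obtains \<psi> :: "real \<Rightarrow> 'a::euclidean_space" and g :: "'a \<Rightarrow> real"
  where "continuous_on UNIV \<psi>" and "g \<in> borel_measurable borel" and "\<And>x. g x \<in> {0..1}"
    and "\<And>x. (\<And>b. b \<in> Basis \<Longrightarrow> 0 \<le> x \<bullet> b \<and> x \<bullet> b < 1) \<Longrightarrow> \<psi> (g x) = x"
proof -
  define m where "m = DIM('a)"
  have m: "m > 0" by (simp add: m_def)
  obtain B :: "nat \<Rightarrow> 'a" where B: "bij_betw B {0..<m} Basis"
    unfolding m_def using ex_bij_betw_nat_finite[OF finite_Basis] by blast
  define \<iota> where "\<iota> = the_inv_into {0..<m} B"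
  have iota: "\<iota> b < m" "B (\<iota> b) = b" if "b \<in> Basis" for b
    using that B the_inv_into_into[of B "{0..<m}" b "{0..<m}"] f_the_inv_into_f_bij_betw[OF B, of b]
    by (auto simp: \<iota>_def bij_betw_def)
  \<comment> \<open>Interleaving: position \<open>j * m + i\<close> holds binary digit
    \<open>j\<close> of the \<open>i\<close>-th coordinate.\<close>
  define a where "a x k = \<lfloor>2 ^ Suc (k div m) * (x \<bullet> B (k mod m))\<rfloor> mod 2" for x k
  have a01: "a x k \<in> {0, 1}" for x k by (auto simp: a_def)
  define g where "g x = (\<Sum>i. 2 * real_of_int (a x i) / 3 ^ Suc i)" for x
  define w where "w b j t = schoenberg_wave (3 ^ (j * m + \<iota> b) * t) * (1 / 2) ^ Suc j" for b j t
  define \<psi> where "\<psi> t = (\<Sum>b\<in>Basis. (\<Sum>j. w b j t) *\<^sub>R b)" for t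
  have cont1: "continuous_on UNIV (\<lambda>t. \<Sum>j. w b j t)" for b
  proof (rule uniform_limit_theorem)
    have "summable (\<lambda>j. (1 / 2 :: real) ^ Suc j)" using power_half_series by (rule sums_summable)
    then show "uniform_limit UNIV (\<lambda>n t. \<Sum>j<n. w b j t) (\<lambda>t. \<Sum>j. w b j t) sequentially"
    proof (rule Weierstrass_m_test[rotated])
      show "norm (w b j t) \<le> (1 / 2) ^ Suc j" for j t
        using schoenberg_wave_bounds[of "3 ^ (j * m + \<iota> b) * t"] by (simp add: w_def abs_mult)
    qed
    show "\<forall>\<^sub>F n in sequentially. continuous_on UNIV (\<lambda>t. \<Sum>j<n. w b j t)"
      unfolding w_def by (intro always_eventually allI continuous_intros)
  qed simp
  have "continuous_on UNIV \<psi>" unfolding \<psi>_def by (intro continuous_intros cont1)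
  moreover have "g \<in> borel_measurable borel" unfolding g_def a_def by measurable
  moreover have "g x \<in> {0..1}" for x using ternary_digit(2,3)[of "a x"] a01 by (auto simp: g_def)
  moreover have "\<psi> (g x) = x" if x: "\<And>b. b \<in> Basis \<Longrightarrow> 0 \<le> x \<bullet> b \<and> x \<bullet> b < 1" for x
  proof -
    have "(\<Sum>j. w b j (g x)) = x \<bullet> b" if b: "b \<in> Basis" for b
    proof -
      have "w b j (g x) = of_int (\<lfloor>2 ^ Suc j * (x \<bullet> b)\<rfloor> mod 2) * (1 / 2) ^ Suc j" for j
      proof -
        have "schoenberg_wave (3 ^ (j * m + \<iota> b) * g x) = of_int (a x (j * m + \<iota> b))"
          unfolding g_def by (rule ternary_digit(1)) (rule a01)
        moreover have "(j * m + \<iota> b) div m = j" "(j * m + \<iota> b) mod m = \<iota> b" using iota[OF b] m by auto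
        ultimately show ?thesis unfolding w_def using iota[OF b] by (simp add: a_def)
      qed
      then have "(\<lambda>j. w b j (g x)) sums (x \<bullet> b)" using binary_digits_sums[of "x \<bullet> b"] x[OF b] by (simp only: simp_thms)
      then show ?thesis by (rule sums_unique[symmetric])
    qed
    then show ?thesis unfolding \<psi>_def by (simp add: euclidean_representation)
  qed
  ultimately show ?thesis by (rule that)
qed

text \<open>The map \<gamma> to the line is merely Borel, but it acts before the limit, where
  \<open>\<phi> (\<gamma> x) = x\<close> almost everywhere. Only \<phi> meets the limit measure, and
  testing with \<open>h\<close> composed with the continuous \<phi> carries convergence on the line
  back to the space.\<close>

lemma weak_compactness:
  fixes \<mu> :: "nat \<Rightarrow> 'a::euclidean_space measure"
  assumes "\<And>k. prob_space (\<mu> k)" and "\<And>k. sets (\<mu> k) = sets borel"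
    and "\<And>k. AE x in \<mu> k. norm x \<le> R"
  obtains \<nu> r where "prob_space \<nu>" and "sets \<nu> = sets borel" and "strict_mono (r :: nat \<Rightarrow> nat)"
    and "\<And>h :: 'a \<Rightarrow> complex. continuous_on UNIV h \<Longrightarrow> (\<exists>B. \<forall>x. norm (h x) \<le> B) \<Longrightarrow>
        (\<lambda>k. LINT x|\<mu> (r k). h x) \<longlonglongrightarrow> (LINT x|\<nu>. h x)"
proof -
  obtain \<psi> :: "real \<Rightarrow> 'a" and g :: "'a \<Rightarrow> real" where sch: "continuous_on UNIV \<psi>" "g \<in> borel_measurable borel"
    "\<And>x. g x \<in> {0..1}" "\<And>x. (\<And>b. b \<in> Basis \<Longrightarrow> 0 \<le> x \<bullet> b \<and> x \<bullet> b < 1) \<Longrightarrow> \<psi> (g x) = x"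
    using schoenberg_curve by blast
  \<comment> \<open>At this scale the ball of radius \<open>R\<close> lands strictly inside the
    half-open unit cube, on which \<psi> inverts \<open>g\<close>.\<close>
  define S where "S = 2 * \<bar>R\<bar> + 2"
  have S: "S > 0" by (simp add: S_def)
  define \<gamma> where "\<gamma> x = g ((1 / S) *\<^sub>R x + (1 / 2) *\<^sub>R One)" for x
  define \<phi> where "\<phi> t = S *\<^sub>R (\<psi> t - (1 / 2) *\<^sub>R One)" for t
  have gm: "\<gamma> \<in> borel_measurable borel" unfolding \<gamma>_def using sch(2) by measurable
  have phic: "continuous_on UNIV \<phi>" unfolding \<phi>_def by (intro continuous_intros sch)
  then have phim: "\<phi> \<in> borel_measurable borel" by (rule borel_measurable_continuous_onI)
  have inv: "\<phi> (\<gamma> x) = x" if "norm x \<le> R" for x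
  proof -
    have "0 \<le> ((1 / S) *\<^sub>R x + (1 / 2) *\<^sub>R One) \<bullet> b \<and> ((1 / S) *\<^sub>R x + (1 / 2) *\<^sub>R One) \<bullet> b < 1" if b: "b \<in> Basis" for b
    proof -
      have "\<bar>x \<bullet> b\<bar> \<le> \<bar>R\<bar>" using Basis_le_norm[OF b, of x] \<open>norm x \<le> R\<close> by linarith
      then have "\<bar>x \<bullet> b\<bar> / S < 1 / 2" using S by (simp add: S_def divide_simps)
      then have "\<bar>(x \<bullet> b) / S\<bar> < 1 / 2" using S unfolding abs_divide by simp
      then have "- (1 / 2) < (x \<bullet> b) / S" "(x \<bullet> b) / S < 1 / 2" unfolding abs_less_iff by linarith+
      moreover have "((1 / S) *\<^sub>R x + (1 / 2) *\<^sub>R One) \<bullet> b = (x \<bullet> b) / S + 1 / 2" using b by (simp add: inner_add_left)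
      ultimately show ?thesis by linarith
    qed
    then have "\<psi> (\<gamma> x) = (1 / S) *\<^sub>R x + (1 / 2) *\<^sub>R One" unfolding \<gamma>_def by (rule sch(4))
    then show ?thesis using S by (simp add: \<phi>_def)
  qed
  define \<nu> where "\<nu> k = distr (\<mu> k) borel \<gamma>" for k
  have gmk: "\<gamma> \<in> measurable (\<mu> k) borel" for k using gm assms(2) by (simp cong: measurable_cong_sets)
  have prob: "prob_space (\<nu> k)" for k
    unfolding \<nu>_def by (rule prob_space.prob_space_distr[OF assms(1) gmk])
  have rd: "real_distribution (\<nu> k)" for k
    by (intro real_distribution.intro real_distribution_axioms.intro prob) (auto simp: \<nu>_def)
  \<comment> \<open>Tightness is automatic, because all images live on the unit interval.\<close>
  have "tight \<nu>"
    unfolding tight_def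
  proof (intro conjI allI impI rd)
    fix \<epsilon> :: real assume "\<epsilon> > 0"
    have "measure (\<nu> k) {-1<..1} = 1" for k
    proof -
      have "\<gamma> -` {-1<..1} = UNIV" using sch(3) by (auto simp: \<gamma>_def) (smt (verit) atLeastAtMost_iff)+
      then show ?thesis unfolding \<nu>_def using gmk[of k] assms(2)[of k] sets_eq_imp_space_eq[OF assms(2)[of k]] prob_space.prob_space[OF assms(1), of k]
        by (subst measure_distr) auto
    qed
    then show "\<exists>a b. a < b \<and> (\<forall>n. 1 - \<epsilon> < measure (\<nu> n) {a<..b})"
      using \<open>\<epsilon> > 0\<close> by (intro exI[of _ "-1"] exI[of _ 1]) auto
  qed
  then obtain r M where r: "strict_mono r" "real_distribution M" "weak_conv_m (\<nu> \<circ> id \<circ> r) M"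
    using tight_imp_convergent_subsubsequence[of \<nu> id] by (auto simp: strict_mono_id)
  interpret M: real_distribution M by (rule r)
  define \<rho> where "\<rho> = distr M borel \<phi>"
  have phiM: "\<phi> \<in> measurable M borel" using phim by (simp cong: measurable_cong_sets)
  have "prob_space \<rho>" unfolding \<rho>_def by (rule M.prob_space_distr[OF phiM])
  moreover have "sets \<rho> = sets borel" by (simp add: \<rho>_def)
  moreover have "(\<lambda>k. LINT x|\<mu> (r k). h x) \<longlonglongrightarrow> (LINT x|\<rho>. h x)"
    if h: "continuous_on UNIV h" "\<exists>B. \<forall>x. norm (h x) \<le> B" for h :: "'a \<Rightarrow> complex"
  proof -
    have hm: "h \<in> borel_measurable borel" using h(1) by (rule borel_measurable_continuous_onI)
    have hphi: "continuous_on UNIV (\<lambda>t. h (\<phi> t))" by (rule continuous_on_compose2[OF h(1) phic]) auto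
    obtain B where B: "\<And>x. norm (h x) \<le> B" using h(2) by blast
    have "(\<lambda>k. LINT t|\<nu> (r k). h (\<phi> t)) \<longlonglongrightarrow> (LINT t|M. h (\<phi> t))"
    proof -
      have "(\<lambda>k. integral\<^sup>L ((\<nu> \<circ> id \<circ> r) k) (\<lambda>t. h (\<phi> t))) \<longlonglongrightarrow> integral\<^sup>L M (\<lambda>t. h (\<phi> t))"
        by (rule weak_conv_imp_integral_bdd_continuous_conv[OF _ r(2,3), of _ B])
          (use rd hphi B in \<open>auto simp: continuous_on_eq_continuous_at\<close>)
      then show ?thesis by simp
    qed
    moreover have "(LINT t|M. h (\<phi> t)) = (LINT x|\<rho>. h x)"
      unfolding \<rho>_def by (rule integral_distr[OF phiM hm, symmetric])
    moreover have "(LINT t|\<nu> k. h (\<phi> t)) = (LINT x|\<mu> k. h x)" for k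
    proof -
      have "(LINT t|\<nu> k. h (\<phi> t)) = (LINT x|\<mu> k. h (\<phi> (\<gamma> x)))"
        unfolding \<nu>_def using gmk by (rule integral_distr) (use hm phim in measurable)
      also have "\<dots> = (LINT x|\<mu> k. h x)"
        using assms(3)[of k] gm hm phim
        by (intro integral_cong_AE) (auto simp: inv measurable_cong_sets[OF assms(2) refl])
      finally show ?thesis .
    qed
    ultimately show ?thesis by simp
  qed
  ultimately show ?thesis by (rule that[OF _ _ r(1)])
qed

section \<open>Compactly supported measures with rapidly decaying Fourier transform\<close>

lemma fourier_transform_convolution:
  fixes \<mu> \<nu> :: "'a::euclidean_space measure"
  assumes "prob_space \<mu>" "sets \<mu> = sets borel" "prob_space \<nu>" "sets \<nu> = sets borel"
  defines "\<rho> \<equiv> distr (\<mu> \<Otimes>\<^sub>M \<nu>) borel (\<lambda>(x, y). x + y)"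
  shows "prob_space \<rho>" and "fourier_transform \<rho> \<xi> = fourier_transform \<mu> \<xi> * fourier_transform \<nu> \<xi>"
    and "(AE x in \<mu>. norm x \<le> R) \<Longrightarrow> (AE x in \<nu>. norm x \<le> S) \<Longrightarrow> (AE x in \<rho>. norm x \<le> R + S)"
proof -
  interpret \<mu>: prob_space \<mu> by fact
  interpret \<nu>: prob_space \<nu> by fact
  interpret P: pair_prob_space \<mu> \<nu> ..
  have setsP: "sets (\<mu> \<Otimes>\<^sub>M \<nu>) = sets (borel \<Otimes>\<^sub>M borel)"
    by (rule sets_pair_measure_cong) (use assms in auto)
  have m: "(\<lambda>(x, y). x + y) \<in> measurable (\<mu> \<Otimes>\<^sub>M \<nu>) borel"
    unfolding measurable_cong_sets[OF setsP refl] by measurable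
  show "prob_space \<rho>" unfolding \<rho>_def by (rule P.prob_space_distr[OF m])
  have um: "(\<lambda>x. unit_exp (- (x \<bullet> \<xi>))) \<in> borel_measurable borel" by measurable
  have int: "integrable (\<mu> \<Otimes>\<^sub>M \<nu>) (\<lambda>z. unit_exp (- (fst z \<bullet> \<xi>)) * unit_exp (- (snd z \<bullet> \<xi>)))"
  proof (rule P.integrable_const_bound[where B = 1])
    show "(\<lambda>z. unit_exp (- (fst z \<bullet> \<xi>)) * unit_exp (- (snd z \<bullet> \<xi>))) \<in> borel_measurable (\<mu> \<Otimes>\<^sub>M \<nu>)"
      unfolding measurable_cong_sets[OF setsP refl] by measurable
  qed (simp add: norm_mult)
  have "fourier_transform \<rho> \<xi> = (LINT z|(\<mu> \<Otimes>\<^sub>M \<nu>). unit_exp (- ((\<lambda>(x, y). x + y) z \<bullet> \<xi>)))"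
    unfolding fourier_transform_unit_exp \<rho>_def by (rule integral_distr[OF m um])
  also have "\<dots> = (LINT z|(\<mu> \<Otimes>\<^sub>M \<nu>). unit_exp (- (fst z \<bullet> \<xi>)) * unit_exp (- (snd z \<bullet> \<xi>)))"
    by (intro Bochner_Integration.integral_cong) (auto simp: inner_add_left simp flip: unit_exp_add)
  also have "\<dots> = (LINT x|\<mu>. LINT y|\<nu>. unit_exp (- (x \<bullet> \<xi>)) * unit_exp (- (y \<bullet> \<xi>)))"
    using P.integral_fst'[OF int] by simp
  also have "\<dots> = fourier_transform \<mu> \<xi> * fourier_transform \<nu> \<xi>"
    unfolding fourier_transform_unit_exp by simp
  finally show "fourier_transform \<rho> \<xi> = fourier_transform \<mu> \<xi> * fourier_transform \<nu> \<xi>" .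
  assume R: "AE x in \<mu>. norm x \<le> R" and S: "AE x in \<nu>. norm x \<le> S"
  have "AE z in \<mu> \<Otimes>\<^sub>M \<nu>. norm (fst z) \<le> R \<and> norm (snd z) \<le> S"
  proof (rule P.AE_pair_measure)
    show "{z \<in> space (\<mu> \<Otimes>\<^sub>M \<nu>). norm (fst z) \<le> R \<and> norm (snd z) \<le> S} \<in> sets (\<mu> \<Otimes>\<^sub>M \<nu>)"
      unfolding setsP sets_eq_imp_space_eq[OF setsP] by measurable
    show "AE x in \<mu>. AE y in \<nu>. norm (fst (x, y)) \<le> R \<and> norm (snd (x, y)) \<le> S"
      using R S by auto
  qed
  then have "AE z in \<mu> \<Otimes>\<^sub>M \<nu>. norm ((\<lambda>(x, y). x + y) z) \<le> R + S"
    by eventually_elim (auto simp: case_prod_unfold intro!: norm_triangle_le add_mono)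
  then show "AE x in \<rho>. norm x \<le> R + S"
    unfolding \<rho>_def by (subst AE_distr_iff[OF m]) auto
qed

text \<open>Translating by \<open>\<xi> / (2 |\<xi>|\<^sup>2)\<close> changes the sign of the character, so the Fourier transform of a
  Lipschitz density is half that of a difference of two nearby translates.\<close>

lemma tent_measure:
  obtains \<mu> :: "'a::euclidean_space measure" and C R where "prob_space \<mu>" "sets \<mu> = sets borel"
    "AE x in \<mu>. norm x \<le> R" "C > 0" "\<And>\<xi>. norm (fourier_transform \<mu> \<xi>) \<le> C * (1 + norm \<xi>) powr (- 1)"
proof -
  define f where "f x = max 0 (1 - norm x)" for x :: 'a
  have fc: "continuous_on A f" for A unfolding f_def by (intro continuous_intros)
  have fm [measurable]: "f \<in> borel_measurable borel" by (rule borel_measurable_continuous_onI[OF fc])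
  have f0: "f x \<ge> 0" and f1: "f x \<le> 1" for x by (auto simp: f_def)
  \<comment> \<open>Radius 3 leaves room for the support of a translate \<open>f (x - h)\<close>
    with \<open>norm h \<le> 1\<close>, so that one ball serves both functions.\<close>
  have fsupp: "f x = 0" if "x \<notin> cball 0 3" for x using that by (simp add: f_def)
  have int_ind: "integrable lborel (indicat_real (cball (0::'a) 3))"
    by (intro integrable_real_indicator emeasure_bounded_finite) auto
  have fint: "integrable lborel f"
    by (rule Bochner_Integration.integrable_bound[OF int_ind]) (use f0 f1 fsupp in \<open>auto simp: indicator_def\<close>)
  define I where "I = (LINT x|lborel. f x)"
  have I: "I > 0"
  proof -
    have "(LINT x|lborel. (1 / 2) * indicat_real (cball (0::'a) (1 / 2)) x) \<le> I"
      unfolding I_def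
      by (intro integral_mono fint integrable_mult_right integrable_real_indicator emeasure_bounded_finite)
        (auto simp: f_def indicator_def)
    moreover have "(LINT x|lborel. (1 / 2) * indicat_real (cball (0::'a) (1 / 2)) x) = (1 / 2) * measure lborel (cball (0::'a) (1 / 2))"
      by simp
    moreover have "measure lborel (cball (0::'a) (1 / 2)) > 0"
      using content_cball_pos[of "1 / 2" "0 :: 'a"] by simp
    ultimately show ?thesis by linarith
  qed
  define \<mu> where "\<mu> = density lborel (\<lambda>x. ennreal (f x / I))"
  have sets: "sets \<mu> = sets borel" by (simp add: \<mu>_def)
  have prob: "prob_space \<mu>"
  proof
    have "emeasure \<mu> (space \<mu>) = (\<integral>\<^sup>+x. ennreal (f x / I) \<partial>lborel)"
      by (simp add: \<mu>_def emeasure_density)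
    also have "\<dots> = ennreal (LINT x|lborel. f x / I)"
      using f0 I fint by (intro nn_integral_eq_integral) auto
    also have "\<dots> = 1" using I by (simp add: I_def)
    finally show "emeasure \<mu> (space \<mu>) = 1" .
  qed
  have AE: "AE x in \<mu>. norm x \<le> 1"
    unfolding \<mu>_def by (subst AE_density) (auto simp: f_def max_def split: if_splits intro!: AE_I2)
  define V where "V = measure lborel (cball (0::'a) 3)"
  have V: "V > 0" unfolding V_def using content_cball_pos[of 3 "0 :: 'a"] by simp
  have fi: "integrable lborel (\<lambda>x. f x *\<^sub>R unit_exp (- (x \<bullet> \<xi>)))" for \<xi>
    by (rule Bochner_Integration.integrable_bound[OF fint]) (use f0 in auto)
  have ft: "fourier_transform \<mu> \<xi> = (LINT x|lborel. f x *\<^sub>R unit_exp (- (x \<bullet> \<xi>))) / I" for \<xi>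
  proof -
    have "fourier_transform \<mu> \<xi> = (LINT x|lborel. (f x / I) *\<^sub>R unit_exp (- (x \<bullet> \<xi>)))"
      unfolding fourier_transform_unit_exp \<mu>_def using f0 I by (subst integral_density) auto
    also have "\<dots> = (LINT x|lborel. (f x *\<^sub>R unit_exp (- (x \<bullet> \<xi>))) / I)"
      by (simp add: scaleR_conv_of_real)
    finally show ?thesis by simp
  qed
  have decay: "norm (fourier_transform \<mu> \<xi>) \<le> V / (4 * I) / norm \<xi>" if xi: "norm \<xi> \<ge> 1" for \<xi>
  proof -
    define h where "h = (1 / (2 * (norm \<xi>)\<^sup>2)) *\<^sub>R \<xi>"
    have "\<xi> \<noteq> 0" using xi by auto
    then have hx: "h \<bullet> \<xi> = 1 / 2" by (simp add: h_def power2_norm_eq_inner)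
    have nh: "norm h = 1 / (2 * norm \<xi>)" using \<open>\<xi> \<noteq> 0\<close> by (simp add: h_def power2_eq_square)
    have "1 / (2 * norm \<xi>) \<le> 1 / 1" using xi by (intro divide_left_mono) auto
    then have nh1: "norm h \<le> 1" by (simp only: nh div_by_1)
    define J where "J = (LINT x|lborel. f x *\<^sub>R unit_exp (- (x \<bullet> \<xi>)))"
    have "J = (LINT x|lborel. f (x - h) *\<^sub>R unit_exp (- ((x - h) \<bullet> \<xi>)))"
    proof -
      have "J = (LINT x|distr lborel borel ((+) (- h)). f x *\<^sub>R unit_exp (- (x \<bullet> \<xi>)))"
        unfolding J_def by (subst lborel_distr_plus[of "- h"]) simp
      also have "\<dots> = (LINT x|lborel. f (- h + x) *\<^sub>R unit_exp (- ((- h + x) \<bullet> \<xi>)))"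
        by (rule integral_distr) measurable
      finally show ?thesis by simp
    qed
    also have "\<dots> = - (LINT x|lborel. f (x - h) *\<^sub>R unit_exp (- (x \<bullet> \<xi>)))"
    proof -
      have "unit_exp (- ((x - h) \<bullet> \<xi>)) = - unit_exp (- (x \<bullet> \<xi>))" for x
        using unit_exp_add[of "- (x \<bullet> \<xi>)" "h \<bullet> \<xi>"] unfolding hx unit_exp_half by (simp add: inner_diff_left hx)
      then show ?thesis by simp
    qed
    finally have J2: "J = - (LINT x|lborel. f (x - h) *\<^sub>R unit_exp (- (x \<bullet> \<xi>)))" .
    have lip: "\<bar>f x - f (x - h)\<bar> \<le> norm h" for x
      using norm_triangle_ineq3[of x "x - h"] by (auto simp: f_def max_def)
    have supp2: "f x - f (x - h) = 0" if "x \<notin> cball 0 3" for x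
    proof -
      have "norm x > 3" using that by simp
      moreover have "norm x \<le> norm (x - h) + norm h" using norm_triangle_sub[of x h] by simp
      ultimately show ?thesis using nh1 by (simp add: f_def)
    qed
    have bnd: "\<bar>f x - f (x - h)\<bar> \<le> norm h * indicat_real (cball 0 3) x" for x
      using lip[of x] supp2[of x] by (auto simp: indicator_def)
    have fhi: "integrable lborel (\<lambda>x. f (x - h) *\<^sub>R unit_exp (- (x \<bullet> \<xi>)))"
    proof (rule Bochner_Integration.integrable_bound[OF int_ind])
      show "AE x in lborel. norm (f (x - h) *\<^sub>R unit_exp (- (x \<bullet> \<xi>))) \<le> norm (indicat_real (cball 0 3) x)"
      proof (rule AE_I2)
        fix x
        have "f (x - h) = 0" if "x \<notin> cball 0 3" using supp2[OF that] fsupp[OF that] by simp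
        then show "norm (f (x - h) *\<^sub>R unit_exp (- (x \<bullet> \<xi>))) \<le> norm (indicat_real (cball 0 3) x)"
          using f0[of "x - h"] f1[of "x - h"] by (auto simp: indicator_def)
      qed
    qed measurable
    have "2 * norm J = norm (J + J)" by (metis mult_2 norm_mult norm_numeral)
    also have "J + J = J - (LINT x|lborel. f (x - h) *\<^sub>R unit_exp (- (x \<bullet> \<xi>)))"
      using J2 by (metis diff_conv_add_uminus)
    also have "\<dots> = (LINT x|lborel. (f x - f (x - h)) *\<^sub>R unit_exp (- (x \<bullet> \<xi>)))"
      unfolding J_def scaleR_left_diff_distrib using fi fhi by (subst Bochner_Integration.integral_diff) auto
    also have "norm \<dots> \<le> (LINT x|lborel. norm h * indicat_real (cball (0::'a) 3) x)"
    proof (rule order_trans[OF integral_norm_bound], rule integral_mono)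
      have "integrable lborel (\<lambda>x. (f x - f (x - h)) *\<^sub>R unit_exp (- (x \<bullet> \<xi>)))"
        unfolding scaleR_left_diff_distrib using fi fhi by (rule Bochner_Integration.integrable_diff)
      then show "integrable lborel (\<lambda>x. norm ((f x - f (x - h)) *\<^sub>R unit_exp (- (x \<bullet> \<xi>))))"
        by (rule integrable_norm)
      show "integrable lborel (\<lambda>x. norm h * indicat_real (cball (0::'a) 3) x)"
        by (intro integrable_mult_right int_ind)
    qed (use bnd in simp)
    also have "\<dots> = norm h * V" by (simp add: V_def)
    finally have "norm J \<le> V / (4 * norm \<xi>)" unfolding nh by (simp add: field_simps)
    then have "norm J / I \<le> V / (4 * norm \<xi>) / I" using I by (intro divide_right_mono) auto
    then show ?thesis unfolding ft J_def[symmetric] using I by (simp add: norm_divide mult_ac)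
  qed
  \<comment> \<open>For \<open>norm \<xi> \<ge> 1\<close> the decay estimate is combined with
    \<open>1 / (2 * norm \<xi>) \<le> 1 / (1 + norm \<xi>)\<close>; for smaller \<xi> the trivial
    bound 1 is at most \<open>2 / (1 + norm \<xi>)\<close>.\<close>
  define C where "C = max 2 (V / (2 * I))"
  have "norm (fourier_transform \<mu> \<xi>) \<le> C * (1 + norm \<xi>) powr (- 1)" for \<xi>
  proof -
    have pw: "(1 + norm \<xi>) powr (- 1) = 1 / (1 + norm \<xi>)" by (simp add: powr_minus_divide)
    show ?thesis
    proof (cases "norm \<xi> \<ge> 1")
      case True
      have "V / (4 * I) / norm \<xi> = V / (2 * I) * (1 / (2 * norm \<xi>))" by simp
      also have "\<dots> \<le> C * (1 / (1 + norm \<xi>))"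
        using True I V by (intro mult_mono frac_le) (auto simp: C_def)
      finally show ?thesis using decay[OF True] unfolding pw by linarith
    next
      case False
      have "norm (fourier_transform \<mu> \<xi>) \<le> 1"
        using norm_fourier_transform_le[of \<mu> \<xi>] prob prob_space.prob_space[OF prob] prob_space.axioms(1)[OF prob] by simp
      also have "1 \<le> 2 * (1 / (1 + norm \<xi>))"
      proof -
        have "0 < 1 + norm \<xi>" by (simp add: add_pos_nonneg)
        then show ?thesis using False by (simp add: field_simps)
      qed
      also have "\<dots> \<le> C * (1 / (1 + norm \<xi>))" by (intro mult_right_mono) (auto simp: C_def)
      finally show ?thesis unfolding pw .
    qed
  qed
  moreover have "C > 0" by (simp add: C_def)
  ultimately show ?thesis using that[OF prob sets AE] by blast
qed

text \<open>Each convolution with the tent measure multiplies the transforms and gains one power of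
  decay, while the radius of the support grows but stays finite.\<close>

lemma smooth_compact_measure:
  fixes A :: nat
  obtains \<mu> :: "'a::euclidean_space measure" and C R where "prob_space \<mu>" "sets \<mu> = sets borel"
    "AE x in \<mu>. norm x \<le> R" "C > 0" "\<And>\<xi>. norm (fourier_transform \<mu> \<xi>) \<le> C * (1 + norm \<xi>) powr (- real A)"
proof -
  obtain \<nu> :: "'a measure" and D S where nu: "prob_space \<nu>" "sets \<nu> = sets borel"
    "AE x in \<nu>. norm x \<le> S" "D > 0" "\<And>\<xi>. norm (fourier_transform \<nu> \<xi>) \<le> D * (1 + norm \<xi>) powr (- 1)"
    by (rule tent_measure) (rule that)
  have "\<exists>(\<mu> :: 'a measure) C R. prob_space \<mu> \<and> sets \<mu> = sets borel \<and> (AE x in \<mu>. norm x \<le> R) \<and> C > 0 \<and>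
      (\<forall>\<xi>. norm (fourier_transform \<mu> \<xi>) \<le> C * (1 + norm \<xi>) powr (- real A))"
  proof (induction A)
    case 0
    have "norm (fourier_transform \<nu> \<xi>) \<le> 1 * (1 + norm \<xi>) powr (- real 0)" for \<xi>
    proof -
      have "1 + norm \<xi> \<noteq> 0" by (metis add_pos_nonneg norm_ge_zero zero_less_one less_irrefl)
      then show ?thesis
        using norm_fourier_transform_le[of \<nu> \<xi>] prob_space.prob_space[OF nu(1)] prob_space.axioms(1)[OF nu(1)] by simp
    qed
    then show ?case using nu(1-3) zero_less_one by blast
  next
    case (Suc A)
    then obtain \<mu> :: "'a measure" and C R where mu: "prob_space \<mu>" "sets \<mu> = sets borel" "AE x in \<mu>. norm x \<le> R" "C > 0"
      "\<And>\<xi>. norm (fourier_transform \<mu> \<xi>) \<le> C * (1 + norm \<xi>) powr (- real A)" by blast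
    note conv = fourier_transform_convolution[OF mu(1,2) nu(1,2)]
    have "norm (fourier_transform \<mu> \<xi> * fourier_transform \<nu> \<xi>) \<le> (C * D) * (1 + norm \<xi>) powr (- real (Suc A))" for \<xi>
    proof -
      have "norm (fourier_transform \<mu> \<xi> * fourier_transform \<nu> \<xi>) \<le> (C * (1 + norm \<xi>) powr (- real A)) * (D * (1 + norm \<xi>) powr (- 1))"
        unfolding norm_mult using mu nu by (intro mult_mono) auto
      also have "\<dots> = (C * D) * ((1 + norm \<xi>) powr (- real A) * (1 + norm \<xi>) powr (- 1))" by (simp add: mult_ac)
      also have "(1 + norm \<xi>) powr (- real A) * (1 + norm \<xi>) powr (- 1) = (1 + norm \<xi>) powr (- real (Suc A))"
        unfolding powr_add[symmetric] by (simp add: add.commute)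
      finally show ?thesis .
    qed
    then show ?case using conv(1) conv(3)[OF mu(3) nu(3)] mu(4) nu(4)
      by (intro exI[of _ "distr (\<mu> \<Otimes>\<^sub>M \<nu>) borel (\<lambda>(x, y). x + y)"] exI[of _ "C * D"] exI[of _ "R + S"]) (simp add: conv(2))
  qed
  then show ?thesis using that by blast
qed

section \<open>Fejer kernel estimates\<close>

text \<open>Within \<open>1 / (8 * N)\<close> of an integer all \<open>N\<close> phases have angle
  at most pi/4, hence below pi/3, so every summand has real part at least 1/2.\<close>

lemma norm_exp_sum_ge:
  fixes r :: int
  assumes "N > 0" "\<bar>t - of_int r\<bar> \<le> 1 / (8 * real N)"
  shows "norm (\<Sum>a<N. unit_exp (real a * t)) \<ge> real N / 2"
proof -
  define s where "s = t - of_int r"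
  have e: "unit_exp (real a * t) = unit_exp (real a * s)" for a
  proof -
    have "real a * t = real a * s + of_int (int a * r)" by (simp add: s_def algebra_simps)
    then show ?thesis by (simp only: unit_exp_add unit_exp_of_int mult_1_right)
  qed
  have c: "cos (2 * pi * (real a * s)) \<ge> 1 / 2" if "a < N" for a
  proof -
    have "real a * \<bar>s\<bar> \<le> real N * (1 / (8 * real N))"
      using assms that by (intro mult_mono) (auto simp: s_def)
    then have "2 * pi * (real a * \<bar>s\<bar>) \<le> 2 * pi * (1 / 8)" using assms by (intro mult_left_mono) auto
    then have le: "\<bar>2 * pi * (real a * s)\<bar> \<le> pi / 3" by (simp add: abs_mult)
    have "cos (pi / 3) \<le> cos \<bar>2 * pi * (real a * s)\<bar>" using le by (intro cos_monotone_0_pi_le) auto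
    then show ?thesis by (simp only: cos_abs_real cos_60)
  qed
  have "real N / 2 = (\<Sum>a<N. 1 / 2)" by simp
  also have "\<dots> \<le> (\<Sum>a<N. cos (2 * pi * (real a * s)))" using c by (intro sum_mono) auto
  also have "\<dots> = Re (\<Sum>a<N. unit_exp (real a * t))" unfolding e by (simp add: unit_exp_def)
  also have "\<dots> \<le> norm (\<Sum>a<N. unit_exp (real a * t))" by (rule complex_Re_le_cmod)
  finally show ?thesis .
qed

text \<open>The sign in the exponent agrees with that of \<open>fourier_transform\<close>, so
  integrating each term yields a value of the transform.\<close>

lemma fejer_product_expand:
  assumes "finite I"
  shows "complex_of_real (\<Prod>i\<in>I. (norm (\<Sum>a<N. unit_exp (real a * t i)))\<^sup>2) =
    (\<Sum>j\<in>PiE I (\<lambda>_. {..<N}). \<Sum>j'\<in>PiE I (\<lambda>_. {..<N}). unit_exp (- (\<Sum>i\<in>I. (real (j i) - real (j' i)) * t i)))"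
proof -
  define z where "z i = (\<Sum>a<N. unit_exp (real a * t i))" for i
  have pz: "(\<Prod>i\<in>I. z i) = (\<Sum>j\<in>PiE I (\<lambda>_. {..<N}). unit_exp (\<Sum>i\<in>I. real (j i) * t i))"
    unfolding z_def using assms by (subst prod_sum_PiE) (auto simp: unit_exp_sum)
  have "complex_of_real (\<Prod>i\<in>I. (norm (z i))\<^sup>2) = (\<Prod>i\<in>I. cnj (z i) * z i)"
    by (simp add: complex_norm_square[unfolded of_real_power] mult.commute)
  also have "\<dots> = cnj (\<Prod>i\<in>I. z i) * (\<Prod>i\<in>I. z i)" by (simp add: prod.distrib)
  also have "\<dots> = (\<Sum>j\<in>PiE I (\<lambda>_. {..<N}). \<Sum>j'\<in>PiE I (\<lambda>_. {..<N}). unit_exp (- (\<Sum>i\<in>I. real (j i) * t i)) * unit_exp (\<Sum>i\<in>I. real (j' i) * t i))"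
    unfolding pz by (simp add: sum_product unit_exp_minus)
  also have "\<dots> = (\<Sum>j\<in>PiE I (\<lambda>_. {..<N}). \<Sum>j'\<in>PiE I (\<lambda>_. {..<N}). unit_exp (- (\<Sum>i\<in>I. (real (j i) - real (j' i)) * t i)))"
    by (intro sum.cong refl) (simp add: unit_exp_add[symmetric] left_diff_distrib sum_subtractf)
  finally show ?thesis by (simp add: z_def)
qed

lemma near_lattice_sets:
  fixes v :: "'i \<Rightarrow> 'a::euclidean_space"
  assumes "finite I"
  shows "{x. \<forall>i\<in>I. \<exists>r::int. \<bar>x \<bullet> v i - of_int r\<bar> \<le> c} \<in> sets borel"
  using assms by measurable

text \<open>The unnormalised Fejer product is at least \<open>(N\<^sup>2 / 4) ^ card I\<close> on
  the set and nonnegative elsewhere, and its integral is a sum of transform values. The family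
  \<open>v\<close> is general because two are needed: \<open>axis i q\<close> for approximation by a
  fixed denominator, and the standard basis for differences of two points.\<close>

lemma fejer_measure_bound:
  fixes \<mu> :: "'a::euclidean_space measure"
  assumes "finite_measure \<mu>" "sets \<mu> = sets borel" "finite I" "N > 0"
  shows "measure \<mu> {x. \<forall>i\<in>I. \<exists>r::int. \<bar>x \<bullet> v i - of_int r\<bar> \<le> 1 / (8 * real N)} * ((real N)\<^sup>2 / 4) ^ card I \<le>
    (\<Sum>j\<in>PiE I (\<lambda>_. {..<N}). \<Sum>j'\<in>PiE I (\<lambda>_. {..<N}).
      norm (fourier_transform \<mu> (\<Sum>i\<in>I. (real (j i) - real (j' i)) *\<^sub>R v i)))"
proof -
  interpret finite_measure \<mu> by fact
  define A where "A = {x. \<forall>i\<in>I. \<exists>r::int. \<bar>x \<bullet> v i - of_int r\<bar> \<le> 1 / (8 * real N)}"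
  define f where "f x = (\<Prod>i\<in>I. (norm (\<Sum>a<N. unit_exp (real a * (x \<bullet> v i))))\<^sup>2)" for x
  define c where "c = ((real N)\<^sup>2 / 4) ^ card I"
  have A: "A \<in> sets \<mu>" unfolding A_def assms(2) by (rule near_lattice_sets[OF assms(3)])
  have fc: "continuous_on UNIV f" unfolding f_def by (intro continuous_intros)
  have f0: "f x \<ge> 0" for x unfolding f_def by (intro prod_nonneg) auto
  have fb: "norm (f x) \<le> (\<Prod>i\<in>I. (real N)\<^sup>2)" for x
  proof -
    have "f x \<le> (\<Prod>i\<in>I. (real N)\<^sup>2)"
      unfolding f_def
    proof (intro prod_mono conjI power_mono)
      show "norm (\<Sum>a<N. unit_exp (real a * (x \<bullet> v i))) \<le> real N" for i
        using norm_sum[of "\<lambda>a. unit_exp (real a * (x \<bullet> v i))" "{..<N}"] by simp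
    qed auto
    then show ?thesis using f0[of x] by simp
  qed
  have fint: "integrable \<mu> f"
    by (rule integrable_bounded_continuous[OF assms(1,2) borel_measurable_continuous_onI[OF fc] fb])
  have fA: "c \<le> f x" if xA: "x \<in> A" for x
  proof -
    have "c = (\<Prod>i\<in>I. (real N / 2)\<^sup>2)" by (simp add: c_def power_divide)
    also have "\<dots> \<le> f x"
      unfolding f_def
    proof (intro prod_mono conjI power_mono)
      fix i assume "i \<in> I"
      then obtain r :: int where "\<bar>x \<bullet> v i - of_int r\<bar> \<le> 1 / (8 * real N)" using xA by (auto simp: A_def)
      then show "real N / 2 \<le> norm (\<Sum>a<N. unit_exp (real a * (x \<bullet> v i)))" using assms(4) by (intro norm_exp_sum_ge)
    qed auto
    finally show ?thesis .
  qed
  have "measure \<mu> A * c = (LINT x|\<mu>. c * indicat_real A x)" using A by (simp add: mult.commute)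
  also have "\<dots> \<le> (LINT x|\<mu>. f x)"
    using A fint fA f0 by (intro integral_mono integrable_mult_right integrable_real_indicator)
      (auto simp: indicator_def emeasure_eq_measure)
  also have "\<dots> \<le> norm (LINT x|\<mu>. complex_of_real (f x))"
    unfolding integral_complex_of_real by simp
  also have "(LINT x|\<mu>. complex_of_real (f x)) = (\<Sum>j\<in>PiE I (\<lambda>_. {..<N}). \<Sum>j'\<in>PiE I (\<lambda>_. {..<N}).
      fourier_transform \<mu> (\<Sum>i\<in>I. (real (j i) - real (j' i)) *\<^sub>R v i))"
  proof -
    have "complex_of_real (f x) = (\<Sum>j\<in>PiE I (\<lambda>_. {..<N}). \<Sum>j'\<in>PiE I (\<lambda>_. {..<N}).
        unit_exp (- (x \<bullet> (\<Sum>i\<in>I. (real (j i) - real (j' i)) *\<^sub>R v i))))" for x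
      unfolding f_def fejer_product_expand[OF assms(3)] by (simp add: inner_sum_right)
    moreover have "integrable \<mu> (\<lambda>x. unit_exp (- (x \<bullet> w)))" for w
      by (intro integrable_unit_exp assms continuous_intros)
    ultimately show ?thesis by (simp add: fourier_transform_unit_exp)
  qed
  also have "norm \<dots> \<le> (\<Sum>j\<in>PiE I (\<lambda>_. {..<N}). \<Sum>j'\<in>PiE I (\<lambda>_. {..<N}).
      norm (fourier_transform \<mu> (\<Sum>i\<in>I. (real (j i) - real (j' i)) *\<^sub>R v i)))"
    by (intro order_trans[OF norm_sum] sum_mono order_refl)
  finally show ?thesis unfolding A_def c_def .
qed

text \<open>The complement of the support is a union of possibly uncountably many open null sets;
  the Lindelof property reduces it to a countable one.\<close>

lemma measure_support_null:
  fixes \<mu> :: "'a::euclidean_space measure"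
  assumes "sets \<mu> = sets borel"
  shows "emeasure \<mu> (UNIV - measure_support \<mu>) = 0" "closed (measure_support \<mu>)"
proof -
  define F where "F = {C. closed C \<and> emeasure \<mu> (UNIV - C) = 0}"
  show "closed (measure_support \<mu>)" unfolding measure_support_def by (intro closed_Inter) auto
  have "\<And>S. S \<in> uminus ` F \<Longrightarrow> open S" by (auto simp: F_def)
  then obtain F' where F': "F' \<subseteq> uminus ` F" "countable F'" "\<Union>F' = \<Union>(uminus ` F)"
    using Lindelof[of "uminus ` F"] by metis
  have "UNIV - measure_support \<mu> = \<Union>F'" unfolding F'(3) by (auto simp: measure_support_def F_def)
  moreover have "\<Union>F' \<in> null_sets \<mu>"
  proof -
    have "S \<in> null_sets \<mu>" if S: "S \<in> F'" for S
    proof -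
      obtain C where "C \<in> F" "S = - C" using S F'(1) by blast
      then show ?thesis using assms by (auto simp: F_def null_sets_def Compl_eq_Diff_UNIV)
    qed
    then have "(\<Union>S\<in>F'. S) \<in> null_sets \<mu>" using F'(2) by (intro null_sets_UN') auto
    then show ?thesis by simp
  qed
  ultimately show "emeasure \<mu> (UNIV - measure_support \<mu>) = 0" by auto
qed

section \<open>The upper bound for the Fourier dimension\<close>

lemma norm_outer:
  fixes c :: "'n::finite \<Rightarrow> real" and q :: "real ^ 'd"
  shows "norm ((\<chi> i. c i *\<^sub>R q) :: real ^ 'd ^ 'n) = norm (\<chi> i. c i) * norm q"
proof -
  have "(norm ((\<chi> i. c i *\<^sub>R q) :: real ^ 'd ^ 'n))\<^sup>2 = (\<Sum>i\<in>UNIV. (c i)\<^sup>2 * (norm q)\<^sup>2)"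

  proof -
    have "(norm ((\<chi> i. c i *\<^sub>R q) :: real ^ 'd ^ 'n))\<^sup>2 = (\<Sum>i\<in>UNIV. (c i *\<^sub>R q) \<bullet> (c i *\<^sub>R q))"
      unfolding power2_norm_eq_inner by (subst inner_vec_def) simp
    then show ?thesis unfolding power2_norm_eq_inner[of q] by (simp add: power2_eq_square mult_ac)
  qed
  also have "\<dots> = (norm (\<chi> i. c i) * norm q)\<^sup>2"

  proof -
    have "(norm (\<chi> i. c i))\<^sup>2 = (\<Sum>i\<in>UNIV. (c i)\<^sup>2)"
      unfolding power2_norm_eq_inner by (subst inner_vec_def) (simp add: power2_eq_square)
    then show ?thesis by (simp only: power_mult_distrib sum_distrib_right)
  qed
  finally show ?thesis by (metis mult_nonneg_nonneg norm_ge_zero power2_eq_imp_eq)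
qed

lemma sum_axis_outer:
  fixes c :: "'n::finite \<Rightarrow> real" and q :: "real ^ 'd"
  shows "(\<Sum>i\<in>UNIV. c i *\<^sub>R axis i q) = ((\<chi> i. c i *\<^sub>R q) :: real ^ 'd ^ 'n)"
proof -
  have "(\<Sum>i\<in>UNIV. c i *\<^sub>R axis i q) $ k = c k *\<^sub>R q" for k
  proof -
    have "(\<Sum>i\<in>UNIV. c i *\<^sub>R axis i q) $ k = (\<Sum>i\<in>UNIV. if i = k then c i *\<^sub>R q else 0)"
      unfolding sum_component by (intro sum.cong) (auto simp: axis_def)
    then show ?thesis by simp
  qed
  then show ?thesis by (simp add: vec_eq_iff)
qed

lemma inner_axis_matrix:
  fixes x :: "real ^ 'd ^ 'n"
  shows "x \<bullet> axis i q = (x *v q) $ i"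
  by (simp only: inner_axis) (simp add: matrix_vector_mult_def inner_vec_def)

lemma vec_int_lattice: "((\<chi> i. real_of_int (f i)) :: real ^ 'n) \<in> int_lattice"
  by (auto simp: int_lattice_def Basis_vec_def inner_axis)

text \<open>With \<open>v i = axis i q\<close> the Fejer frequencies are the matrices
  \<open>(j - j') \<otimes> q\<close>, of norm \<open>norm (j - j') * norm q\<close>. The diagonal
  \<open>j = j'\<close> gives the term \<open>N powr (- n)\<close>; the decay of the transform,
  summed over \<open>j'\<close> as a lattice sum in \<open>real ^ 'n\<close>, gives the other
  term.\<close>

lemma approx_measure_bound:
  fixes \<mu> :: "(real ^ 'd ^ 'n) measure"
  assumes "prob_space \<mu>" "sets \<mu> = sets borel"
    and decay: "\<And>\<xi>. \<xi> \<noteq> 0 \<Longrightarrow> norm (fourier_transform \<mu> \<xi>) \<le> C * norm \<xi> powr (- \<sigma>)"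
    and "0 < \<epsilon>" "0 \<le> \<sigma>" "\<sigma> \<le> real CARD('n)"
  shows "\<exists>D>0. \<forall>(q :: real ^ 'd) N. q \<noteq> 0 \<longrightarrow> N > 0 \<longrightarrow>
    measure \<mu> {x. \<forall>i. \<exists>r::int. \<bar>(x *v q) $ i - of_int r\<bar> \<le> 1 / (8 * real N)} \<le>
      D * (real N powr (- real CARD('n)) + norm q powr (- \<sigma>) * real N powr (\<epsilon> - \<sigma>))"
proof -
  interpret prob_space \<mu> by fact
  define n where "n = CARD('n)"
  have n0: "n > 0" by (simp add: n_def)
  have "real n + \<epsilon> > real DIM(real ^ 'n)" using assms by (simp add: n_def)
  then obtain L where L: "L > 0" "\<And>(\<xi>::real ^ 'n) T. finite T \<Longrightarrow> T \<subseteq> int_lattice \<Longrightarrow> (\<Sum>l\<in>T. (1 + norm (\<xi> - l)) powr (- (real n + \<epsilon>))) \<le> L"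
    using lattice_powr_sum_bound by metis
  define C' where "C' = max C 0"
  have C': "C' \<ge> 0" "norm (fourier_transform \<mu> \<xi>) \<le> C' * norm \<xi> powr (- \<sigma>)" if "\<xi> \<noteq> 0" for \<xi>
    using decay[OF that] mult_right_mono[of C C' "norm \<xi> powr (- \<sigma>)"] by (auto simp: C'_def)
  have C'0: "C' \<ge> 0" by (simp add: C'_def)
  \<comment> \<open>The surplus between the available exponent \<sigma> and the summable exponent
    \<open>n + \<epsilon>\<close>. It is positive because \<open>\<sigma> \<le> n\<close>, so
    \<open>(1 + r) powr e\<close> can be bounded by its value at the largest \<open>r\<close>, of
    order \<open>N\<close>.\<close>
  define e where "e = real n + \<epsilon> - \<sigma>"
  have e: "e > 0" using assms by (simp add: e_def n_def)
  define D where "D = 4 ^ n * (1 + C' * 2 powr \<sigma> * (real n + 1) powr e * L)"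
  have D: "D > 0" unfolding D_def using C'0 L by (intro mult_pos_pos add_pos_nonneg mult_nonneg_nonneg) auto
  show ?thesis
  proof (intro exI[of _ D] conjI D allI impI)
    fix q :: "real ^ 'd" and N :: nat assume q: "q \<noteq> 0" and N: "N > 0"
    define P where "P = PiE (UNIV :: 'n set) (\<lambda>_. {..<N})"
    have finP: "finite P" unfolding P_def by (intro finite_PiE) auto
    have cardP: "card P = N ^ n" unfolding P_def by (simp add: card_PiE n_def)
    define w :: "('n \<Rightarrow> nat) \<Rightarrow> real ^ 'n" where "w j = (\<chi> i. real (j i))" for j
    have inj: "inj_on w P" by (auto simp: inj_on_def w_def vec_eq_iff)
    have wl: "w ` P \<subseteq> int_lattice"
      using vec_int_lattice[of "\<lambda>i. int (_ i)"] by (auto simp: w_def)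
    have term_bound: "norm (fourier_transform \<mu> (\<Sum>i\<in>UNIV. (real (j i) - real (j' i)) *\<^sub>R axis i q)) \<le>
        (if j = j' then 1 else 0) + C' * 2 powr \<sigma> * ((real n + 1) * N) powr e * norm q powr (- \<sigma>) * (1 + norm (w j - w j')) powr (- (real n + \<epsilon>))"
      if j: "j \<in> P" "j' \<in> P" for j j'
    proof (cases "j = j'")
      case True
      have "norm (fourier_transform \<mu> (\<Sum>i\<in>UNIV. (real (j i) - real (j' i)) *\<^sub>R axis i q)) \<le> 1"
        using norm_fourier_transform_le[OF finite_measure_axioms] prob_space by simp
      moreover have "0 \<le> C' * 2 powr \<sigma> * ((real n + 1) * N) powr e * norm q powr (- \<sigma>) * (1 + norm (w j - w j')) powr (- (real n + \<epsilon>))"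
        using C'0 by simp
      ultimately show ?thesis using True by simp
    next
      case False
      define r where "r = norm (w j - w j')"
      have "w j \<noteq> w j'" using False inj j by (auto simp: inj_on_def)
      then have r1: "r \<ge> 1" unfolding r_def using wl j by (intro norm_ge_1_int_lattice int_lattice_diff) auto
      have eq: "(\<Sum>i\<in>UNIV. (real (j i) - real (j' i)) *\<^sub>R axis i q) = ((\<chi> i. (real (j i) - real (j' i)) *\<^sub>R q) :: real ^ 'd ^ 'n)"
        by (rule sum_axis_outer)
      have nrm: "norm ((\<chi> i. (real (j i) - real (j' i)) *\<^sub>R q) :: real ^ 'd ^ 'n) = r * norm q"
        unfolding norm_outer r_def w_def by (simp add: minus_vec_def)
      have "r \<le> (\<Sum>i\<in>UNIV. \<bar>(w j - w j') $ i\<bar>)" unfolding r_def by (rule norm_le_l1_cart)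
      also have "\<dots> \<le> (\<Sum>i\<in>(UNIV::'n set). real N)"
      proof (intro sum_mono)
        fix i
        have "j i < N" "j' i < N" using j by (auto simp: P_def PiE_def)
        then show "\<bar>(w j - w j') $ i\<bar> \<le> real N" by (simp add: w_def)
      qed
      finally have rN: "1 + r \<le> (real n + 1) * N" using N by (simp add: n_def distrib_right)
      have "norm (fourier_transform \<mu> (\<Sum>i\<in>UNIV. (real (j i) - real (j' i)) *\<^sub>R axis i q)) \<le> C' * (r * norm q) powr (- \<sigma>)"
        unfolding eq using C'(2)[of "\<chi> i. (real (j i) - real (j' i)) *\<^sub>R q"] nrm r1 q by force
      also have "(r * norm q) powr (- \<sigma>) = r powr (- \<sigma>) * norm q powr (- \<sigma>)" using r1 by (simp add: powr_mult)
      also have "r powr (- \<sigma>) \<le> 2 powr \<sigma> * (1 + r) powr (- \<sigma>)"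
      proof -
        have "(2 * r) powr (- \<sigma>) \<le> (1 + r) powr (- \<sigma>)" using r1 assms by (intro powr_mono2') auto
        then have "2 powr \<sigma> * (2 powr (- \<sigma>) * r powr (- \<sigma>)) \<le> 2 powr \<sigma> * (1 + r) powr (- \<sigma>)"
          using r1 by (intro mult_left_mono) (auto simp: powr_mult)
        moreover have "2 powr \<sigma> * (2 powr (- \<sigma>) * r powr (- \<sigma>)) = r powr (- \<sigma>)"
          by (simp add: powr_minus)
        ultimately show ?thesis by simp
      qed
      also have "(1 + r) powr (- \<sigma>) = (1 + r) powr e * (1 + r) powr (- (real n + \<epsilon>))"
        by (simp add: e_def powr_add[symmetric])
      also have "(1 + r) powr e \<le> ((real n + 1) * N) powr e" using rN r1 e by (intro powr_mono2) auto
      finally show ?thesis using False C'0 by (simp add: r_def mult_ac mult_left_mono mult_right_mono)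
    qed
    have "measure \<mu> {x. \<forall>i\<in>(UNIV :: 'n set). \<exists>r::int. \<bar>x \<bullet> axis i q - of_int r\<bar> \<le> 1 / (8 * real N)} * ((real N)\<^sup>2 / 4) ^ card (UNIV :: 'n set) \<le>
        (\<Sum>j\<in>P. \<Sum>j'\<in>P. norm (fourier_transform \<mu> (\<Sum>i\<in>UNIV. (real (j i) - real (j' i)) *\<^sub>R axis i q)))"
      unfolding P_def by (rule fejer_measure_bound[OF finite_measure_axioms assms(2) _ N]) simp
    also have "\<dots> \<le> (\<Sum>j\<in>P. \<Sum>j'\<in>P. (if j = j' then 1 else 0) + C' * 2 powr \<sigma> * ((real n + 1) * N) powr e * norm q powr (- \<sigma>) * (1 + norm (w j - w j')) powr (- (real n + \<epsilon>)))"
      by (intro sum_mono term_bound)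
    also have "\<dots> \<le> (\<Sum>j\<in>P. 1 + C' * 2 powr \<sigma> * ((real n + 1) * N) powr e * norm q powr (- \<sigma>) * L)"
    proof (intro sum_mono)
      fix j assume j: "j \<in> P"
      have "(\<Sum>j'\<in>P. (1 + norm (w j - w j')) powr (- (real n + \<epsilon>))) = (\<Sum>l\<in>w ` P. (1 + norm (w j - l)) powr (- (real n + \<epsilon>)))"
        by (subst sum.reindex[OF inj]) simp
      also have "\<dots> \<le> L" using finP wl by (intro L(2)) auto
      finally show "(\<Sum>j'\<in>P. (if j = j' then 1 else 0) + C' * 2 powr \<sigma> * ((real n + 1) * N) powr e * norm q powr (- \<sigma>) * (1 + norm (w j - w j')) powr (- (real n + \<epsilon>))) \<le>
          1 + C' * 2 powr \<sigma> * ((real n + 1) * N) powr e * norm q powr (- \<sigma>) * L"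
        unfolding sum.distrib sum_distrib_left[symmetric] using finP j C'0 by (intro add_mono mult_left_mono) auto
    qed
    also have "\<dots> = real N ^ n * (1 + C' * 2 powr \<sigma> * ((real n + 1) * N) powr e * norm q powr (- \<sigma>) * L)"
      by (simp add: cardP)
    finally have main: "measure \<mu> {x. \<forall>i. \<exists>r::int. \<bar>(x *v q) $ i - of_int r\<bar> \<le> 1 / (8 * real N)} * ((real N)\<^sup>2 / 4) ^ n \<le>
        real N ^ n * (1 + C' * 2 powr \<sigma> * ((real n + 1) * N) powr e * norm q powr (- \<sigma>) * L)"
      by (simp add: inner_axis_matrix n_def)
    have "measure \<mu> {x. \<forall>i. \<exists>r::int. \<bar>(x *v q) $ i - of_int r\<bar> \<le> 1 / (8 * real N)} \<le>
        4 ^ n * (real N powr (- real n) * (1 + C' * 2 powr \<sigma> * ((real n + 1) * N) powr e * norm q powr (- \<sigma>) * L))"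
      (is "?m \<le> 4 ^ n * (_ * ?R)")
    proof -
      have "?m * (real N ^ n * real N ^ n / 4 ^ n) \<le> real N ^ n * ?R"
        using main by (simp add: power_divide power2_eq_square power_mult_distrib)
      moreover have "m \<le> b * (1 / a * R)" if "m * (a * a / b) \<le> a * R" "a > 0" "b > 0" for m a b R :: real
      proof -
        have "a * (m * a / b) \<le> a * R" using that by (simp add: mult_ac)
        then have "m * a / b \<le> R" using that(2) by (rule mult_left_le_imp_le)
        then show ?thesis using that by (simp add: field_simps)
      qed
      moreover have "real N powr (- real n) = 1 / real N ^ n" using N by (simp add: powr_minus_divide powr_realpow)
      moreover have "real N ^ n > 0" "(4::real) ^ n > 0" using N by auto
      ultimately show ?thesis by presburger
    qed
    also have "real N powr (- real n) * ?R = real N powr (- real n) + C' * 2 powr \<sigma> * (real n + 1) powr e * L * (norm q powr (- \<sigma>) * real N powr (\<epsilon> - \<sigma>))"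
    proof -
      have "((real n + 1) * real N) powr e = (real n + 1) powr e * real N powr e" by (simp add: powr_mult)
      moreover have "real N powr (- real n) * real N powr e = real N powr (\<epsilon> - \<sigma>)"
        by (simp add: powr_add[symmetric] e_def)
      ultimately show ?thesis by (simp add: distrib_left mult_ac)
    qed
    also have "4 ^ n * \<dots> \<le> D * (real N powr (- real n) + norm q powr (- \<sigma>) * real N powr (\<epsilon> - \<sigma>))"
    proof -
      have le: "x + b * y \<le> (1 + b) * (x + y)" if "x \<ge> 0" "b \<ge> 0" "y \<ge> 0" for x b y :: real
        using that by (simp add: distrib_left distrib_right)
      define b where "b = C' * 2 powr \<sigma> * (real n + 1) powr e * L"
      have "b \<ge> 0" using C'0 L(1) by (simp add: b_def)
      then show ?thesis unfolding D_def b_def[symmetric] mult.assoc[of "4 ^ n"] by (intro mult_left_mono le) auto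
    qed
    finally show "?m \<le> D * (real N powr (- real CARD('n)) + norm q powr (- \<sigma>) * real N powr (\<epsilon> - \<sigma>))"
      by (simp add: n_def)
  qed
qed

lemma finite_int_vec_box:
  fixes a b :: "'n::finite \<Rightarrow> int"
  shows "finite {r :: int ^ 'n. \<forall>i. r $ i \<in> {a i..b i}}"
proof -
  have "{r :: int ^ 'n. \<forall>i. r $ i \<in> {a i..b i}} \<subseteq> vec_lambda ` PiE UNIV (\<lambda>i. {a i..b i})"
  proof
    fix r :: "int ^ 'n" assume "r \<in> {r. \<forall>i. r $ i \<in> {a i..b i}}"
    then show "r \<in> vec_lambda ` PiE UNIV (\<lambda>i. {a i..b i})"
      by (intro image_eqI[of _ _ "\<lambda>i. r $ i"]) (auto simp: PiE_def vec_eq_iff)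
  qed
  moreover have "finite (PiE (UNIV::'n set) (\<lambda>i. {a i..b i}))" by (intro finite_PiE) auto
  ultimately show ?thesis using finite_subset by blast
qed

text \<open>For fixed \<open>q\<close> the admissible \<open>r\<close> lie in a bounded box, so
  infinitely many pairs force infinitely many \<open>q\<close>. Borel-Cantelli can then be applied
  over the denominators alone.\<close>

lemma infinite_denominators:
  fixes x :: "real ^ 'd ^ 'n"
  assumes "x \<in> well_approximable \<tau>"
  shows "infinite {q :: int ^ 'd. q \<noteq> 0 \<and> (\<exists>r :: int ^ 'n. infnorm (x *v real_vec q - real_vec r) < infnorm (real_vec q) powr (- \<tau>))}"
    (is "infinite ?Q")
proof
  assume fin: "finite ?Q"
  let ?R = "\<lambda>q :: int ^ 'd. {r :: int ^ 'n. infnorm (x *v real_vec q - real_vec r) < infnorm (real_vec q) powr (- \<tau>)}"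
  have "finite (?R q)" for q
  proof (rule finite_subset[OF _ finite_int_vec_box])
    show "?R q \<subseteq> {r. \<forall>i. r $ i \<in> {\<lfloor>(x *v real_vec q) $ i - infnorm (real_vec q) powr (- \<tau>)\<rfloor>..\<lceil>(x *v real_vec q) $ i + infnorm (real_vec q) powr (- \<tau>)\<rceil>}}"
    proof (intro subsetI CollectI allI)
      fix r i assume "r \<in> ?R q"
      then have "\<bar>(x *v real_vec q - real_vec r) $ i\<bar> < infnorm (real_vec q) powr (- \<tau>)"
        using component_le_infnorm_cart[of "x *v real_vec q - real_vec r" i] by simp
      then have "\<bar>(x *v real_vec q) $ i - real_of_int (r $ i)\<bar> < infnorm (real_vec q) powr (- \<tau>)"
        by (simp add: real_vec_def)
      then show "r $ i \<in> {\<lfloor>(x *v real_vec q) $ i - infnorm (real_vec q) powr (- \<tau>)\<rfloor>..\<lceil>(x *v real_vec q) $ i + infnorm (real_vec q) powr (- \<tau>)\<rceil>}"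
        unfolding atLeastAtMost_iff abs_less_iff by linarith
    qed
  qed
  then have "finite (SIGMA q:?Q. ?R q)" using fin by (intro finite_SigmaI)
  moreover have "{(q, r). q \<noteq> 0 \<and> infnorm (x *v real_vec q - real_vec r) < infnorm (real_vec q) powr (- \<tau>)} \<subseteq> (SIGMA q:?Q. ?R q)"
    by auto
  ultimately show False using assms unfolding well_approximable_def using finite_subset by blast
qed

lemma real_vec_eq_0_iff [simp]: "real_vec q = 0 \<longleftrightarrow> q = 0"
  by (simp add: real_vec_def vec_eq_iff)

lemma real_vec_int_lattice: "real_vec q \<in> int_lattice"
  unfolding real_vec_def by (rule vec_int_lattice)

lemma inj_real_vec: "inj real_vec"
  by (auto simp: inj_def real_vec_def vec_eq_iff)

lemma prob_measure_not_rapidly_decaying: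
  fixes \<mu> :: "(real ^ 'd ^ 'n) measure"
  assumes tau: "\<tau> > real CARD('d) / real CARD('n)" and mu: "prob_space \<mu>" "sets \<mu> = sets borel"
    and supp: "measure_support \<mu> \<subseteq> well_approximable \<tau>"
    and decay: "\<And>\<xi>. \<xi> \<noteq> 0 \<Longrightarrow> norm (fourier_transform \<mu> \<xi>) \<le> C * norm \<xi> powr (- \<sigma>)"
    and sigma: "real CARD('d) / (1 + \<tau>) < \<sigma>" "\<sigma> \<le> real CARD('n)"
  shows False
proof -
  interpret prob_space \<mu> by fact
  define d n where "d = real CARD('d)" and "n = real CARD('n)"
  have dn: "d > 0" "n > 0" by (auto simp: d_def n_def)
  have tau0: "\<tau> > 0" using tau dn by (smt (verit) d_def divide_pos_pos n_def)
  have taun: "\<tau> * n > d" using tau dn by (simp add: d_def n_def field_simps)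
  have sig: "(1 + \<tau>) * \<sigma> > d" using sigma(1) tau0 by (simp add: d_def field_simps)
  have sig0: "\<sigma> > 0" 
  proof -
    have "d / (1 + \<tau>) > 0" using dn tau0 by simp
    then show ?thesis using sigma(1) unfolding d_def by linarith
  qed
  \<comment> \<open>The first entry keeps \<open>\<sigma> - \<epsilon>\<close> positive, the second
    uses half of the slack in \<open>(1 + \<tau>) * \<sigma> > d\<close>.\<close>
  define \<epsilon> where "\<epsilon> = min (\<sigma> / 2) (((1 + \<tau>) * \<sigma> - d) / (2 * \<tau>))"
  have eps: "\<epsilon> > 0" "\<epsilon> < \<sigma>" using sig sig0 tau0 by (auto simp: \<epsilon>_def)
  have "\<epsilon> * \<tau> \<le> ((1 + \<tau>) * \<sigma> - d) / (2 * \<tau>) * \<tau>" using tau0 by (intro mult_right_mono) (auto simp: \<epsilon>_def)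
  also have "\<dots> = ((1 + \<tau>) * \<sigma> - d) / 2" using tau0 by simp
  also have "\<dots> < (1 + \<tau>) * \<sigma> - d"
  proof -
    have "y / 2 < y" if "y > 0" for y :: real using that by simp
    then show ?thesis using sig by (simp only: diff_gt_0_iff_gt)
  qed
  finally have eps3: "\<epsilon> * \<tau> < (1 + \<tau>) * \<sigma> - d" .
  \<comment> \<open>The smaller of the decay exponents in \<open>q\<close> of the two terms of the
    bound when \<open>N\<close> has the order of the \<tau>-th power of \<open>q\<close>.
    Summability over the denominators means that it exceeds \<open>d\<close>.\<close>
  define \<alpha> where "\<alpha> = min (\<tau> * n) (\<sigma> + \<tau> * (\<sigma> - \<epsilon>))"
  have alpha: "\<alpha> > d" using taun eps3 by (simp add: \<alpha>_def algebra_simps)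
  have alpha0: "\<alpha> > 0" using alpha dn by simp
  have "\<exists>D>0. \<forall>(q :: real ^ 'd) N. q \<noteq> 0 \<longrightarrow> N > 0 \<longrightarrow>
    measure \<mu> {x. \<forall>i. \<exists>r::int. \<bar>(x *v q) $ i - of_int r\<bar> \<le> 1 / (8 * real N)} \<le>
      D * (real N powr (- n) + norm q powr (- \<sigma>) * real N powr (\<epsilon> - \<sigma>))"
    unfolding n_def by (rule approx_measure_bound[OF mu _ eps(1) less_imp_le[OF sig0] sigma(2)]) (rule decay)
  then obtain D where D: "D > 0" "\<And>(q :: real ^ 'd) N. q \<noteq> 0 \<Longrightarrow> N > 0 \<Longrightarrow>
    measure \<mu> {x. \<forall>i. \<exists>r::int. \<bar>(x *v q) $ i - of_int r\<bar> \<le> 1 / (8 * real N)} \<le>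
      D * (real N powr (- n) + norm q powr (- \<sigma>) * real N powr (\<epsilon> - \<sigma>))"
    by blast
  \<comment> \<open>With this degree \<open>1 / (8 * Nq q)\<close> is at least the tolerance
    \<open>infnorm (real_vec q) powr (- \<tau>)\<close>, so the Fejer set contains all matrices
    approximable with denominator \<open>q\<close>.\<close>
  define Nq where "Nq q = nat \<lfloor>infnorm (real_vec q) powr \<tau> / 8\<rfloor>" for q :: "int ^ 'd"
  \<comment> \<open>Below the threshold 8 the degree would be 0. Only finitely many \<open>q\<close>
    lie there, and dropping them does not affect whether a point lies in infinitely many of the
    sets.\<close>
  define A where "A q = (if infnorm (real_vec q) powr \<tau> \<ge> 8 then {x :: real ^ 'd ^ 'n. \<forall>i. \<exists>r::int. \<bar>(x *v real_vec q) $ i - of_int r\<bar> \<le> 1 / (8 * real (Nq q))} else {})" for q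
  have Asets: "A q \<in> sets \<mu>" for q
    unfolding A_def mu(2) using near_lattice_sets[of "UNIV :: 'n set" "\<lambda>i. axis i (real_vec q)" "1 / (8 * real (Nq q))"]
    by (simp add: inner_axis_matrix)
  define s where "s = sqrt (real DIM(real ^ 'd))"
  have s0: "s \<ge> 1" by (simp add: s_def)
  define B where "B = D * 2 * 16 powr (n + \<sigma>) * (2 * s) powr \<alpha>"
  have A_bound: "measure \<mu> (A q) \<le> B * (1 + norm (real_vec q)) powr (- \<alpha>)" for q
  proof (cases "infnorm (real_vec q) powr \<tau> \<ge> 8")
    case False
    then show ?thesis using D(1) by (simp add: A_def B_def)
  next
    case True
    define u where "u = infnorm (real_vec q)"
    have u8: "u powr \<tau> \<ge> 8" using True by (simp add: u_def)
    have "u \<noteq> 0" using u8 by auto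
    then have u0: "u > 0" using infnorm_pos_le[of "real_vec q"] by (simp add: u_def)
    have u1: "u > 1"
    proof (rule ccontr)
      assume "\<not> u > 1"
      then have "u powr \<tau> \<le> 1 powr \<tau>" using u0 tau0 by (intro powr_mono2) auto
      then show False using u8 by simp
    qed
    have q0: "real_vec q \<noteq> 0"
    proof
      assume "real_vec q = 0"
      then have "u = 0" unfolding u_def by (simp only: infnorm_0)
      then show False using u0 by simp
    qed
    have un: "u \<le> norm (real_vec q)" "norm (real_vec q) \<le> s * u"
      using infnorm_le_norm[of "real_vec q"] norm_le_infnorm[of "real_vec q"] by (auto simp: u_def s_def)
    define N where "N = Nq q"
    have fl: "\<lfloor>u powr \<tau> / 8\<rfloor> \<ge> 1" using u8 by (simp add: le_floor_iff)
    then have N: "N > 0" by (simp add: N_def Nq_def u_def)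
    have Nr: "real N = of_int \<lfloor>u powr \<tau> / 8\<rfloor>" using fl by (simp add: N_def Nq_def u_def)
    have "u powr \<tau> / 8 < of_int \<lfloor>u powr \<tau> / 8\<rfloor> + 1" by simp
    also have "\<dots> \<le> 2 * of_int \<lfloor>u powr \<tau> / 8\<rfloor>" using fl by linarith
    finally have Nge: "real N \<ge> u powr \<tau> / 16" using Nr by simp
    have pw: "real N powr (- e) \<le> 16 powr e * u powr (- (\<tau> * e))" if "e \<ge> 0" for e
    proof -
      have "real N powr (- e) \<le> (u powr \<tau> / 16) powr (- e)" using Nge u0 that by (intro powr_mono2') auto
      also have "\<dots> = 16 powr e * u powr (- (\<tau> * e))"
        using u0 by (simp add: powr_divide powr_powr powr_minus field_simps)
      finally show ?thesis .
    qed
    have "measure \<mu> (A q) \<le> D * (real N powr (- n) + norm (real_vec q) powr (- \<sigma>) * real N powr (\<epsilon> - \<sigma>))"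
      using D(2)[OF q0 N] True by (simp add: A_def N_def)
    also have "\<dots> \<le> D * (16 powr (n + \<sigma>) * u powr (- \<alpha>) + 16 powr (n + \<sigma>) * u powr (- \<alpha>))"
    proof (intro mult_left_mono add_mono)
      have "real N powr (- n) \<le> 16 powr n * u powr (- (\<tau> * n))" using pw[of n] dn by simp
      also have "\<dots> \<le> 16 powr (n + \<sigma>) * u powr (- \<alpha>)"
        using u1 sig0 by (intro mult_mono powr_mono) (auto simp: \<alpha>_def)
      finally show "real N powr (- n) \<le> 16 powr (n + \<sigma>) * u powr (- \<alpha>)" .
      have "norm (real_vec q) powr (- \<sigma>) * real N powr (\<epsilon> - \<sigma>) \<le> u powr (- \<sigma>) * (16 powr (\<sigma> - \<epsilon>) * u powr (- (\<tau> * (\<sigma> - \<epsilon>))))"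
        using pw[of "\<sigma> - \<epsilon>"] eps un u0 sig0 by (intro mult_mono powr_mono2') auto
      also have "\<dots> = 16 powr (\<sigma> - \<epsilon>) * u powr (- (\<sigma> + \<tau> * (\<sigma> - \<epsilon>)))"
        using u0 by (simp add: powr_add[symmetric] mult_ac)
      also have "\<dots> \<le> 16 powr (n + \<sigma>) * u powr (- \<alpha>)"
        using u1 eps dn by (intro mult_mono powr_mono) (auto simp: \<alpha>_def)
      finally show "norm (real_vec q) powr (- \<sigma>) * real N powr (\<epsilon> - \<sigma>) \<le> 16 powr (n + \<sigma>) * u powr (- \<alpha>)" .
    qed (use D in auto)
    also have "\<dots> = D * 2 * 16 powr (n + \<sigma>) * u powr (- \<alpha>)" by simp
    also have "u powr (- \<alpha>) \<le> (2 * s) powr \<alpha> * (1 + norm (real_vec q)) powr (- \<alpha>)"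
    proof -
      have "1 \<le> s * u" using mult_mono[of 1 s 1 u] s0 u1 by simp
      then have "1 + norm (real_vec q) \<le> 2 * s * u" using un by linarith
      then have "(2 * s * u) powr (- \<alpha>) \<le> (1 + norm (real_vec q)) powr (- \<alpha>)"
        using alpha0 by (intro powr_mono2') (auto intro: add_pos_nonneg)
      then have "(2 * s) powr \<alpha> * ((2 * s) powr (- \<alpha>) * u powr (- \<alpha>)) \<le> (2 * s) powr \<alpha> * (1 + norm (real_vec q)) powr (- \<alpha>)"
        using s0 u0 by (intro mult_left_mono) (auto simp: powr_mult)
      moreover have "(2 * s) powr \<alpha> * (2 * s) powr (- \<alpha>) = 1" using s0 by (simp add: powr_minus)
      ultimately show ?thesis by (simp add: mult.assoc[symmetric])
    qed
    finally show ?thesis using D(1) by (simp add: B_def mult_ac)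
  qed
  have "\<alpha> > real DIM(real ^ 'd)" using alpha by (simp add: d_def)
  then obtain L where L: "L > 0" "\<And>(\<xi>::real ^ 'd) T. finite T \<Longrightarrow> T \<subseteq> int_lattice \<Longrightarrow> (\<Sum>l\<in>T. (1 + norm (\<xi> - l)) powr (- \<alpha>)) \<le> L"
    using lattice_powr_sum_bound by metis
  have sumA: "(\<Sum>q\<in>T. measure \<mu> (A q)) \<le> B * L" if T: "finite T" for T
  proof -
    have "(\<Sum>q\<in>T. measure \<mu> (A q)) \<le> B * (\<Sum>q\<in>T. (1 + norm (0 - real_vec q)) powr (- \<alpha>))"
      unfolding sum_distrib_left using A_bound by (intro sum_mono) simp
    also have "(\<Sum>q\<in>T. (1 + norm (0 - real_vec q)) powr (- \<alpha>)) = (\<Sum>l\<in>real_vec ` T. (1 + norm (0 - l)) powr (- \<alpha>))"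
      by (subst sum.reindex) (auto intro: inj_on_subset[OF inj_real_vec])
    also have "B * \<dots> \<le> B * L"
      using T D(1) by (intro mult_left_mono L(2)) (auto simp: B_def real_vec_int_lattice)
    finally show ?thesis .
  qed
  \<comment> \<open>Borel-Cantelli speaks of sequences, so the denominators are enumerated; numbers
    that code no denominator get the empty set.\<close>
  define A' where "A' k = (if k \<in> range (to_nat :: int ^ 'd \<Rightarrow> nat) then A (from_nat k) else {})" for k
  have "summable (\<lambda>k. measure \<mu> (A' k))"
  proof (rule summableI_nonneg_bounded)
    fix K
    have "(\<Sum>k<K. measure \<mu> (A' k)) = (\<Sum>k\<in>{..<K} \<inter> range (to_nat :: int ^ 'd \<Rightarrow> nat). measure \<mu> (A (from_nat k)))"
      by (simp add: A'_def if_distrib[of "measure \<mu>"] sum.If_cases cong: if_cong)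
    also have "\<dots> = (\<Sum>q\<in>from_nat ` ({..<K} \<inter> range (to_nat :: int ^ 'd \<Rightarrow> nat)). measure \<mu> (A q))"
      by (subst sum.reindex) (auto simp: inj_on_def)
    also have "\<dots> \<le> B * L" by (intro sumA) auto
    finally show "(\<Sum>k<K. measure \<mu> (A' k)) \<le> B * L" .
  qed simp
  then have ev: "AE x in \<mu>. eventually (\<lambda>k. x \<in> space \<mu> - A' k) sequentially"
    using Asets by (intro borel_cantelli_AE1) (auto simp: A'_def emeasure_eq_measure less_top[symmetric])
  have sp: "space \<mu> = UNIV" using sets_eq_imp_space_eq[OF mu(2)] by simp
  have "AE x in \<mu>. x \<in> measure_support \<mu>"
    using measure_support_null[OF mu(2)] mu(2) sp by (intro AE_I[of _ _ "UNIV - measure_support \<mu>"]) auto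
  with ev have "AE x in \<mu>. False"
  proof eventually_elim
    case (elim x)
    then have "x \<in> well_approximable \<tau>" using supp by auto
    from infinite_denominators[OF this]
    have inf: "infinite {q :: int ^ 'd. q \<noteq> 0 \<and> (\<exists>r :: int ^ 'n. infnorm (x *v real_vec q - real_vec r) < infnorm (real_vec q) powr (- \<tau>))}" (is "infinite ?Q") .
    have fin8: "finite {q :: int ^ 'd. infnorm (real_vec q) powr \<tau> < 8}"
    proof (rule finite_subset[OF _ finite_int_vec_box])
      show "{q :: int ^ 'd. infnorm (real_vec q) powr \<tau> < 8} \<subseteq> {q. \<forall>i. q $ i \<in> {- \<lceil>8 powr (1 / \<tau>)\<rceil>..\<lceil>8 powr (1 / \<tau>)\<rceil>}}"
      proof (intro subsetI CollectI allI)
        fix q :: "int ^ 'd" and i assume "q \<in> {q. infnorm (real_vec q) powr \<tau> < 8}"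
        then have "(infnorm (real_vec q) powr \<tau>) powr (1 / \<tau>) \<le> 8 powr (1 / \<tau>)" using tau0 by (intro powr_mono2) auto
        then have "infnorm (real_vec q) \<le> 8 powr (1 / \<tau>)" using tau0 infnorm_pos_le[of "real_vec q"] by (simp add: powr_powr)
        then have "\<bar>real_of_int (q $ i)\<bar> \<le> 8 powr (1 / \<tau>)"
          using component_le_infnorm_cart[of "real_vec q" i] by (simp add: real_vec_def)
        then show "q $ i \<in> {- \<lceil>8 powr (1 / \<tau>)\<rceil>..\<lceil>8 powr (1 / \<tau>)\<rceil>}"
          unfolding atLeastAtMost_iff abs_le_iff by linarith
      qed
    qed
    have xA: "x \<in> A q" if qQ: "q \<in> ?Q" "\<not> infnorm (real_vec q) powr \<tau> < 8" for q
    proof -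
      define u where "u = infnorm (real_vec q)"
      have u8: "u powr \<tau> \<ge> 8" using qQ by (simp add: u_def)
      obtain r :: "int ^ 'n" where r: "infnorm (x *v real_vec q - real_vec r) < u powr (- \<tau>)" using qQ by (auto simp: u_def)
      have fl: "\<lfloor>u powr \<tau> / 8\<rfloor> \<ge> 1" using u8 by (simp add: le_floor_iff)
      have Nr: "real (Nq q) = of_int \<lfloor>u powr \<tau> / 8\<rfloor>" using fl by (simp add: Nq_def u_def)
      have "8 * real (Nq q) \<le> u powr \<tau>" using of_int_floor_le[of "u powr \<tau> / 8"] unfolding Nr by linarith
      moreover have "real (Nq q) \<ge> 1" using fl Nr by simp
      ultimately have "1 / u powr \<tau> \<le> 1 / (8 * real (Nq q))" by (intro frac_le) auto
      then have "u powr (- \<tau>) \<le> 1 / (8 * real (Nq q))" by (simp add: powr_minus_divide)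
      then have "\<bar>(x *v real_vec q) $ i - of_int (r $ i)\<bar> \<le> 1 / (8 * real (Nq q))" for i
        using component_le_infnorm_cart[of "x *v real_vec q - real_vec r" i] r by (simp add: real_vec_def)
      then show ?thesis using u8 unfolding A_def u_def[symmetric] by auto
    qed
    have sub: "to_nat ` (?Q - {q. infnorm (real_vec q) powr \<tau> < 8}) \<subseteq> {k. x \<in> A' k}"
    proof (intro image_subsetI)
      fix q assume "q \<in> ?Q - {q. infnorm (real_vec q) powr \<tau> < 8}"
      then have "x \<in> A q" by (intro xA) blast+
      then show "to_nat q \<in> {k. x \<in> A' k}" by (simp add: A'_def)
    qed
    have "infinite (to_nat ` (?Q - {q. infnorm (real_vec q) powr \<tau> < 8}))"
      using inf fin8 by (subst finite_image_iff) (auto simp: inj_on_def)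
    then have "infinite {k. x \<in> A' k}" using sub finite_subset by blast
    moreover have "finite {k. x \<in> A' k}"
    proof -
      obtain K where "\<And>k. k \<ge> K \<Longrightarrow> x \<notin> A' k" using elim(1) by (auto simp: eventually_sequentially)
      then have "{k. x \<in> A' k} \<subseteq> {..<K}" by (auto simp: not_le[symmetric])
      then show ?thesis using finite_subset by blast
    qed
    ultimately show False by simp
  qed
  then show False by (simp add: AE_False)
qed

lemma fourier_dim_measure_le:
  fixes \<mu> :: "(real ^ 'd ^ 'n) measure"
  assumes tau: "\<tau> > real CARD('d) / real CARD('n)" and mu: "\<mu> \<in> prob_measures_on (well_approximable \<tau>)"
  shows "fourier_dim_measure \<mu> \<le> 2 * real CARD('d) / (1 + \<tau>)"
proof -
  have tau0: "\<tau> > 0" using tau by (smt (verit) divide_nonneg_nonneg of_nat_0_le_iff)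
  have prob: "prob_space \<mu>" and sets: "sets \<mu> = sets borel" and supp: "measure_support \<mu> \<subseteq> well_approximable \<tau>"
    using mu by (auto simp: prob_measures_on_def)
  have fin: "finite_measure \<mu>" using prob by (rule prob_space.axioms(1))
  have le1: "norm (fourier_transform \<mu> \<xi>) \<le> 1" for \<xi>
    using norm_fourier_transform_le[OF fin] prob_space.prob_space[OF prob] by simp
  let ?S = "{s \<in> {0..real DIM(real ^ 'd ^ 'n)}. \<exists>C. \<forall>\<xi>. \<xi> \<noteq> 0 \<longrightarrow> norm (fourier_transform \<mu> \<xi>) \<le> C * norm \<xi> powr (- s / 2)}"
  have "0 \<in> ?S" using le1 by (auto intro!: exI[of _ 1])
  then have ne: "?S \<noteq> {}" by blast
  have "s \<le> 2 * real CARD('d) / (1 + \<tau>)" if s: "s \<in> ?S" for s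
  proof (rule ccontr)
    assume "\<not> ?thesis"
    then have "s > 2 * (real CARD('d) / (1 + \<tau>))" by simp
    then have s2: "s / 2 > real CARD('d) / (1 + \<tau>)" by linarith
    obtain C where C: "\<And>\<xi>. \<xi> \<noteq> 0 \<Longrightarrow> norm (fourier_transform \<mu> \<xi>) \<le> C * norm \<xi> powr (- (s / 2))" using s by auto
    \<comment> \<open>The preceding lemma asks for \<open>\<sigma> \<le> n\<close>, whereas
      \<open>s / 2\<close> may be larger. Capping loses nothing, since \<open>d < n * \<tau>\<close>
      puts the critical value \<open>d / (1 + \<tau>)\<close> below \<open>n\<close>.\<close>
    define \<sigma> where "\<sigma> = min (s / 2) (real CARD('n))"
    have "real CARD('d) < real CARD('n) * \<tau>" using tau by (simp add: field_simps)
    then have "real CARD('d) / (1 + \<tau>) < real CARD('n)" using tau0 by (simp add: field_simps)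
    then have sig: "real CARD('d) / (1 + \<tau>) < \<sigma>" "\<sigma> \<le> real CARD('n)" "\<sigma> \<le> s / 2" using s2 by (auto simp: \<sigma>_def)
    have sig0: "\<sigma> \<ge> 0" using sig(1) tau0 by (smt (verit) divide_nonneg_nonneg of_nat_0_le_iff)
    have "norm (fourier_transform \<mu> \<xi>) \<le> max C 1 * norm \<xi> powr (- \<sigma>)" if xi: "\<xi> \<noteq> 0" for \<xi>
    proof (cases "norm \<xi> \<ge> 1")
      case True
      have "C * norm \<xi> powr (- (s / 2)) \<le> max C 1 * norm \<xi> powr (- \<sigma>)"
        using True sig by (intro mult_mono powr_mono) auto
      then show ?thesis using C[OF xi] by linarith
    next
      case False
      have "norm \<xi> powr (- \<sigma>) \<ge> norm \<xi> powr 0" using False xi sig0 by (intro powr_mono') auto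
      then have "norm \<xi> powr (- \<sigma>) \<ge> 1" using xi by simp
      then have "1 * 1 \<le> max C 1 * norm \<xi> powr (- \<sigma>)" by (intro mult_mono) auto
      then show ?thesis using le1[of \<xi>] by linarith
    qed
    from prob_measure_not_rapidly_decaying[OF tau prob sets supp this sig(1,2)] show False .
  qed
  then have "Sup ?S \<le> 2 * real CARD('d) / (1 + \<tau>)" by (rule cSup_least[OF ne])
  then show ?thesis by (simp only: fourier_dim_measure_def)
qed

section \<open>Lower bounds for the Hausdorff dimension\<close>

lemma diameter_coordinate_cube:
  fixes S :: "'a::euclidean_space set"
  assumes "c \<ge> 0" "\<And>x b. x \<in> S \<Longrightarrow> b \<in> Basis \<Longrightarrow> u b \<le> x \<bullet> b \<and> x \<bullet> b \<le> u b + c"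
  shows "bounded S" "diameter S \<le> real DIM('a) * c"
proof -
  have d: "dist x y \<le> real DIM('a) * c" if "x \<in> S" "y \<in> S" for x y
  proof -
    have "dist x y \<le> (\<Sum>b\<in>Basis. \<bar>(x - y) \<bullet> b\<bar>)" unfolding dist_norm by (rule norm_le_l1)
    also have "\<dots> \<le> (\<Sum>b\<in>(Basis::'a set). c)"
    proof (intro sum_mono)
      fix b :: 'a assume "b \<in> Basis"
      then have "u b \<le> x \<bullet> b" "x \<bullet> b \<le> u b + c" "u b \<le> y \<bullet> b" "y \<bullet> b \<le> u b + c" using assms(2) that by auto
      then show "\<bar>(x - y) \<bullet> b\<bar> \<le> c" unfolding inner_diff_left abs_le_iff by linarith
    qed
    finally show ?thesis by simp
  qed
  then show "bounded S" unfolding bounded_two_points by blast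
  show "diameter S \<le> real DIM('a) * c" by (rule diameter_le) (use d assms(1) in \<open>auto simp: dist_norm\<close>)
qed

text \<open>It makes the set in the definition of \<open>hausdorff_dim\<close> nonempty, without
  which a real infimum has no lower bound property. Box number \<open>k\<close>, of side
  \<open>2 * (k + 1)\<close>, is cut into \<open>n ^ m\<close> cubes; with exponent
  \<open>m + 1\<close> their total weight is a constant over \<open>n\<close>, so a large
  \<open>n\<close> for each \<open>k\<close> gives a convergent total below \<epsilon>.\<close>

lemma hausdorff_measure_zero_large:
  fixes E :: "'a::euclidean_space set"
  shows "hausdorff_measure (real DIM('a) + 1) E = 0"
proof -
  define m where "m = DIM('a)"
  define s where "s = real m + 1"
  have m: "m > 0" by (simp add: m_def)
  have "hausdorff_premeasure s \<delta> E = 0" if delta: "\<delta> > 0" for \<delta> :: real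
  proof -
    have le: "hausdorff_premeasure s \<delta> E \<le> ennreal \<epsilon>" if eps: "\<epsilon> > 0" for \<epsilon> :: real
    proof -
      define c where "c k n = 2 * (real k + 1) / real n" for k n :: nat
      define Q where "Q k n f = {x :: 'a. \<forall>b\<in>Basis. (- (real k + 1) + c k n * real (f b)) \<le> x \<bullet> b \<and> x \<bullet> b \<le> (- (real k + 1) + c k n * real (f b)) + c k n}"
        for k n :: nat and f :: "'a \<Rightarrow> nat"
      have "\<exists>n>0. real m * c k n \<le> \<delta> \<and> real n ^ m * (real m * c k n) powr s \<le> \<epsilon> * (1 / 2) ^ Suc k" for k
      proof -
        define a where "a = real m * (2 * (real k + 1))"
        have a: "a > 0" using m by (simp add: a_def)
        obtain n :: nat where n: "real n > max (a / \<delta>) (max 1 (a powr s / (\<epsilon> * (1 / 2) ^ Suc k)))" using reals_Archimedean2 by blast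
        then have n0: "n > 0" by (cases n) auto
        have mc: "real m * c k n = a / real n" by (simp add: c_def a_def)
        have "a / real n \<le> \<delta>" using n n0 delta by (simp add: field_simps)
        moreover have "real n ^ m * (a / real n) powr s = a powr s / real n"
        proof -
          have "real n powr s = real n ^ m * real n" using n0 by (simp add: s_def powr_add powr_realpow)
          then show ?thesis using n0 a by (simp add: powr_divide)
        qed
        moreover have "a powr s / real n \<le> \<epsilon> * (1 / 2) ^ Suc k"
        proof -
          have "a powr s / (\<epsilon> * (1 / 2) ^ Suc k) \<le> real n" using n by linarith
          moreover have "\<epsilon> * (1 / 2) ^ Suc k > 0" using eps by simp
          ultimately show ?thesis using n0 by (simp only: divide_le_eq mult.commute of_nat_0_less_iff if_True split: if_splits)
        qed
        ultimately show ?thesis using n0 mc by auto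
      qed
      then obtain n where n: "\<And>k. n k > 0" "\<And>k. real m * c k (n k) \<le> \<delta>"
        "\<And>k. real (n k) ^ m * (real m * c k (n k)) powr s \<le> \<epsilon> * (1 / 2) ^ Suc k" by metis
      define F where "F k = PiE (Basis :: 'a set) (\<lambda>_. {..<n k})" for k
      have finF: "finite (F k)" for k unfolding F_def by (intro finite_PiE) auto
      have cardF: "card (F k) = n k ^ m" for k unfolding F_def by (simp add: card_PiE m_def)
      have "\<exists>h. bij_betw h {0..<card (F k)} (F k)" for k using ex_bij_betw_nat_finite[OF finF] by blast
      then obtain h where h: "\<And>k. bij_betw (h k) {0..<card (F k)} (F k)" by metis
      \<comment> \<open>Pairs \<open>(k, j)\<close> number the cubes of box \<open>k\<close>;
        indices past the last cube give the empty set, whose \<open>diam_power\<close> is 0.\<close>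
      define V where "V p = (if snd p < card (F (fst p)) then Q (fst p) (n (fst p)) (h (fst p) (snd p)) else {})" for p :: "nat \<times> nat"
      define U where "U i = V (prod_decode i)" for i
      have c0: "c k (n k) \<ge> 0" for k by (simp add: c_def)
      have Vd: "bounded (V p)" "diameter (V p) \<le> real m * c (fst p) (n (fst p))" for p
      proof -
        have "bounded (Q k (n k) f)" "diameter (Q k (n k) f) \<le> real m * c k (n k)" for k f
          unfolding m_def by (rule diameter_coordinate_cube[OF c0], auto simp: Q_def)+
        then show "bounded (V p)" "diameter (V p) \<le> real m * c (fst p) (n (fst p))" using c0 by (auto simp: V_def)
      qed
      have cover: "E \<subseteq> (\<Union>i. U i)"
      proof
        fix x :: 'a
        obtain k :: nat where k: "norm x < real k" using reals_Archimedean2 by blast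
        define f where "f = restrict (\<lambda>b. nat \<lfloor>(x \<bullet> b + (real k + 1)) / c k (n k)\<rfloor>) Basis"
        have cp: "c k (n k) > 0" using n(1)[of k] by (simp add: c_def)
        have fb: "real (f b) \<le> (x \<bullet> b + (real k + 1)) / c k (n k)" "(x \<bullet> b + (real k + 1)) / c k (n k) < real (f b) + 1" "f b < n k" if b: "b \<in> Basis" for b
        proof -
          have xb: "\<bar>x \<bullet> b\<bar> < real k" using Basis_le_norm[OF b, of x] k by linarith
          define t where "t = (x \<bullet> b + (real k + 1)) / c k (n k)"
          have t0: "t \<ge> 0" unfolding t_def using xb cp by (intro divide_nonneg_pos) auto
          then have fb: "real (f b) = of_int \<lfloor>t\<rfloor>" using b by (simp add: f_def t_def)
          have "t < (2 * (real k + 1)) / c k (n k)" unfolding t_def using xb cp by (intro divide_strict_right_mono) auto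
          also have "\<dots> = real (n k)" by (simp add: c_def)
          finally have tn: "t < real (n k)" .
          show "real (f b) \<le> (x \<bullet> b + (real k + 1)) / c k (n k)" "(x \<bullet> b + (real k + 1)) / c k (n k) < real (f b) + 1"
            unfolding fb t_def[symmetric] by linarith+
          have "real (f b) < real (n k)" unfolding fb using tn by linarith
          then show "f b < n k" by simp
        qed
        have "f \<in> F k" unfolding F_def PiE_def using fb(3) by (auto simp: f_def)
        then have "f \<in> h k ` {0..<card (F k)}" using h[of k] by (simp add: bij_betw_def)
        then obtain j where j: "j < card (F k)" "h k j = f" by auto
        have "x \<in> Q k (n k) f"
          unfolding Q_def
        proof (intro CollectI ballI)
          fix b :: 'a assume b: "b \<in> Basis"
          have "c k (n k) * real (f b) \<le> x \<bullet> b + (real k + 1)" using fb(1)[OF b] cp by (simp add: pos_le_divide_eq mult.commute)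
          moreover have "x \<bullet> b + (real k + 1) < c k (n k) * (real (f b) + 1)" using fb(2)[OF b] cp by (simp add: pos_divide_less_eq mult.commute)
          ultimately show "- (real k + 1) + c k (n k) * real (f b) \<le> x \<bullet> b \<and> x \<bullet> b \<le> - (real k + 1) + c k (n k) * real (f b) + c k (n k)"
            unfolding distrib_left by linarith
        qed
        then have "x \<in> U (prod_encode (k, j))" using j by (simp add: U_def V_def)
        then show "x \<in> (\<Union>i. U i)" by blast
      qed
      have "(\<Sum>i. diam_power s (U i)) = (\<Sum>k. \<Sum>j. diam_power s (V (k, j)))"
        unfolding U_def by (rule suminf_ennreal_2dimen) simp
      also have "\<dots> \<le> (\<Sum>k. ennreal (\<epsilon> * (1 / 2) ^ Suc k))"
      proof (intro suminf_le summableI)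
        fix k
        have "(\<Sum>j. diam_power s (V (k, j))) = (\<Sum>j<card (F k). diam_power s (V (k, j)))"
          by (rule suminf_finite) (auto simp: V_def diam_power_def)
        also have "\<dots> \<le> (\<Sum>j<card (F k). ennreal ((real m * c k (n k)) powr s))"
        proof (intro sum_mono)
          fix j
          have "diameter (V (k, j)) powr s \<le> (real m * c k (n k)) powr s"
            using Vd[of "(k, j)"] diameter_ge_0[of "V (k, j)"] m by (intro powr_mono2) (auto simp: s_def)
          then show "diam_power s (V (k, j)) \<le> ennreal ((real m * c k (n k)) powr s)"
            using m by (auto simp: diam_power_def s_def intro: ennreal_leI)
        qed
        also have "\<dots> = ennreal (real (n k) ^ m * (real m * c k (n k)) powr s)"
          by (simp add: cardF ennreal_mult ennreal_of_nat_eq_real_of_nat)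
        also have "\<dots> \<le> ennreal (\<epsilon> * (1 / 2) ^ Suc k)" by (intro ennreal_leI n)
        finally show "(\<Sum>j. diam_power s (V (k, j))) \<le> ennreal (\<epsilon> * (1 / 2) ^ Suc k)" .
      qed
      also have "\<dots> = ennreal \<epsilon>"
      proof -
        have "(\<lambda>k. \<epsilon> * (1 / 2) ^ Suc k) sums \<epsilon>" using sums_mult[OF power_half_series, of \<epsilon>] by simp
        then show ?thesis using eps by (intro suminf_ennreal_eq) auto
      qed
      finally have sum_le: "(\<Sum>i. diam_power s (U i)) \<le> ennreal \<epsilon>" .
      have "bounded (U i) \<and> diameter (U i) \<le> \<delta>" for i
        using Vd[of "prod_decode i"] n(2) order_trans by (auto simp: U_def)
      then have "hausdorff_premeasure s \<delta> E \<le> (\<Sum>i. diam_power s (U i))"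
        unfolding hausdorff_premeasure_def using cover by (intro Inf_lower) blast
      then show ?thesis using sum_le by (rule order_trans)
    qed
    show ?thesis
    proof -
      have "hausdorff_premeasure s \<delta> E \<le> 0" by (rule ennreal_le_epsilon) (use le in simp)
      then show ?thesis by simp
    qed
  qed
  then have "hausdorff_measure s E \<le> 0" unfolding hausdorff_measure_def by (intro SUP_least) simp
  then show ?thesis by (simp add: s_def m_def)
qed

section \<open>Energy of a measure and concentration on small sets\<close>

text \<open>Neighbourhoods of the diagonal under the product measure are neighbourhoods of 0 under
  the law of \<open>y - x\<close>. The squared modulus of the transform is where the energy enters
  the Fejer bound.\<close>

lemma difference_measure:
  fixes \<mu> :: "'a::euclidean_space measure"
  assumes "prob_space \<mu>" "sets \<mu> = sets borel"
  defines "\<rho> \<equiv> distr (\<mu> \<Otimes>\<^sub>M \<mu>) borel (\<lambda>(x, y). y - x)"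
  shows "prob_space \<rho>" and "norm (fourier_transform \<rho> \<xi>) = (norm (fourier_transform \<mu> \<xi>))\<^sup>2"
    and "(\<lambda>(x, y). y - x) \<in> measurable (\<mu> \<Otimes>\<^sub>M \<mu>) borel"
proof -
  interpret \<mu>: prob_space \<mu> by fact
  interpret P: pair_prob_space \<mu> \<mu> ..
  have setsP: "sets (\<mu> \<Otimes>\<^sub>M \<mu>) = sets (borel \<Otimes>\<^sub>M borel)"
    by (rule sets_pair_measure_cong) (use assms in auto)
  show m: "(\<lambda>(x, y). y - x) \<in> measurable (\<mu> \<Otimes>\<^sub>M \<mu>) borel"
    unfolding measurable_cong_sets[OF setsP refl] by measurable
  show "prob_space \<rho>" unfolding \<rho>_def by (rule P.prob_space_distr[OF m])
  have um: "(\<lambda>x. unit_exp (- (x \<bullet> \<xi>))) \<in> borel_measurable borel" by measurable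
  have int: "integrable (\<mu> \<Otimes>\<^sub>M \<mu>) (\<lambda>z. unit_exp (fst z \<bullet> \<xi>) * unit_exp (- (snd z \<bullet> \<xi>)))"
  proof (rule P.integrable_const_bound[where B = 1])
    show "(\<lambda>z. unit_exp (fst z \<bullet> \<xi>) * unit_exp (- (snd z \<bullet> \<xi>))) \<in> borel_measurable (\<mu> \<Otimes>\<^sub>M \<mu>)"
      unfolding measurable_cong_sets[OF setsP refl] by measurable
  qed (simp add: norm_mult)
  have "fourier_transform \<rho> \<xi> = (LINT z|(\<mu> \<Otimes>\<^sub>M \<mu>). unit_exp (- ((\<lambda>(x, y). y - x) z \<bullet> \<xi>)))"
    unfolding fourier_transform_unit_exp \<rho>_def by (rule integral_distr[OF m um])
  also have "\<dots> = (LINT z|(\<mu> \<Otimes>\<^sub>M \<mu>). unit_exp (fst z \<bullet> \<xi>) * unit_exp (- (snd z \<bullet> \<xi>)))"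
    by (intro Bochner_Integration.integral_cong) (auto simp: inner_diff_left simp flip: unit_exp_add)
  also have "\<dots> = (LINT x|\<mu>. LINT y|\<mu>. unit_exp (x \<bullet> \<xi>) * unit_exp (- (y \<bullet> \<xi>)))"
    using P.integral_fst'[OF int] by simp
  also have "\<dots> = (LINT x|\<mu>. unit_exp (x \<bullet> \<xi>)) * fourier_transform \<mu> \<xi>"
    unfolding fourier_transform_unit_exp by simp
  also have "(LINT x|\<mu>. unit_exp (x \<bullet> \<xi>)) = cnj (fourier_transform \<mu> \<xi>)"
    unfolding fourier_transform_unit_exp by (simp add: unit_exp_minus integral_cnj[symmetric] del: integral_cnj)
  finally show "norm (fourier_transform \<rho> \<xi>) = (norm (fourier_transform \<mu> \<xi>))\<^sup>2"
    by (simp add: norm_mult power2_eq_square)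
qed

text \<open>The Fejer frequencies for the standard basis are integer vectors of norm at most
  \<open>m * N\<close>, so each weight in the energy is bounded below by a constant times
  \<open>N powr (- p)\<close>. The kernel also counts differences close to other integer points,
  which can only increase the measure.\<close>

lemma energy_bound:
  fixes \<mu> :: "'a::euclidean_space measure"
  assumes "prob_space \<mu>" "sets \<mu> = sets borel" and p: "p \<ge> 0"
    and energy: "\<And>T. finite T \<Longrightarrow> T \<subseteq> int_lattice \<Longrightarrow> (\<Sum>l\<in>T. (norm (fourier_transform \<mu> l))\<^sup>2 * (1 + norm l) powr (- p)) \<le> B"
  obtains C where "C > 0" "\<And>N. N > 0 \<Longrightarrow> emeasure (\<mu> \<Otimes>\<^sub>M \<mu>) {(x, y). \<forall>b\<in>Basis. \<bar>(y - x) \<bullet> b\<bar> \<le> 1 / (8 * real N)} \<le> ennreal (C * real N powr (p - real DIM('a)))"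
proof -
  interpret \<mu>: prob_space \<mu> by fact
  define m where "m = DIM('a)"
  define \<rho> where "\<rho> = distr (\<mu> \<Otimes>\<^sub>M \<mu>) borel (\<lambda>(x, y). y - x)"
  note diff = difference_measure[OF assms(1,2), folded \<rho>_def]
  interpret \<rho>: prob_space \<rho> by (rule diff)
  have B0: "B \<ge> 0" using energy[of "{}"] by simp
  define C where "C = 4 ^ m * ((real m + 1) powr p * B) + 1"
  have C: "C > 0" using B0 by (simp add: C_def add_nonneg_pos)
  show ?thesis
  proof (rule that[OF C])
    fix N :: nat assume N: "N > 0"
    define P where "P = PiE (Basis :: 'a set) (\<lambda>_. {..<N})"
    have finP: "finite P" unfolding P_def by (intro finite_PiE) auto
    have cardP: "card P = N ^ m" unfolding P_def by (simp add: card_PiE m_def)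
    define w where "w j j' = (\<Sum>b\<in>Basis. (real (j b) - real (j' b)) *\<^sub>R b :: 'a)" for j j' :: "'a \<Rightarrow> nat"
    have wb: "w j j' \<bullet> b = real (j b) - real (j' b)" if "b \<in> Basis" for j j' b
      unfolding w_def using that by (simp add: inner_sum_left inner_Basis if_distrib sum.delta cong: if_cong)
    have inner_sum: "(\<Sum>j'\<in>P. norm (fourier_transform \<rho> (w j j'))) \<le> ((real m + 1) * N) powr p * B" if j: "j \<in> P" for j
    proof -
      have inj: "inj_on (w j) P"
      proof (rule inj_onI)
        fix f g assume fg: "f \<in> P" "g \<in> P" "w j f = w j g"
        show "f = g"
        proof (rule PiE_ext[OF fg(1,2)[unfolded P_def]])
          fix b :: 'a assume "b \<in> Basis"
          then show "f b = g b" using wb[of b j f] wb[of b j g] fg(3) by simp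
        qed
      qed
      have lat: "w j ` P \<subseteq> int_lattice" by (auto simp: int_lattice_def wb)
      have bound: "1 + norm (w j j') \<le> (real m + 1) * N" if j': "j' \<in> P" for j'
      proof -
        have "norm (w j j') \<le> (\<Sum>b\<in>Basis. \<bar>w j j' \<bullet> b\<bar>)" by (rule norm_le_l1)
        also have "\<dots> \<le> (\<Sum>b\<in>(Basis::'a set). real N)"
        proof (intro sum_mono)
          fix b :: 'a assume b: "b \<in> Basis"
          have "j b < N" "j' b < N" using j j' b by (auto simp: P_def PiE_def)
          then show "\<bar>w j j' \<bullet> b\<bar> \<le> real N" by (simp add: wb[OF b])
        qed
        finally show ?thesis using N by (simp add: m_def distrib_right)
      qed
      have "(\<Sum>j'\<in>P. norm (fourier_transform \<rho> (w j j'))) \<le>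
          (\<Sum>j'\<in>P. ((real m + 1) * N) powr p * ((norm (fourier_transform \<mu> (w j j')))\<^sup>2 * (1 + norm (w j j')) powr (- p)))"
      proof (intro sum_mono)
        fix j' assume j': "j' \<in> P"
        have pos: "1 + norm (w j j') > 0" by (simp add: add_pos_nonneg)
        have "(1 + norm (w j j')) powr p \<le> ((real m + 1) * N) powr p" using bound[OF j'] p by (intro powr_mono2) auto
        then have "(1 + norm (w j j')) powr p * (1 + norm (w j j')) powr (- p) \<le> ((real m + 1) * N) powr p * (1 + norm (w j j')) powr (- p)"
          by (intro mult_right_mono) auto
        then have "1 \<le> ((real m + 1) * N) powr p * (1 + norm (w j j')) powr (- p)" using pos by (simp add: powr_minus)
        from mult_left_mono[OF this zero_le_power2[of "norm (fourier_transform \<mu> (w j j'))"]]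
        show "norm (fourier_transform \<rho> (w j j')) \<le> ((real m + 1) * N) powr p * ((norm (fourier_transform \<mu> (w j j')))\<^sup>2 * (1 + norm (w j j')) powr (- p))"
          unfolding diff(2) by (simp only: mult_1_right mult_ac)
      qed
      also have "\<dots> = ((real m + 1) * N) powr p * (\<Sum>l\<in>w j ` P. (norm (fourier_transform \<mu> l))\<^sup>2 * (1 + norm l) powr (- p))"
        by (subst sum.reindex[OF inj]) (simp add: sum_distrib_left)
      also have "\<dots> \<le> ((real m + 1) * N) powr p * B" using finP lat by (intro mult_left_mono energy) auto
      finally show ?thesis .
    qed
    have "measure \<rho> {x. \<forall>b\<in>Basis. \<exists>r::int. \<bar>x \<bullet> b - of_int r\<bar> \<le> 1 / (8 * real N)} * ((real N)\<^sup>2 / 4) ^ card (Basis :: 'a set) \<le>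
        (\<Sum>j\<in>P. \<Sum>j'\<in>P. norm (fourier_transform \<rho> (w j j')))"
      unfolding P_def w_def by (rule fejer_measure_bound[OF \<rho>.finite_measure_axioms _ _ N]) (auto simp: \<rho>_def)
    also have "\<dots> \<le> (\<Sum>j\<in>P. ((real m + 1) * N) powr p * B)" by (intro sum_mono inner_sum)
    also have "\<dots> = real N ^ m * ((real m + 1) powr p * real N powr p * B)" by (simp add: cardP powr_mult)
    finally have main: "measure \<rho> {x. \<forall>b\<in>Basis. \<exists>r::int. \<bar>x \<bullet> b - of_int r\<bar> \<le> 1 / (8 * real N)} * (real N ^ m * real N ^ m / 4 ^ m) \<le>
        real N ^ m * ((real m + 1) powr p * real N powr p * B)"
      by (simp add: m_def power_divide power2_eq_square power_mult_distrib)
    have gen: "a \<le> b * (1 / u * R)" if "a * (u * u / b) \<le> u * R" "u > 0" "b > 0" for a u b R :: real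
    proof -
      have "u * (a * u / b) \<le> u * R" using that by (simp add: mult_ac)
      then have "a * u / b \<le> R" using that(2) by (rule mult_left_le_imp_le)
      then show ?thesis using that by (simp add: field_simps)
    qed
    have "measure \<rho> {x. \<forall>b\<in>Basis. \<exists>r::int. \<bar>x \<bullet> b - of_int r\<bar> \<le> 1 / (8 * real N)} \<le> 4 ^ m * (1 / real N ^ m * ((real m + 1) powr p * real N powr p * B))"
      by (rule gen[OF main]) (use N in auto)
    also have "\<dots> = 4 ^ m * ((real m + 1) powr p * B) * real N powr (p - real m)"
      using N by (simp add: powr_diff powr_realpow)
    also have "\<dots> \<le> C * real N powr (p - real m)" by (intro mult_right_mono) (auto simp: C_def)
    finally have rho: "measure \<rho> {x. \<forall>b\<in>Basis. \<exists>r::int. \<bar>x \<bullet> b - of_int r\<bar> \<le> 1 / (8 * real N)} \<le> C * real N powr (p - real m)" .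
    let ?S = "{x :: 'a. \<forall>b\<in>Basis. \<exists>r::int. \<bar>x \<bullet> b - of_int r\<bar> \<le> 1 / (8 * real N)}"
    have S: "?S \<in> sets borel" by (rule near_lattice_sets) simp
    have sp: "space (\<mu> \<Otimes>\<^sub>M \<mu>) = UNIV" using sets_eq_imp_space_eq[OF assms(2)] by (simp add: space_pair_measure)
    have "emeasure (\<mu> \<Otimes>\<^sub>M \<mu>) {(x, y). \<forall>b\<in>Basis. \<bar>(y - x) \<bullet> b\<bar> \<le> 1 / (8 * real N)} \<le> emeasure (\<mu> \<Otimes>\<^sub>M \<mu>) ((\<lambda>(x, y). y - x) -` ?S \<inter> space (\<mu> \<Otimes>\<^sub>M \<mu>))"
    proof (rule emeasure_mono)
      show "{(x, y). \<forall>b\<in>Basis. \<bar>(y - x) \<bullet> b\<bar> \<le> 1 / (8 * real N)} \<subseteq> (\<lambda>(x, y). y - x) -` ?S \<inter> space (\<mu> \<Otimes>\<^sub>M \<mu>)"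
        unfolding sp by (auto intro!: exI[of _ 0])
      show "(\<lambda>(x, y). y - x) -` ?S \<inter> space (\<mu> \<Otimes>\<^sub>M \<mu>) \<in> sets (\<mu> \<Otimes>\<^sub>M \<mu>)"
        by (rule measurable_sets[OF diff(3) S])
    qed
    also have "\<dots> = emeasure \<rho> ?S" unfolding \<rho>_def by (rule emeasure_distr[OF diff(3) S, symmetric])
    also have "\<dots> = ennreal (measure \<rho> ?S)" by (rule \<rho>.emeasure_eq_measure)
    also have "\<dots> \<le> ennreal (C * real N powr (p - real m))" by (intro ennreal_leI rho)
    finally show "emeasure (\<mu> \<Otimes>\<^sub>M \<mu>) {(x, y). \<forall>b\<in>Basis. \<bar>(y - x) \<bullet> b\<bar> \<le> 1 / (8 * real N)} \<le> ennreal (C * real N powr (p - real DIM('a)))"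
      by (simp add: m_def)
  qed
qed

lemma ex_dyadic_scale:
  fixes a :: real
  assumes "2 ^ k0 \<le> a"
  obtains k where "k \<ge> k0" "2 ^ k \<le> a" "a < 2 ^ Suc k"
proof -
  have ex: "\<exists>k. a < 2 ^ Suc k"
  proof -
    obtain n where n: "a < 2 ^ n" using real_arch_pow[of 2 a] by auto
    have "(2::real) ^ n \<le> 2 ^ Suc n" by (rule power_increasing) auto
    then show ?thesis using n by (intro exI[of _ n]) linarith
  qed
  define k where "k = (LEAST k. a < 2 ^ Suc k)"
  have k: "a < 2 ^ Suc k" unfolding k_def using LeastI_ex[OF ex] .
  have "(2::real) ^ k0 < 2 ^ Suc k" using assms k by linarith
  then have "k0 < Suc k" by (rule power_less_imp_less_exp[rotated]) simp
  then have kk: "k \<ge> k0" by simp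
  have "2 ^ k \<le> a"
  proof (cases k)
    case 0
    have "(1::real) \<le> 2 ^ k0" by simp
    then have "1 \<le> a" using assms by (rule order_trans)
    then show ?thesis using 0 by simp
  next
    case (Suc j)
    then have "\<not> a < 2 ^ Suc j" using not_less_Least[of j "\<lambda>k. a < 2 ^ Suc k"] by (simp only: k_def[symmetric]) simp
    then show ?thesis using Suc by (simp only: not_less)
  qed
  with kk k show ?thesis using that by blast
qed

text \<open>The energy controls the mass of small cubes only on average. Markov's inequality at
  every dyadic scale, summable because \<open>s < DIM('a) - p\<close>, leaves a set \<open>G\<close>
  of measure above 1/2 all of whose points have small cubes; the mass distribution principle on
  \<open>G\<close> then contradicts a cheap cover.\<close>

lemma hausdorff_measure_nonzero:
  fixes \<mu> :: "'a::euclidean_space measure"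
  assumes prob: "prob_space \<mu>" and sets: "sets \<mu> = sets borel" and p: "p \<ge> 0"
    and energy: "\<And>T. finite T \<Longrightarrow> T \<subseteq> int_lattice \<Longrightarrow> (\<Sum>l\<in>T. (norm (fourier_transform \<mu> l))\<^sup>2 * (1 + norm l) powr (- p)) \<le> B"
    and E: "AE x in \<mu>. x \<in> E" and s: "0 \<le> s" "s < real DIM('a) - p"
  shows "hausdorff_measure s E \<noteq> 0"
proof
  assume H0: "hausdorff_measure s E = 0"
  interpret \<mu>: prob_space \<mu> by (rule prob)
  interpret P: pair_prob_space \<mu> \<mu> ..
  have sp: "space \<mu> = UNIV" using sets_eq_imp_space_eq[OF sets] by simp
  obtain C where C: "C > 0" "\<And>N. N > 0 \<Longrightarrow> emeasure (\<mu> \<Otimes>\<^sub>M \<mu>) {(x, y). \<forall>b\<in>Basis. \<bar>(y - x) \<bullet> b\<bar> \<le> 1 / (8 * real N)} \<le> ennreal (C * real N powr (p - real DIM('a)))"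
    by (rule energy_bound[OF prob sets p energy]) (assumption | rule that | blast)+
  define W where "W k = {(x :: 'a, y). \<forall>b\<in>Basis. \<bar>(y - x) \<bullet> b\<bar> \<le> 1 / (8 * 2 ^ k)}" for k :: nat
  have setsP: "sets (\<mu> \<Otimes>\<^sub>M \<mu>) = sets (borel \<Otimes>\<^sub>M borel)"
    by (rule sets_pair_measure_cong) (use sets in auto)
  have Wsets: "W k \<in> sets (\<mu> \<Otimes>\<^sub>M \<mu>)" for k
  proof -
    have "{z \<in> space (borel \<Otimes>\<^sub>M borel). \<forall>b\<in>Basis. \<bar>(snd z - fst z) \<bullet> (b :: 'a)\<bar> \<le> 1 / (8 * 2 ^ k)} \<in> sets (borel \<Otimes>\<^sub>M borel)"
      by measurable
    moreover have "W k = {z \<in> space (borel \<Otimes>\<^sub>M borel). \<forall>b\<in>Basis. \<bar>(snd z - fst z) \<bullet> (b :: 'a)\<bar> \<le> 1 / (8 * 2 ^ k)}"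
      by (auto simp: W_def space_pair_measure)
    ultimately show ?thesis unfolding setsP by simp
  qed
  define u where "u k x = emeasure \<mu> (Pair x -` W k)" for k x
  have um [measurable]: "u k \<in> borel_measurable \<mu>" for k
    unfolding u_def[abs_def] by (rule \<mu>.measurable_emeasure_Pair[OF Wsets])
  define t where "t = real DIM('a) - p - s"
  have t: "t > 0" using s by (simp add: t_def)
  define r where "r = 2 powr (- t)"
  have r: "0 < r" "r < 1" using t by (auto simp: r_def powr_less_one)
  have uint: "(\<integral>\<^sup>+x. u k x \<partial>\<mu>) \<le> ennreal (C * (2 ^ k) powr (p - real DIM('a)))" for k
  proof -
    have "(\<integral>\<^sup>+x. u k x \<partial>\<mu>) = emeasure (\<mu> \<Otimes>\<^sub>M \<mu>) (W k)"
      unfolding u_def by (rule \<mu>.emeasure_pair_measure_alt[OF Wsets, symmetric])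
    then show ?thesis using C(2)[of "2 ^ k"] by (simp add: W_def)
  qed
  \<comment> \<open>Points whose cube of scale \<open>k\<close> carries at least
    \<open>2 powr (- (k * s))\<close> of the mass; their measure is at most
    \<open>C * r ^ k\<close>.\<close>
  define bad where "bad k = {x \<in> space \<mu>. 1 \<le> ennreal (2 powr (real k * s)) * u k x}" for k
  have badsets: "bad k \<in> sets \<mu>" for k unfolding bad_def by measurable
  have bad: "emeasure \<mu> (bad k) \<le> ennreal (C * r ^ k)" for k
  proof -
    have "emeasure \<mu> (bad k) \<le> ennreal (2 powr (real k * s)) * (\<integral>\<^sup>+x. u k x * indicator (space \<mu>) x \<partial>\<mu>)"
      unfolding bad_def by (rule nn_integral_Markov_inequality) (use um in auto)
    also have "(\<integral>\<^sup>+x. u k x * indicator (space \<mu>) x \<partial>\<mu>) = (\<integral>\<^sup>+x. u k x \<partial>\<mu>)" by (simp add: sp)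
    also have "ennreal (2 powr (real k * s)) * \<dots> \<le> ennreal (2 powr (real k * s)) * ennreal (C * (2 ^ k) powr (p - real DIM('a)))"
      by (intro mult_left_mono uint) auto
    also have "\<dots> = ennreal (C * (2 powr (real k * s) * (2 ^ k) powr (p - real DIM('a))))"
      using C(1) by (simp add: ennreal_mult[symmetric] mult_ac)
    also have "2 powr (real k * s) * (2 ^ k) powr (p - real DIM('a)) = r ^ k"
    proof -
      have "((2::real) ^ k) powr (p - real DIM('a)) = 2 powr (real k * (p - real DIM('a)))"
        by (simp add: powr_realpow[symmetric] powr_powr)
      then have "2 powr (real k * s) * (2 ^ k) powr (p - real DIM('a)) = 2 powr (real k * s + real k * (p - real DIM('a)))"
        by (simp only: powr_add)
      also have "real k * s + real k * (p - real DIM('a)) = - t * real k" by (simp add: t_def algebra_simps)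
      also have "2 powr (- t * real k) = r ^ k" unfolding r_def by (subst powr_realpow[symmetric]) (auto simp: powr_powr)
      finally show ?thesis .
    qed
    finally show ?thesis .
  qed
  \<comment> \<open>From this scale on, all bad points together cost less than half of the
    mass.\<close>
  obtain k0 where k0: "C * r ^ k0 / (1 - r) < 1 / 2"
  proof -
    have "(\<lambda>k. C * r ^ k / (1 - r)) \<longlonglongrightarrow> C * 0 / (1 - r)"
      using r by (intro tendsto_intros LIMSEQ_power_zero) auto
    then have "\<forall>\<^sub>F k in sequentially. C * r ^ k / (1 - r) < 1 / 2" by (rule order_tendstoD) simp
    then show ?thesis using that by (auto simp: eventually_sequentially)
  qed
  define Bd where "Bd = (\<Union>k. bad (k + k0))"
  define G where "G = space \<mu> - Bd"
  have Bdsets: "Bd \<in> sets \<mu>" unfolding Bd_def using badsets by auto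
  have Gsets: "G \<in> sets \<mu>" unfolding G_def using Bdsets by auto
  have "emeasure \<mu> Bd \<le> (\<Sum>k. emeasure \<mu> (bad (k + k0)))"
    unfolding Bd_def by (rule emeasure_subadditive_countably) (use badsets in auto)
  also have "\<dots> \<le> (\<Sum>k. ennreal (C * r ^ k0 * r ^ k))"
  proof (intro suminf_le summableI)
    fix k show "emeasure \<mu> (bad (k + k0)) \<le> ennreal (C * r ^ k0 * r ^ k)"
      using bad[of "k + k0"] by (simp add: power_add mult_ac)
  qed
  also have "\<dots> = ennreal (C * r ^ k0 * (1 / (1 - r)))"
    using r C(1) by (intro suminf_ennreal_eq sums_mult geometric_sums) auto
  finally have "ennreal (measure \<mu> Bd) \<le> ennreal (C * r ^ k0 * (1 / (1 - r)))" unfolding \<mu>.emeasure_eq_measure .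
  moreover have "C * r ^ k0 * (1 / (1 - r)) \<ge> 0" using C(1) r by simp
  ultimately have "measure \<mu> Bd \<le> C * r ^ k0 * (1 / (1 - r))" by (simp only: ennreal_le_iff)
  then have "measure \<mu> Bd \<le> C * r ^ k0 / (1 - r)" by simp
  then have "measure \<mu> Bd < 1 / 2" using k0 by linarith
  then have G12: "measure \<mu> G > 1 / 2" unfolding G_def using \<mu>.prob_compl[OF Bdsets] by simp
  have ball: "measure \<mu> (Pair y -` W k) \<le> 2 powr (- (real k * s))" if yG: "y \<in> G" "k \<ge> k0" for y k
  proof -
    have "y \<notin> bad (k - k0 + k0)" using yG(1) unfolding G_def Bd_def by blast
    then have "\<not> 1 \<le> ennreal (2 powr (real k * s)) * u k y" using yG(2) by (simp add: bad_def sp)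
    then have "ennreal (2 powr (real k * s) * measure \<mu> (Pair y -` W k)) < 1"
      unfolding u_def by (simp add: \<mu>.emeasure_eq_measure ennreal_mult not_le)
    then have "2 powr (real k * s) * measure \<mu> (Pair y -` W k) < 1"
      by (simp add: ennreal_less_one_iff)
    then show ?thesis by (simp add: powr_minus field_simps)
  qed
  have secsets: "Pair y -` W k \<in> sets \<mu>" for y k using Wsets by (rule sets_Pair1)
  \<comment> \<open>A covering set of at most this diameter has its dyadic scale at
    \<open>k0\<close> or beyond, where the cubes around points of \<open>G\<close> are under
    control.\<close>
  define \<delta> where "\<delta> = 1 / (8 * 2 ^ k0 :: real)"
  have delta: "\<delta> > 0" by (simp add: \<delta>_def)
  have "hausdorff_premeasure s \<delta> E \<le> hausdorff_measure s E"
    unfolding hausdorff_measure_def using delta by (intro SUP_upper) auto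
  \<comment> \<open>After the factor \<open>16 powr s\<close> of the covering estimate, this leaves
    at most 1/2.\<close>
  then have "hausdorff_premeasure s \<delta> E < ennreal (1 / (2 * 16 powr s))" using H0 by simp
  then obtain U where U: "E \<subseteq> (\<Union>i. U i)" "\<And>i. bounded (U i)" "\<And>i. diameter (U i) \<le> \<delta>"
    "(\<Sum>i. diam_power s (U i)) < ennreal (1 / (2 * 16 powr s))"
    unfolding hausdorff_premeasure_def Inf_less_iff by blast
  \<comment> \<open>The covering sets need not be measurable; their closures are, and have the same
    diameter.\<close>
  define V where "V i = closure (U i)" for i
  have Vsets: "V i \<in> sets \<mu>" for i unfolding V_def sets by simp
  have claim: "emeasure \<mu> (V i \<inter> G) \<le> ennreal (16 powr s) * diam_power s (U i)" for i
  proof (cases "V i \<inter> G = {}")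
    case True
    then show ?thesis by simp
  next
    case False
    then obtain y where y: "y \<in> V i" "y \<in> G" by blast
    have Une: "U i \<noteq> {}" using y by (auto simp: V_def)
    define D where "D = diameter (U i)"
    have D0: "D \<ge> 0" unfolding D_def by (rule diameter_ge_0[OF U(2)])
    have sub: "V i \<subseteq> Pair y -` W k" if k: "D \<le> 1 / (8 * 2 ^ k)" for k
    proof
      fix z assume z: "z \<in> V i"
      have "dist z y \<le> diameter (V i)"
        using z y U(2) by (intro diameter_bounded_bound) (auto simp: V_def bounded_closure)
      then have "norm (z - y) \<le> D" unfolding V_def D_def diameter_closure[OF U(2)] dist_norm .
      then have "\<bar>(z - y) \<bullet> b\<bar> \<le> 1 / (8 * 2 ^ k)" if "b \<in> Basis" for b
        using Basis_le_norm[OF that, of "z - y"] k by linarith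
      then show "z \<in> Pair y -` W k" by (simp add: W_def)
    qed
    have mV: "measure \<mu> (V i) \<le> 2 powr (- (real k * s))" if k: "k \<ge> k0" "D \<le> 1 / (8 * 2 ^ k)" for k
      using \<mu>.finite_measure_mono[OF sub[OF k(2)] secsets] ball[OF y(2) k(1)] by linarith
    have le: "emeasure \<mu> (V i \<inter> G) \<le> ennreal (measure \<mu> (V i))"
      unfolding \<mu>.emeasure_eq_measure[symmetric] by (rule emeasure_mono) (use Vsets in auto)
    show ?thesis
    proof (cases "s = 0")
      case True
      have "emeasure \<mu> (V i \<inter> G) \<le> 1" by (rule \<mu>.emeasure_le_1)
      then show ?thesis using True Une by (simp add: diam_power_def)
    next
      case s0: False
      have "measure \<mu> (V i) \<le> 16 powr s * D powr s"
      \<comment> \<open>No dyadic scale matches diameter 0; instead the set lies in the cubes of all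
        scales around \<open>y\<close>, so its mass is 0.\<close>
      proof (cases "D = 0")
        case True
        have "measure \<mu> (V i) \<le> 0"
        proof (rule LIMSEQ_le_const)
          have "(\<lambda>k. (2 powr (- s)) ^ k) \<longlonglongrightarrow> 0" using s0 s by (intro LIMSEQ_power_zero) (auto simp: powr_less_one)
          moreover have "(2 powr (- s)) ^ k = 2 powr (- (real k * s))" for k
            by (subst powr_realpow[symmetric]) (auto simp: powr_powr mult.commute)
          ultimately show "(\<lambda>k. 2 powr (- (real k * s))) \<longlonglongrightarrow> 0" by simp
          show "\<exists>N. \<forall>k\<ge>N. measure \<mu> (V i) \<le> 2 powr (- (real k * s))"
            using mV True by (intro exI[of _ k0]) auto
        qed
        then show ?thesis by (meson measure_nonneg order_trans mult_nonneg_nonneg powr_ge_zero)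
      next
        case False
        then have Dp: "D > 0" using D0 by simp
        \<comment> \<open>The scale \<open>k\<close> with
          \<open>2 ^ k \<le> 1 / (8 * D) < 2 ^ Suc k\<close> puts \<open>V i\<close> inside the cube
          of scale \<open>k\<close>, while the upper inequality gives
          \<open>1 / 2 ^ k < 16 * D\<close>. This is the origin of the constant 16.\<close>
        have "2 ^ k0 \<le> 1 / (8 * D)" using U(3)[of i] Dp by (simp add: D_def[symmetric] \<delta>_def field_simps)
        then obtain k where k: "k \<ge> k0" "2 ^ k \<le> 1 / (8 * D)" "1 / (8 * D) < 2 ^ Suc k" by (rule ex_dyadic_scale)
        have "measure \<mu> (V i) \<le> 2 powr (- (real k * s))" using k Dp by (intro mV) (auto simp: field_simps)
        also have "\<dots> = (1 / 2 ^ k) powr s"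
          by (simp add: powr_divide powr_realpow[symmetric] powr_powr powr_minus_divide)
        also have "\<dots> \<le> (16 * D) powr s"
          using k(3) Dp s by (intro powr_mono2) (auto simp: field_simps)
        also have "\<dots> = 16 powr s * D powr s" using Dp by (simp add: powr_mult)
        finally show ?thesis .
      qed
      then have "emeasure \<mu> (V i \<inter> G) \<le> ennreal (16 powr s * D powr s)" using le ennreal_leI order_trans by blast
      also have "\<dots> = ennreal (16 powr s) * diam_power s (U i)" using s0 Une by (simp add: diam_power_def D_def ennreal_mult)
      finally show ?thesis .
    qed
  qed
  have "emeasure \<mu> G \<le> emeasure \<mu> (\<Union>i. V i \<inter> G)"
  proof (rule emeasure_mono_AE)
    show "AE x in \<mu>. x \<in> G \<longrightarrow> x \<in> (\<Union>i. V i \<inter> G)"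
      using E
    proof eventually_elim
      case (elim x)
      then obtain i where "x \<in> U i" using U(1) by blast
      then have "x \<in> V i" unfolding V_def using closure_subset by blast
      then show ?case by blast
    qed
    show "(\<Union>i. V i \<inter> G) \<in> sets \<mu>" using Vsets Gsets by auto
  qed
  also have "\<dots> \<le> (\<Sum>i. emeasure \<mu> (V i \<inter> G))"
    by (rule emeasure_subadditive_countably) (use Vsets Gsets in auto)
  also have "\<dots> \<le> (\<Sum>i. ennreal (16 powr s) * diam_power s (U i))" by (intro suminf_le summableI claim)
  also have "\<dots> = ennreal (16 powr s) * (\<Sum>i. diam_power s (U i))" by simp
  also have "\<dots> \<le> ennreal (16 powr s) * ennreal (1 / (2 * 16 powr s))" using U(4) by (intro mult_left_mono) auto
  also have "\<dots> = ennreal (1 / 2)" by (simp add: ennreal_mult[symmetric])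
  finally have "ennreal (measure \<mu> G) \<le> ennreal (1 / 2)" unfolding \<mu>.emeasure_eq_measure .
  moreover have "(0::real) \<le> 1 / 2" by simp
  ultimately have "measure \<mu> G \<le> 1 / 2" by (simp only: ennreal_le_iff)
  then show False using G12 by simp
qed

lemma hausdorff_dim_ge:
  fixes \<mu> :: "'a::euclidean_space measure"
  assumes "prob_space \<mu>" "sets \<mu> = sets borel" "p \<ge> 0"
    and "\<And>T. finite T \<Longrightarrow> T \<subseteq> int_lattice \<Longrightarrow> (\<Sum>l\<in>T. (norm (fourier_transform \<mu> l))\<^sup>2 * (1 + norm l) powr (- p)) \<le> B"
    and "AE x in \<mu>. x \<in> E"
  shows "hausdorff_dim E \<ge> real DIM('a) - p"
  unfolding hausdorff_dim_def
proof (rule cInf_greatest)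
  show "{s. 0 \<le> s \<and> hausdorff_measure s E = 0} \<noteq> {}"
    using hausdorff_measure_zero_large[of E] by (intro ex_in_conv[THEN iffD1] exI[of _ "real DIM('a) + 1"]) simp
  fix s assume "s \<in> {s. 0 \<le> s \<and> hausdorff_measure s E = 0}"
  then show "real DIM('a) - p \<le> s"
    using hausdorff_measure_nonzero[OF assms(1-3) assms(4) assms(5), of s] by (auto simp: not_less[symmetric])
qed

section \<open>Perturbation estimates\<close>

text \<open>Peetre's inequality moves the coefficient weight from \<open>l\<close> to \<xi> at the
  price of the \<open>a\<close>-th power of the distance. The decay \<open>A\<close> of the measure
  absorbs this and keeps \<open>DIM('a) + 1\<close> powers for the lattice sum.\<close>

lemma perturbation_pointwise:
  fixes L :: "'a::euclidean_space set"
  assumes Lam: "\<And>(\<xi>::'a) T. finite T \<Longrightarrow> T \<subseteq> int_lattice \<Longrightarrow> (\<Sum>l\<in>T. (1 + norm (\<xi> - l)) powr (- (real DIM('a) + 1))) \<le> \<Lambda>"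
    and L: "finite L" "L \<subseteq> int_lattice" and a: "a \<ge> 0" "A \<ge> a + real DIM('a) + 1" and th: "\<theta> \<ge> 0"
    and b: "\<And>l. l \<in> L \<Longrightarrow> b l \<le> \<theta> * (1 + norm l) powr (- a)"
  shows "(\<Sum>l\<in>L. b l * (1 + norm (\<xi> - l)) powr (- A)) \<le> \<theta> * \<Lambda> * (1 + norm \<xi>) powr (- a)"
proof -
  have "(\<Sum>l\<in>L. b l * (1 + norm (\<xi> - l)) powr (- A)) \<le>
      (\<Sum>l\<in>L. \<theta> * (1 + norm \<xi>) powr (- a) * (1 + norm (\<xi> - l)) powr (- (real DIM('a) + 1)))"
  proof (intro sum_mono)
    fix l assume l: "l \<in> L"
    have pos: "1 + norm (\<xi> - l) \<ge> 1" by simp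
    have "b l * (1 + norm (\<xi> - l)) powr (- A) \<le> (\<theta> * ((1 + norm \<xi>) powr (- a) * (1 + norm (\<xi> - l)) powr a)) * (1 + norm (\<xi> - l)) powr (- A)"
      using b[OF l] mult_left_mono[OF Peetre_powr[OF a(1), of l \<xi>] th] by (intro mult_right_mono) auto
    also have "\<dots> = \<theta> * (1 + norm \<xi>) powr (- a) * (1 + norm (\<xi> - l)) powr (a - A)"
      by (simp add: powr_add[symmetric])
    also have "\<dots> \<le> \<theta> * (1 + norm \<xi>) powr (- a) * (1 + norm (\<xi> - l)) powr (- (real DIM('a) + 1))"
      using a th pos by (intro mult_left_mono powr_mono) auto
    finally show "b l * (1 + norm (\<xi> - l)) powr (- A) \<le> \<theta> * (1 + norm \<xi>) powr (- a) * (1 + norm (\<xi> - l)) powr (- (real DIM('a) + 1))" .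
  qed
  also have "\<dots> = \<theta> * (1 + norm \<xi>) powr (- a) * (\<Sum>l\<in>L. (1 + norm (\<xi> - l)) powr (- (real DIM('a) + 1)))"
    by (simp add: sum_distrib_left)
  also have "\<dots> \<le> \<theta> * (1 + norm \<xi>) powr (- a) * \<Lambda>" using th L by (intro mult_left_mono Lam) auto
  finally show ?thesis by (simp add: mult_ac)
qed

text \<open>Here the transfer goes the other way: the full decay \<open>A\<close> is moved to \<xi>,
  paid for by the surplus decay of the coefficients. It shows that the product measure stays in the
  class of decay \<open>A\<close>.\<close>

lemma perturbation_class:
  fixes L :: "'a::euclidean_space set"
  assumes Lam: "\<And>(\<xi>::'a) T. finite T \<Longrightarrow> T \<subseteq> int_lattice \<Longrightarrow> (\<Sum>l\<in>T. (1 + norm (\<xi> - l)) powr (- (real DIM('a) + 1))) \<le> \<Lambda>"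
    and L: "finite L" "L \<subseteq> int_lattice" and A: "A \<ge> 0" and th: "\<theta> \<ge> 0"
    and b: "\<And>l. l \<in> L \<Longrightarrow> b l \<le> \<theta> * (1 + norm l) powr (- (A + real DIM('a) + 1))"
  shows "(\<Sum>l\<in>L. b l * (1 + norm (\<xi> - l)) powr (- A)) \<le> \<theta> * \<Lambda> * (1 + norm \<xi>) powr (- A)"
proof -
  have "(\<Sum>l\<in>L. b l * (1 + norm (\<xi> - l)) powr (- A)) \<le>
      (\<Sum>l\<in>L. \<theta> * (1 + norm \<xi>) powr (- A) * (1 + norm (0 - l)) powr (- (real DIM('a) + 1)))"
  proof (intro sum_mono)
    fix l assume l: "l \<in> L"
    have "b l * (1 + norm (\<xi> - l)) powr (- A) \<le> (\<theta> * (1 + norm l) powr (- (A + real DIM('a) + 1))) * ((1 + norm \<xi>) powr (- A) * (1 + norm l) powr A)"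
      using b[OF l] Peetre_powr[OF A, of "\<xi> - l" \<xi>] th by (intro mult_mono) auto
    also have "\<dots> = \<theta> * (1 + norm \<xi>) powr (- A) * ((1 + norm l) powr (- (A + real DIM('a) + 1)) * (1 + norm l) powr A)"
      by (simp add: mult_ac)
    also have "(1 + norm l) powr (- (A + real DIM('a) + 1)) * (1 + norm l) powr A = (1 + norm (0 - l)) powr (- (real DIM('a) + 1))"
      by (simp add: powr_add[symmetric])
    finally show "b l * (1 + norm (\<xi> - l)) powr (- A) \<le> \<theta> * (1 + norm \<xi>) powr (- A) * (1 + norm (0 - l)) powr (- (real DIM('a) + 1))" .
  qed
  also have "\<dots> = \<theta> * (1 + norm \<xi>) powr (- A) * (\<Sum>l\<in>L. (1 + norm (0 - l)) powr (- (real DIM('a) + 1)))"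
    by (simp add: sum_distrib_left)
  also have "\<dots> \<le> \<theta> * (1 + norm \<xi>) powr (- A) * \<Lambda>" using th L by (intro mult_left_mono Lam) auto
  finally show ?thesis by (simp add: mult_ac)
qed

text \<open>A Schur test. Cauchy-Schwarz with the kernel split into two square roots costs one
  lattice sum; exchanging the sums and moving the weight from \<xi> to \<open>l\<close> by Peetre's
  inequality costs another, hence the factor \<open>\<Lambda>\<^sup>2\<close>.\<close>

lemma perturbation_energy:
  fixes L :: "'a::euclidean_space set"
  assumes Lam: "\<And>(\<xi>::'a) T. finite T \<Longrightarrow> T \<subseteq> int_lattice \<Longrightarrow> (\<Sum>l\<in>T. (1 + norm (\<xi> - l)) powr (- (real DIM('a) + 1))) \<le> \<Lambda>"
    and L: "finite L" "L \<subseteq> int_lattice" and T: "finite T" "T \<subseteq> int_lattice" and p: "p \<ge> 0" "A \<ge> p + real DIM('a) + 1"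
  shows "(\<Sum>\<xi>\<in>T. (\<Sum>l\<in>L. b l * (1 + norm (\<xi> - l)) powr (- A))\<^sup>2 * (1 + norm \<xi>) powr (- p)) \<le>
    \<Lambda>\<^sup>2 * (\<Sum>l\<in>L. (b l)\<^sup>2 * (1 + norm l) powr (- p))"
proof -
  define u where "u v = (1 + norm v) powr (- A)" for v :: 'a
  have u0: "u v \<ge> 0" for v by (simp add: u_def)
  have ule: "u v * (1 + norm v) powr p \<le> (1 + norm v) powr (- (real DIM('a) + 1))" for v
    using p by (simp add: u_def powr_add[symmetric] powr_mono)
  have ule0: "u v \<le> (1 + norm v) powr (- (real DIM('a) + 1))" for v
    unfolding u_def using p by (intro powr_mono) auto
  have Lam0: "\<Lambda> \<ge> 0" using Lam[of "{}" 0] by simp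
  have cs: "(\<Sum>l\<in>L. b l * u (\<xi> - l))\<^sup>2 \<le> \<Lambda> * (\<Sum>l\<in>L. (b l)\<^sup>2 * u (\<xi> - l))" for \<xi>
  proof -
    have "(\<Sum>l\<in>L. b l * u (\<xi> - l)) = (\<Sum>l\<in>L. (b l * sqrt (u (\<xi> - l))) * sqrt (u (\<xi> - l)))"
      using u0 by (simp add: mult.assoc)
    then have "(\<Sum>l\<in>L. b l * u (\<xi> - l))\<^sup>2 \<le> (\<Sum>l\<in>L. (b l * sqrt (u (\<xi> - l)))\<^sup>2) * (\<Sum>l\<in>L. (sqrt (u (\<xi> - l)))\<^sup>2)"
      using Cauchy_Schwarz_ineq_sum[of "\<lambda>l. b l * sqrt (u (\<xi> - l))" "\<lambda>l. sqrt (u (\<xi> - l))" L] by simp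
    also have "\<dots> = (\<Sum>l\<in>L. (b l)\<^sup>2 * u (\<xi> - l)) * (\<Sum>l\<in>L. u (\<xi> - l))" using u0 by (simp add: power_mult_distrib)
    also have "\<dots> \<le> (\<Sum>l\<in>L. (b l)\<^sup>2 * u (\<xi> - l)) * \<Lambda>"
      using order_trans[OF sum_mono[OF ule0] Lam[OF L, of \<xi>]] u0 by (intro mult_left_mono sum_nonneg) auto
    finally show ?thesis by (simp add: mult.commute)
  qed
  have "(\<Sum>\<xi>\<in>T. (\<Sum>l\<in>L. b l * u (\<xi> - l))\<^sup>2 * (1 + norm \<xi>) powr (- p)) \<le>
      (\<Sum>\<xi>\<in>T. \<Lambda> * (\<Sum>l\<in>L. (b l)\<^sup>2 * u (\<xi> - l)) * (1 + norm \<xi>) powr (- p))"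
    by (intro sum_mono mult_right_mono cs) auto
  also have "\<dots> = \<Lambda> * (\<Sum>\<xi>\<in>T. \<Sum>l\<in>L. (b l)\<^sup>2 * (u (\<xi> - l) * (1 + norm \<xi>) powr (- p)))"
    by (simp add: sum_distrib_left sum_distrib_right mult_ac)
  also have "\<dots> = \<Lambda> * (\<Sum>l\<in>L. \<Sum>\<xi>\<in>T. (b l)\<^sup>2 * (u (\<xi> - l) * (1 + norm \<xi>) powr (- p)))"
    by (subst sum.swap) simp
  also have "\<dots> \<le> \<Lambda> * (\<Sum>l\<in>L. (b l)\<^sup>2 * ((1 + norm l) powr (- p) * \<Lambda>))"
  proof (intro mult_left_mono sum_mono Lam0)
    fix l assume "l \<in> L"
    have "(\<Sum>\<xi>\<in>T. u (\<xi> - l) * (1 + norm \<xi>) powr (- p)) \<le> (\<Sum>\<xi>\<in>T. (1 + norm l) powr (- p) * (1 + norm (l - \<xi>)) powr (- (real DIM('a) + 1)))"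
    proof (intro sum_mono)
      fix \<xi> :: 'a
      have "u (\<xi> - l) * (1 + norm \<xi>) powr (- p) \<le> u (\<xi> - l) * ((1 + norm l) powr (- p) * (1 + norm (l - \<xi>)) powr p)"
        using Peetre_powr[OF p(1), of \<xi> l] u0 by (intro mult_left_mono) auto
      also have "\<dots> = (1 + norm l) powr (- p) * (u (l - \<xi>) * (1 + norm (l - \<xi>)) powr p)"
        by (simp add: u_def norm_minus_commute mult_ac)
      also have "\<dots> \<le> (1 + norm l) powr (- p) * (1 + norm (l - \<xi>)) powr (- (real DIM('a) + 1))"
        by (intro mult_left_mono ule) auto
      finally show "u (\<xi> - l) * (1 + norm \<xi>) powr (- p) \<le> (1 + norm l) powr (- p) * (1 + norm (l - \<xi>)) powr (- (real DIM('a) + 1))" .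
    qed
    also have "\<dots> \<le> (1 + norm l) powr (- p) * \<Lambda>"
      unfolding sum_distrib_left[symmetric] by (intro mult_left_mono Lam T) auto
    finally show "(\<Sum>\<xi>\<in>T. (b l)\<^sup>2 * (u (\<xi> - l) * (1 + norm \<xi>) powr (- p))) \<le> (b l)\<^sup>2 * ((1 + norm l) powr (- p) * \<Lambda>)"
      unfolding sum_distrib_left[symmetric] by (intro mult_left_mono) auto
  qed
  also have "\<dots> = \<Lambda>\<^sup>2 * (\<Sum>l\<in>L. (b l)\<^sup>2 * (1 + norm l) powr (- p))"
    by (simp add: sum_distrib_left power2_eq_square mult_ac)
  finally show ?thesis unfolding u_def .
qed

section \<open>Outer products and their multiplicities\<close>

text \<open>The tensor \<open>k \<otimes> q\<close>; \<open>k\<close> stays a plain function because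
  it arises as a choice of one Fourier mode per row.\<close>

definition outer :: "('n \<Rightarrow> int) \<Rightarrow> int ^ 'd \<Rightarrow> real ^ 'd ^ 'n" where
  "outer k q = (\<chi> i. real_of_int (k i) *\<^sub>R real_vec q)"

lemma outer_component: "outer k q $ i $ j = real_of_int (k i * q $ j)"
  by (simp add: outer_def real_vec_def)

lemma norm_outer_int: "norm (outer k q) = norm (\<chi> i. real_of_int (k i)) * norm (real_vec q)"
  unfolding outer_def by (rule norm_outer)

lemma outer_int_lattice: "outer k q \<in> int_lattice"
  by (auto simp: int_lattice_def Basis_vec_def inner_axis outer_component)

lemma inner_outer: "x \<bullet> outer k q = (\<Sum>i\<in>UNIV. real_of_int (k i) * (x *v real_vec q) $ i)"
  unfolding outer_def by (subst inner_vec_def) (simp add: matrix_vector_mult_def inner_vec_def sum_distrib_left mult_ac)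

definition denominators :: "nat \<Rightarrow> (int ^ 'd) set" where
  "denominators M = {q. \<forall>j. int M \<le> q $ j \<and> q $ j < 2 * int M}"

lemma denominators_vec_lambda: "denominators M = vec_lambda ` PiE (UNIV :: 'd::finite set) (\<lambda>_. {int M..<2 * int M})"
proof
  show "(denominators M :: (int ^ 'd) set) \<subseteq> vec_lambda ` PiE UNIV (\<lambda>_. {int M..<2 * int M})"
  proof
    fix q :: "int ^ 'd" assume "q \<in> denominators M"
    then show "q \<in> vec_lambda ` PiE UNIV (\<lambda>_. {int M..<2 * int M})"
      by (intro image_eqI[of _ _ "\<lambda>j. q $ j"]) (auto simp: denominators_def PiE_def)
  qed
qed (auto simp: denominators_def PiE_def)

lemma finite_denominators: "finite (denominators M)"
  unfolding denominators_vec_lambda by (intro finite_imageI finite_PiE) auto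

lemma card_denominators: "card (denominators M :: (int ^ 'd) set) = M ^ CARD('d)"
  unfolding denominators_vec_lambda by (subst card_image) (auto simp: inj_on_def vec_lambda_inject card_PiE)

lemma norm_denominators:
  fixes q :: "int ^ 'd"
  assumes "q \<in> denominators M"
  shows "real M \<le> norm (real_vec q)" "norm (real_vec q) \<le> real CARD('d) * (2 * real M)"
proof -
  have q: "real M \<le> real_of_int (q $ j)" "real_of_int (q $ j) \<le> 2 * real M" for j
  proof -
    have "int M \<le> q $ j" "q $ j \<le> 2 * int M" using assms by (auto simp: denominators_def intro: less_imp_le)
    then have "real_of_int (int M) \<le> real_of_int (q $ j)" "real_of_int (q $ j) \<le> real_of_int (2 * int M)" by (simp_all only: of_int_le_iff)
    then show "real M \<le> real_of_int (q $ j)" "real_of_int (q $ j) \<le> 2 * real M" by simp_all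
  qed
  have "real M \<le> \<bar>real_vec q $ undefined\<bar>" using q[of undefined] by (simp add: real_vec_def)
  also have "\<dots> \<le> norm (real_vec q)" by (rule component_le_norm_cart)
  finally show "real M \<le> norm (real_vec q)" .
  have "norm (real_vec q) \<le> (\<Sum>j\<in>UNIV. \<bar>real_vec q $ j\<bar>)" by (rule norm_le_l1_cart)
  also have "\<dots> \<le> (\<Sum>j\<in>(UNIV::'d set). 2 * real M)"
  proof (intro sum_mono)
    fix j have "0 \<le> real_of_int (q $ j)" using q(1)[of j] by linarith
    then show "\<bar>real_vec q $ j\<bar> \<le> 2 * real M" using q(2)[of j] by (simp add: real_vec_def)
  qed
  finally show "norm (real_vec q) \<le> real CARD('d) * (2 * real M)" by simp
qed

text \<open>Some coordinate of \<open>k\<close> has size at least \<open>norm k / n\<close>; its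
  coefficient supplies the decay and the others are bounded by 2. A quantity below both 1 and
  \<open>x ^ K\<close> is below \<open>x powr \<kappa>\<close> for each \<kappa> between 0 and
  \<open>K\<close>; \<kappa> stays free because different estimates need different
  exponents.\<close>

lemma coeff_product_bound:
  fixes k :: "'n::finite \<Rightarrow> int" and c :: "int \<Rightarrow> complex"
  assumes c2: "\<And>k. norm (c k) \<le> 2" and cK: "\<And>k. k \<noteq> 0 \<Longrightarrow> norm (c k) \<le> 2 * (real K / (\<delta> * \<bar>of_int k\<bar>)) ^ K"
    and k: "k \<noteq> (\<lambda>_. 0)" and "\<delta> > 0" and \<kappa>: "0 \<le> \<kappa>" "\<kappa> \<le> real K" and K: "K > 0"
  shows "norm (\<Prod>i\<in>UNIV. c (k i)) \<le> 2 ^ CARD('n) * (real K * real CARD('n) / (\<delta> * norm (\<chi> i. real_of_int (k i)))) powr \<kappa>"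
proof -
  define v :: "real ^ 'n" where "v = (\<chi> i. real_of_int (k i))"
  have v0: "v \<noteq> 0" using k by (auto simp: v_def vec_eq_iff)
  obtain i where i: "\<bar>v $ i\<bar> * real CARD('n) \<ge> norm v"
  proof (rule ccontr)
    assume "\<not> thesis"
    then have lt: "\<bar>v $ i\<bar> * real CARD('n) < norm v" for i
      by (rule contrapos_np) (simp add: that not_less)
    have "norm v * real CARD('n) \<le> (\<Sum>i\<in>UNIV. \<bar>v $ i\<bar>) * real CARD('n)" by (intro mult_right_mono norm_le_l1_cart) auto
    also have "\<dots> = (\<Sum>i\<in>UNIV. \<bar>v $ i\<bar> * real CARD('n))" by (simp add: sum_distrib_right)
    also have "\<dots> < (\<Sum>i\<in>(UNIV::'n set). norm v)" by (intro sum_strict_mono lt) auto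
    finally show False by (simp add: mult.commute)
  qed
  have nv: "norm v > 0" using v0 by simp
  have vi: "\<bar>v $ i\<bar> > 0" using i nv by (metis abs_ge_zero less_eq_real_def mult_zero_left not_less)
  then have ki: "k i \<noteq> 0" by (auto simp: v_def)
  define x where "x = real K / (\<delta> * \<bar>of_int (k i)\<bar>)"
  have x0: "x > 0" using assms(4) K ki by (simp add: x_def)
  have "norm (c (k i)) \<le> 2 * x powr \<kappa>"
  proof (cases "x \<ge> 1")
    case True
    then have "1 \<le> x powr \<kappa>" using \<kappa> by (simp add: ge_one_powr_ge_zero)
    then show ?thesis using c2[of "k i"] by linarith
  next
    case False
    have "x ^ K = x powr real K" using x0 by (simp add: powr_realpow)
    also have "\<dots> \<le> x powr \<kappa>" using False x0 \<kappa> by (intro powr_mono') auto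
    finally show ?thesis using cK[OF ki] unfolding x_def[symmetric] by linarith
  qed
  also have "x powr \<kappa> \<le> (real K * real CARD('n) / (\<delta> * norm v)) powr \<kappa>"
  proof (intro powr_mono2)
    have "\<delta> * norm v \<le> \<delta> * (\<bar>v $ i\<bar> * real CARD('n))" using i assms(4) by (intro mult_left_mono) auto
    then have "real K * real CARD('n) / (\<delta> * (\<bar>v $ i\<bar> * real CARD('n))) \<le> real K * real CARD('n) / (\<delta> * norm v)"
      using nv assms(4) by (intro frac_le) auto
    moreover have "x = real K * real CARD('n) / (\<delta> * (\<bar>v $ i\<bar> * real CARD('n)))" by (simp add: x_def v_def)
    ultimately show "x \<le> real K * real CARD('n) / (\<delta> * norm v)" by simp
  qed (use \<kappa> x0 in auto)
  finally have ci: "norm (c (k i)) \<le> 2 * (real K * real CARD('n) / (\<delta> * norm v)) powr \<kappa>" by simp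
  have "norm (\<Prod>i\<in>UNIV. c (k i)) = norm (c (k i)) * (\<Prod>j\<in>UNIV - {i}. norm (c (k j)))"
    by (subst prod.remove[of _ i]) (auto simp: norm_mult prod_norm)
  also have "\<dots> \<le> (2 * (real K * real CARD('n) / (\<delta> * norm v)) powr \<kappa>) * (\<Prod>j\<in>UNIV - {i}. 2)"
    by (intro mult_mono ci prod_mono conjI c2 prod_nonneg) auto
  also have "\<dots> = 2 ^ Suc (CARD('n) - 1) * (real K * real CARD('n) / (\<delta> * norm v)) powr \<kappa>"
    by (simp only: prod_constant card_Diff_singleton[OF UNIV_I] power_Suc mult_ac)
  also have "Suc (CARD('n) - 1) = CARD('n)" by simp
  finally show ?thesis unfolding v_def .
qed

text \<open>In a row \<open>i\<close> with \<open>k i \<noteq> 0\<close> the entries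
  \<open>l $ i $ j = k i * q $ j\<close> are nonzero integers of size at most \<open>norm l\<close>,
  and every representation has \<open>q $ j\<close> as a positive divisor of them. Moreover
  \<open>q\<close> determines \<open>k\<close>, so the count is at most a product of
  \<open>d\<close> divisor counts.\<close>

lemma outer_multiplicity:
  fixes l :: "real ^ 'd ^ 'n"
  assumes D: "D > 0" "\<And>n::nat. n > 0 \<Longrightarrow> real (card {a::nat. a dvd n}) \<le> D * real n powr \<epsilon>" and eps: "\<epsilon> \<ge> 0" and M: "M > 0"
    and R: "R \<subseteq> {(q, k). q \<in> denominators M \<and> k \<noteq> (\<lambda>_. 0) \<and> outer k q = l}"
  shows "real (card R) \<le> D ^ CARD('d) * norm l powr (\<epsilon> * real CARD('d))"
proof (cases "R = {}")
  case True
  then show ?thesis using D(1) by simp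
next
  case False
  then obtain z where z: "z \<in> R" by blast
  obtain q0 k0 where "z = (q0, k0)" by (cases z)
  then have qk: "q0 \<in> denominators M" "k0 \<noteq> (\<lambda>_. 0)" "outer k0 q0 = l" using R z by auto
  obtain i where i: "k0 i \<noteq> 0" using qk(2) by auto
  have qpos: "q $ j > 0" if "q \<in> denominators M" for q :: "int ^ 'd" and j
    using that M unfolding denominators_def by (metis (mono_tags, lifting) mem_Collect_eq of_nat_0_less_iff order.strict_trans2)
  define n where "n j = nat \<bar>k0 i * q0 $ j\<bar>" for j
  have lij: "l $ i $ j = real_of_int (k0 i * q0 $ j)" for j using qk(3) outer_component[of k0 q0 i j] by simp
  have n0: "n j > 0" for j using i qpos[OF qk(1), of j] by (simp add: n_def)
  have nl: "real (n j) \<le> norm l" for j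
  proof -
    have "real (n j) = \<bar>l $ i $ j\<bar>" by (simp add: n_def lij)
    also have "\<dots> \<le> norm (l $ i)" by (rule component_le_norm_cart)
    also have "\<dots> \<le> norm l" by (rule Finite_Cartesian_Product.norm_nth_le)
    finally show ?thesis .
  qed
  define f where "f = (\<lambda>(q :: int ^ 'd, k :: 'n \<Rightarrow> int). (\<lambda>j. nat (q $ j)))"
  have inj: "inj_on f R"
  proof (rule inj_onI)
    fix z z' assume z: "z \<in> R" "z' \<in> R" "f z = f z'"
    obtain q k q' k' where e: "z = (q, k)" "z' = (q', k')" by fastforce
    have q: "q \<in> denominators M" "q' \<in> denominators M" "outer k q = l" "outer k' q' = l" using z R e by auto
    have "q $ j = q' $ j" for j
      using z(3) qpos[OF q(1), of j] qpos[OF q(2), of j] unfolding e f_def by (auto simp: fun_eq_iff dest!: spec[of _ j])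
    then have qq: "q = q'" by (simp add: vec_eq_iff)
    have "k i' = k' i'" for i'
    proof -
      have "real_of_int (k i' * q $ undefined) = real_of_int (k' i' * q' $ undefined)"
        unfolding outer_component[symmetric] q(3,4) ..
      then have "k i' * q $ undefined = k' i' * q' $ undefined" by (simp only: of_int_eq_iff)
      then show ?thesis using qq qpos[OF q(1), of undefined] by simp
    qed
    then show "z = z'" using qq e by auto
  qed
  have sub: "f ` R \<subseteq> PiE UNIV (\<lambda>j. {a. a dvd n j})"
  proof (intro image_subsetI)
    fix z assume z: "z \<in> R"
    obtain q k where e: "z = (q, k)" by fastforce
    have q: "q \<in> denominators M" "outer k q = l" using z R e by auto
    have "nat (q $ j) dvd n j" for j
    proof -
      have "real_of_int (k i * q $ j) = real_of_int (k0 i * q0 $ j)"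
        unfolding outer_component[symmetric] q(2) qk(3) ..
      then have "k i * q $ j = k0 i * q0 $ j" by (simp only: of_int_eq_iff)
      then have "q $ j dvd k0 i * q0 $ j" by (metis dvd_triv_right)
      then show ?thesis using qpos[OF q(1), of j] unfolding n_def by (simp add: nat_dvd_iff)
    qed
    then show "f z \<in> PiE UNIV (\<lambda>j. {a. a dvd n j})" by (simp add: e f_def PiE_def)
  qed
  have fin: "finite (PiE UNIV (\<lambda>j. {a. a dvd n j}))" using n0 by (intro finite_PiE) auto
  have "card R = card (f ` R)" using card_image[OF inj] by simp
  also have "\<dots> \<le> card (PiE UNIV (\<lambda>j. {a. a dvd n j}))" by (rule card_mono[OF fin sub])
  also have "\<dots> = (\<Prod>j\<in>UNIV. card {a. a dvd n j})" by (simp add: card_PiE)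
  finally have "real (card R) \<le> (\<Prod>j\<in>UNIV. real (card {a. a dvd n j}))" by (simp add: of_nat_prod[symmetric] del: of_nat_prod)
  also have "\<dots> \<le> (\<Prod>j\<in>(UNIV::'d set). D * norm l powr \<epsilon>)"
  proof (intro prod_mono conjI)
    fix j
    have "real (card {a. a dvd n j}) \<le> D * real (n j) powr \<epsilon>" by (rule D(2)[OF n0])
    also have "\<dots> \<le> D * norm l powr \<epsilon>" using D(1) eps nl by (intro mult_left_mono powr_mono2) auto
    finally show "real (card {a. a dvd n j}) \<le> D * norm l powr \<epsilon>" .
  qed simp
  also have "\<dots> = D ^ CARD('d) * (norm l powr \<epsilon>) ^ CARD('d)" by (simp add: power_mult_distrib)
  also have "(norm l powr \<epsilon>) ^ CARD('d) = norm l powr (\<epsilon> * real CARD('d))"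
  proof -
    have "norm l > 0" using nl[of undefined] n0[of undefined] by linarith
    then show ?thesis by (simp add: powr_realpow[symmetric] powr_powr)
  qed
  finally show ?thesis .
qed

section \<open>The multiplicative step\<close>

text \<open>The constant mode is left out: with \<open>c 0 = 1\<close> it reproduces the measure
  itself, so the sum over the remaining modes is exactly the change caused by the
  multiplication.\<close>

definition frequencies :: "nat \<Rightarrow> (int \<Rightarrow> complex) \<Rightarrow> ((int ^ 'd) \<times> ('n \<Rightarrow> int)) set" where
  "frequencies M c = denominators M \<times> (PiE UNIV (\<lambda>_. {k. c k \<noteq> 0}) - {\<lambda>_. 0})"

lemma finite_frequencies: "finite {k. c k \<noteq> 0} \<Longrightarrow> finite (frequencies M c :: ((int ^ 'd) \<times> ('n::finite \<Rightarrow> int)) set)"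
  unfolding frequencies_def by (intro finite_cartesian_product finite_denominators finite_Diff finite_PiE) auto

lemma prod_trig_poly:
  fixes x :: "real ^ 'd ^ 'n" and q :: "int ^ 'd"
  assumes "finite {k. c k \<noteq> 0}"
  shows "(\<Prod>i\<in>UNIV. trig_poly c ((x *v real_vec q) $ i)) =
    (\<Sum>k\<in>PiE UNIV (\<lambda>_. {k. c k \<noteq> 0}). (\<Prod>i\<in>UNIV. c (k i)) * unit_exp (x \<bullet> outer k q))"
proof -
  have "(\<Prod>i\<in>(UNIV::'n set). trig_poly c ((x *v real_vec q) $ i)) =
      (\<Sum>k\<in>PiE UNIV (\<lambda>_. {k. c k \<noteq> 0}). \<Prod>i\<in>UNIV. c (k i) * unit_exp (of_int (k i) * (x *v real_vec q) $ i))"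
    unfolding trig_poly_def using assms by (subst prod_sum_PiE) auto
  also have "\<dots> = (\<Sum>k\<in>PiE UNIV (\<lambda>_. {k. c k \<noteq> 0}). (\<Prod>i\<in>UNIV. c (k i)) * unit_exp (x \<bullet> outer k q))"
    by (intro sum.cong refl) (simp add: prod.distrib inner_outer unit_exp_sum)
  finally show ?thesis .
qed

text \<open>The change of the transform is given as a limit of finite sums, by dominated convergence
  of the trigonometric approximants of \<psi>. The coefficient bounds are uniform in
  \<open>N\<close>, so any estimate derived from them passes to the limit.\<close>

lemma matrix_bump:
  fixes \<delta> :: real
  assumes delta: "0 < \<delta>" "\<delta> \<le> 1" and K: "K > 0" and M: "M > 0"
  obtains F :: "real ^ 'd ^ 'n \<Rightarrow> real" and c :: "nat \<Rightarrow> int \<Rightarrow> complex" and B :: real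
  where "continuous_on UNIV F" and "\<And>x. F x \<ge> 0" and "\<And>x. F x \<le> B"
    and "\<And>x. F x \<noteq> 0 \<Longrightarrow> \<exists>q\<in>denominators M. \<forall>i. \<exists>r::int. \<bar>(x *v real_vec q) $ i - of_int r\<bar> \<le> \<delta>"
    and "\<And>N. finite {k. c N k \<noteq> 0}" and "\<And>N k. norm (c N k) \<le> 2"
    and "\<And>N k. k \<noteq> 0 \<Longrightarrow> norm (c N k) \<le> 2 * (real K / (\<delta> * \<bar>of_int k\<bar>)) ^ K"
    and "\<And>\<mu> \<xi>. finite_measure \<mu> \<Longrightarrow> sets \<mu> = sets borel \<Longrightarrow>
      (\<lambda>N. \<Sum>(q, k)\<in>frequencies M (c N). (\<Prod>i\<in>UNIV. c N (k i)) / of_nat (M ^ CARD('d)) * fourier_transform \<mu> (\<xi> - outer k q))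
      \<longlonglongrightarrow> fourier_transform (density \<mu> (\<lambda>x. ennreal (F x))) \<xi> - fourier_transform \<mu> \<xi>"
proof -
  obtain \<psi> :: "real \<Rightarrow> real" and c :: "nat \<Rightarrow> int \<Rightarrow> complex" and B :: real
    where psi: "continuous_on UNIV \<psi>" "\<And>t. \<psi> t \<ge> 0"
      "\<And>t. \<psi> t \<noteq> 0 \<Longrightarrow> \<exists>r::int. \<bar>t - of_int r\<bar> \<le> \<delta>"
      and c: "\<And>N. finite {k. c N k \<noteq> 0}" "\<And>N. c N 0 = 1" "\<And>N k. norm (c N k) \<le> 2"
      "\<And>N k. k \<noteq> 0 \<Longrightarrow> norm (c N k) \<le> 2 * (real K / (\<delta> * \<bar>of_int k\<bar>)) ^ K"
      and lim: "\<And>t. (\<lambda>N. trig_poly (c N) t) \<longlonglongrightarrow> of_real (\<psi> t)" and B: "\<And>N t. norm (trig_poly (c N) t) \<le> B"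
    by (rule periodic_bump[OF delta K]) (rule that)
  define Q :: "(int ^ 'd) set" where "Q = denominators M"
  have Q: "finite Q" "card Q = M ^ CARD('d)" unfolding Q_def by (rule finite_denominators card_denominators)+
  define m where "m = M ^ CARD('d)"
  have m0: "m > 0" using M by (simp add: m_def)
  have B0: "B \<ge> 0" using order_trans[OF norm_ge_zero B] .
  define F where "F x = (\<Sum>q\<in>Q. \<Prod>i\<in>UNIV. \<psi> ((x *v real_vec q) $ i)) / real m" for x :: "real ^ 'd ^ 'n"
  define G where "G N x = (\<Sum>q\<in>Q. \<Prod>i\<in>UNIV. trig_poly (c N) ((x *v real_vec q) $ i)) / of_nat m" for N and x :: "real ^ 'd ^ 'n"
  have lin: "continuous_on UNIV (\<lambda>x :: real ^ 'd ^ 'n. (x *v real_vec q) $ i)" for q i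
    unfolding matrix_vector_mult_def by (simp, intro continuous_intros)
  have contF: "continuous_on UNIV F"
    unfolding F_def using m0 by (intro continuous_intros continuous_on_compose2[OF psi(1) lin]) auto
  have F0: "F x \<ge> 0" for x unfolding F_def by (intro divide_nonneg_nonneg sum_nonneg prod_nonneg) (use psi in auto)
  have limG: "(\<lambda>N. G N x) \<longlonglongrightarrow> of_real (F x)" for x
    unfolding G_def F_def of_real_divide of_real_sum of_real_prod of_real_of_nat_eq
    using m0 by (intro tendsto_intros lim) auto
  have GB: "norm (G N x) \<le> B ^ CARD('n)" for N x
  proof -
    have "norm (\<Sum>q\<in>Q. \<Prod>i\<in>UNIV. trig_poly (c N) ((x *v real_vec q) $ i)) \<le> (\<Sum>q\<in>Q. B ^ CARD('n))"
    proof (intro order_trans[OF norm_sum] sum_mono)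
      fix q
      have "norm (\<Prod>i\<in>(UNIV::'n set). trig_poly (c N) ((x *v real_vec q) $ i)) \<le> (\<Prod>i\<in>(UNIV::'n set). B)"
        unfolding prod_norm[symmetric] by (intro prod_mono conjI B) auto
      then show "norm (\<Prod>i\<in>(UNIV::'n set). trig_poly (c N) ((x *v real_vec q) $ i)) \<le> B ^ CARD('n)" by simp
    qed
    also have "\<dots> = real m * B ^ CARD('n)" by (simp add: Q m_def)
    finally show ?thesis using m0 by (simp add: G_def norm_divide field_simps)
  qed
  have FB: "F x \<le> B ^ CARD('n)" for x
  proof -
    have "norm (complex_of_real (F x)) \<le> B ^ CARD('n)"
      using tendsto_norm[OF limG[of x]] by (rule Lim_bounded[of _ _ 0]) (use GB in auto)
    then show ?thesis using F0[of x] by simp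
  qed
  have supp: "\<exists>q\<in>denominators M. \<forall>i. \<exists>r::int. \<bar>(x *v real_vec q) $ i - of_int r\<bar> \<le> \<delta>" if Fx: "F x \<noteq> 0" for x
  proof -
    have "\<exists>q\<in>Q. (\<Prod>i\<in>UNIV. \<psi> ((x *v real_vec q) $ i)) \<noteq> 0"
      using Fx unfolding F_def by (metis (no_types, lifting) div_0 sum.neutral)
    then obtain q where q: "q \<in> Q" "(\<Prod>i\<in>UNIV. \<psi> ((x *v real_vec q) $ i)) \<noteq> 0" by blast
    then have "\<psi> ((x *v real_vec q) $ i) \<noteq> 0" for i by (simp add: prod_zero_iff)
    then show ?thesis using psi(3) q(1) unfolding Q_def by blast
  qed
  have conv: "(\<lambda>N. \<Sum>(q, k)\<in>frequencies M (c N). (\<Prod>i\<in>UNIV. c N (k i)) / of_nat (M ^ CARD('d)) * fourier_transform \<mu> (\<xi> - outer k q))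
      \<longlonglongrightarrow> fourier_transform (density \<mu> (\<lambda>x. ennreal (F x))) \<xi> - fourier_transform \<mu> \<xi>"
    if mu: "finite_measure \<mu>" "sets \<mu> = sets borel" for \<mu> :: "(real ^ 'd ^ 'n) measure" and \<xi>
  proof -
    interpret finite_measure \<mu> by (rule mu)
    have meas: "measurable \<mu> borel = (measurable borel borel :: (real ^ 'd ^ 'n \<Rightarrow> complex) set)"
      "measurable \<mu> borel = (measurable borel borel :: (real ^ 'd ^ 'n \<Rightarrow> real) set)" by (rule measurable_cong_sets[OF mu(2) refl])+
    have Fm: "F \<in> borel_measurable \<mu>" unfolding meas by (rule borel_measurable_continuous_onI[OF contF])
    have um: "(\<lambda>x. unit_exp (- (x \<bullet> \<xi>))) \<in> borel_measurable \<mu>" unfolding meas by measurable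
    have contG: "continuous_on UNIV (G N)" for N
      unfolding G_def using m0 by (intro continuous_intros continuous_on_compose2[OF continuous_trig_poly[of UNIV] lin]) auto
    have Gm: "(\<lambda>x. G N x * unit_exp (- (x \<bullet> \<xi>))) \<in> borel_measurable \<mu>" for N
      unfolding meas by (intro borel_measurable_continuous_onI continuous_intros contG)
    have ftF: "fourier_transform (density \<mu> (\<lambda>x. ennreal (F x))) \<xi> = (LINT x|\<mu>. of_real (F x) * unit_exp (- (x \<bullet> \<xi>)))"
      unfolding fourier_transform_unit_exp using Fm um F0 by (subst integral_density) (auto simp: scaleR_conv_of_real)
    have l1: "(\<lambda>N. LINT x|\<mu>. G N x * unit_exp (- (x \<bullet> \<xi>))) \<longlonglongrightarrow> (LINT x|\<mu>. of_real (F x) * unit_exp (- (x \<bullet> \<xi>)))"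
    proof (rule integral_dominated_convergence[where w = "\<lambda>_. B ^ CARD('n)"])
      show "(\<lambda>x. complex_of_real (F x) * unit_exp (- (x \<bullet> \<xi>))) \<in> borel_measurable \<mu>" using Fm um by measurable
      show "AE x in \<mu>. (\<lambda>N. G N x * unit_exp (- (x \<bullet> \<xi>))) \<longlonglongrightarrow> complex_of_real (F x) * unit_exp (- (x \<bullet> \<xi>))"
        by (intro AE_I2 tendsto_intros limG)
      show "AE x in \<mu>. norm (G N x * unit_exp (- (x \<bullet> \<xi>))) \<le> B ^ CARD('n)" for N
        using GB by (intro AE_I2) (simp add: norm_mult)
    qed (use Gm in auto)
    have "(LINT x|\<mu>. G N x * unit_exp (- (x \<bullet> \<xi>))) =
        (\<Sum>(q, k)\<in>frequencies M (c N). (\<Prod>i\<in>UNIV. c N (k i)) / of_nat (M ^ CARD('d)) * fourier_transform \<mu> (\<xi> - outer k q)) + fourier_transform \<mu> \<xi>" for N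
    proof -
      define P where "P = PiE (UNIV :: 'n set) (\<lambda>_. {k. c N k \<noteq> 0})"
      have P: "finite P" "(\<lambda>_. 0) \<in> P" unfolding P_def using c by (auto intro!: finite_PiE)
      define w where "w k = (\<Prod>i\<in>UNIV. c N (k i)) / of_nat m" for k :: "'n \<Rightarrow> int"
      have "G N x * unit_exp (- (x \<bullet> \<xi>)) = (\<Sum>q\<in>Q. \<Sum>k\<in>P. w k * unit_exp (- (x \<bullet> (\<xi> - outer k q))))" for x
        unfolding G_def prod_trig_poly[OF c(1)] P_def[symmetric] sum_divide_distrib sum_distrib_right w_def
        by (intro sum.cong refl) (simp add: inner_diff_right unit_exp_add[symmetric] algebra_simps)
      then have "(LINT x|\<mu>. G N x * unit_exp (- (x \<bullet> \<xi>))) = (LINT x|\<mu>. (\<Sum>q\<in>Q. \<Sum>k\<in>P. w k * unit_exp (- (x \<bullet> (\<xi> - outer k q)))))" by simp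
      also have "\<dots> = (\<Sum>q\<in>Q. \<Sum>k\<in>P. w k * fourier_transform \<mu> (\<xi> - outer k q))"
      proof -
        have int: "integrable \<mu> (\<lambda>x. w k * unit_exp (- (x \<bullet> v)))" for k v
          by (intro integrable_mult_right integrable_unit_exp mu continuous_intros)
        show ?thesis unfolding fourier_transform_unit_exp by (simp add: int)
      qed
      also have "\<dots> = (\<Sum>q\<in>Q. w (\<lambda>_. 0) * fourier_transform \<mu> (\<xi> - outer (\<lambda>_. 0) q) + (\<Sum>k\<in>P - {\<lambda>_. 0}. w k * fourier_transform \<mu> (\<xi> - outer k q)))"
        by (intro sum.cong refl sum.remove P)
      also have "\<dots> = fourier_transform \<mu> \<xi> + (\<Sum>q\<in>Q. \<Sum>k\<in>P - {\<lambda>_. 0}. w k * fourier_transform \<mu> (\<xi> - outer k q))"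
      proof -
        have "outer (\<lambda>_. 0) q = (0 :: real ^ 'd ^ 'n)" for q :: "int ^ 'd" by (simp add: outer_def vec_eq_iff)
        moreover have "w (\<lambda>_. 0) = 1 / of_nat m" by (simp add: w_def c)
        ultimately show ?thesis using m0 Q by (simp add: sum.distrib m_def)
      qed
      also have "(\<Sum>q\<in>Q. \<Sum>k\<in>P - {\<lambda>_. 0}. w k * fourier_transform \<mu> (\<xi> - outer k q)) =
          (\<Sum>(q, k)\<in>frequencies M (c N). w k * fourier_transform \<mu> (\<xi> - outer k q))"
        unfolding frequencies_def Q_def P_def by (rule sum.cartesian_product)
      finally show ?thesis by (simp add: w_def m_def add.commute)
    qed
    then have "(\<lambda>N. (\<Sum>(q, k)\<in>frequencies M (c N). (\<Prod>i\<in>UNIV. c N (k i)) / of_nat (M ^ CARD('d)) * fourier_transform \<mu> (\<xi> - outer k q)) + fourier_transform \<mu> \<xi>)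
      \<longlonglongrightarrow> fourier_transform (density \<mu> (\<lambda>x. ennreal (F x))) \<xi>" using l1 ftF by simp
    from tendsto_diff[OF this tendsto_const[of "fourier_transform \<mu> \<xi>"]] show ?thesis by simp
  qed
  show ?thesis by (rule that[OF contF F0 FB supp c(1) c(3) c(4) conv])
qed

text \<open>The multiplicity of \<open>l\<close> times the largest coefficient. The constant
  \<open>Y\<close> gathers the factor \<open>K * n\<close> from the coefficient bound,
  \<open>2 * 2 powr \<tau>\<close> from the reciprocal of the bump width, and \<open>2 * d\<close>
  from \<open>norm q \<le> 2 * d * M\<close>, which converts \<open>norm k\<close> into
  \<open>norm l\<close>.\<close>

lemma coeff_sum_bound:
  fixes l :: "real ^ 'd ^ 'n" and c :: "int \<Rightarrow> complex"
  assumes D: "D > 0" "\<And>n::nat. n > 0 \<Longrightarrow> real (card {a::nat. a dvd n}) \<le> D * real n powr \<epsilon>" and eps: "\<epsilon> \<ge> 0" and M: "M > 0" and tau: "\<tau> > 0"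
    and c2: "\<And>k. norm (c k) \<le> 2" and cK: "\<And>k. k \<noteq> 0 \<Longrightarrow> norm (c k) \<le> 2 * (real K / ((2 * real M) powr (- \<tau>) / 2 * \<bar>of_int k\<bar>)) ^ K"
    and \<kappa>: "0 \<le> \<kappa>" "\<kappa> \<le> real K" and K: "K > 0"
    and R: "finite R" "R \<subseteq> {(q, k). q \<in> denominators M \<and> k \<noteq> (\<lambda>_. 0) \<and> outer k q = l}"
    and Y: "Y = 2 * real K * real CARD('n) * 2 powr \<tau> * (2 * real CARD('d))"
  shows "(\<Sum>(q, k)\<in>R. norm (\<Prod>i\<in>UNIV. c (k i)) / real (M ^ CARD('d))) \<le>
    (2 ^ CARD('n) * Y ^ K * D ^ CARD('d)) * real M powr (- real CARD('d)) * norm l powr (\<epsilon> * real CARD('d)) * (real M powr (1 + \<tau>) / norm l) powr \<kappa>"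
proof -
  have Y1: "Y \<ge> 1"
  proof -
    have "real CARD('n) \<ge> 1" "real CARD('d) \<ge> 1" "real K \<ge> 1" "2 powr \<tau> \<ge> 1" using K tau by (auto simp: Suc_le_eq ge_one_powr_ge_zero)
    then have "1 * 1 * 1 * 1 * (2 * 1) \<le> 2 * real K * real CARD('n) * 2 powr \<tau> * (2 * real CARD('d))" by (intro mult_mono) auto
    then show ?thesis unfolding Y by linarith
  qed
  have each: "norm (\<Prod>i\<in>UNIV. c (k i)) \<le> 2 ^ CARD('n) * (Y ^ K * (real M powr (1 + \<tau>) / norm l) powr \<kappa>)" if qk: "(q, k) \<in> R" for q k
  proof -
    have q: "q \<in> denominators M" "k \<noteq> (\<lambda>_. 0)" "outer k q = l" using qk R(2) by auto
    define v where "v = norm (\<chi> i. real_of_int (k i))"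
    have v: "v > 0" using q(2) by (auto simp: v_def vec_eq_iff)
    have nl: "norm l = v * norm (real_vec q)" using q(3) norm_outer_int[of k q] by (simp add: v_def)
    have nq: "norm (real_vec q) > 0" "norm (real_vec q) \<le> real CARD('d) * (2 * real M)"

    proof -
      have "real M > 0" using M by simp
      then show "norm (real_vec q) > 0" "norm (real_vec q) \<le> real CARD('d) * (2 * real M)"
        using norm_denominators[OF q(1)] by linarith+
    qed
    have nl0: "norm l > 0" using nl v nq by simp
    define \<delta> where "\<delta> = (2 * real M) powr (- \<tau>) / 2"
    have \<delta>: "\<delta> > 0" using M by (simp add: \<delta>_def)
    have "norm (\<Prod>i\<in>UNIV. c (k i)) \<le> 2 ^ CARD('n) * (real K * real CARD('n) / (\<delta> * v)) powr \<kappa>"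
      unfolding v_def by (rule coeff_product_bound[OF c2 _ q(2) \<delta> \<kappa> K]) (use cK in \<open>simp add: \<delta>_def\<close>)
    also have "(real K * real CARD('n) / (\<delta> * v)) powr \<kappa> \<le> (Y * (real M powr (1 + \<tau>) / norm l)) powr \<kappa>"
    proof (intro powr_mono2 \<kappa>)
      have "1 / \<delta> = 2 * 2 powr \<tau> * real M powr \<tau>" using M by (simp add: \<delta>_def powr_minus powr_mult divide_simps)
      then have "real K * real CARD('n) / (\<delta> * v) = real K * real CARD('n) * (2 * 2 powr \<tau> * real M powr \<tau>) * (1 / v)"
        using \<delta> v by (simp add: divide_simps)
      also have "1 / v = norm (real_vec q) / norm l" using nl nq v by simp
      also have "real K * real CARD('n) * (2 * 2 powr \<tau> * real M powr \<tau>) * (norm (real_vec q) / norm l) \<le>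
          real K * real CARD('n) * (2 * 2 powr \<tau> * real M powr \<tau>) * (real CARD('d) * (2 * real M) / norm l)"
        using nq nl0 by (intro mult_left_mono divide_right_mono) auto
      also have "\<dots> = Y * (real M powr (1 + \<tau>) / norm l)" using M by (simp add: Y powr_add mult_ac)
      finally show "real K * real CARD('n) / (\<delta> * v) \<le> Y * (real M powr (1 + \<tau>) / norm l)" .
    qed (use \<delta> v in auto)
    also have "\<dots> = Y powr \<kappa> * (real M powr (1 + \<tau>) / norm l) powr \<kappa>" using Y1 nl0 by (intro powr_mult)
    also have "Y powr \<kappa> \<le> Y powr real K" using Y1 \<kappa> by (intro powr_mono) auto
    also have "Y powr real K = Y ^ K" using Y1 by (simp add: powr_realpow)
    finally show ?thesis by (simp add: mult_left_mono mult_right_mono)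
  qed
  define Z where "Z = 2 ^ CARD('n) * (Y ^ K * (real M powr (1 + \<tau>) / norm l) powr \<kappa>)"
  have Z0: "Z \<ge> 0" unfolding Z_def using Y1 by (intro mult_nonneg_nonneg) auto
  have m: "real M powr (- real CARD('d)) = 1 / real (M ^ CARD('d))" using M by (simp add: powr_minus_divide powr_realpow)
  have "(\<Sum>(q, k)\<in>R. norm (\<Prod>i\<in>UNIV. c (k i)) / real (M ^ CARD('d))) \<le> (\<Sum>(q, k)\<in>R. Z / real (M ^ CARD('d)))"
    using each unfolding Z_def by (intro sum_mono) (auto intro!: divide_right_mono)
  also have "\<dots> = real (card R) * (Z / real (M ^ CARD('d)))" by (simp add: case_prod_unfold)
  also have "\<dots> \<le> (D ^ CARD('d) * norm l powr (\<epsilon> * real CARD('d))) * (Z / real (M ^ CARD('d)))"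
    by (intro mult_right_mono outer_multiplicity[OF D eps M R(2)]) (use Z0 in auto)
  finally show ?thesis unfolding m Z_def by (simp add: mult_ac)
qed

text \<open>A closed condition, so that it passes to weak limits. The entries of \<open>q\<close>
  stay below \<open>2 * M\<close>, and the factor 1/2 leaves room for the strict inequality in
  \<open>well_approximable\<close>.\<close>

definition denominator_nbhd :: "real \<Rightarrow> nat \<Rightarrow> (real ^ 'd ^ 'n) set" where
  "denominator_nbhd \<tau> M = {x. \<exists>q\<in>denominators M. \<forall>i. \<exists>r::int. \<bar>(x *v real_vec q) $ i - of_int r\<bar> \<le> (2 * real M) powr (- \<tau>) / 2}"

text \<open>The sum runs over pairs \<open>(q, k)\<close>, not over matrices. From
  \<open>norm (outer k q) \<ge> norm k * M\<close> comes the power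
  \<open>M powr (\<epsilon> - p)\<close>, from the bump width
  \<open>M powr (\<tau> * \<kappa>)\<close>; the value of \<kappa> is the one that leaves exactly
  the exponent \<open>- (n + \<epsilon>)\<close> on \<open>norm k\<close>, summable over the
  lattice.\<close>

lemma frequency_energy_bound:
  fixes c :: "int \<Rightarrow> complex"
  assumes Lam: "\<And>(\<xi>::real ^ 'n) T. finite T \<Longrightarrow> T \<subseteq> int_lattice \<Longrightarrow> (\<Sum>l\<in>T. (1 + norm (\<xi> - l)) powr (- (real CARD('n) + \<epsilon>))) \<le> \<Lambda>"
    and M: "M > 0" and tau: "\<tau> > 0" and fin: "finite {k. c k \<noteq> 0}"
    and c2: "\<And>k. norm (c k) \<le> 2" and cK: "\<And>k. k \<noteq> 0 \<Longrightarrow> norm (c k) \<le> 2 * (real K / ((2 * real M) powr (- \<tau>) / 2 * \<bar>of_int k\<bar>)) ^ K"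
    and K: "K > 0" and eps: "0 < \<epsilon>" "\<epsilon> < p" and \<kappa>: "\<kappa> = real CARD('n) - p + 2 * \<epsilon>" "0 \<le> \<kappa>" "\<kappa> \<le> real K"
    and X: "X = 2 * real K * real CARD('n) * 2 powr \<tau>"
  shows "(\<Sum>(q, k)\<in>(frequencies M c :: ((int ^ 'd) \<times> ('n \<Rightarrow> int)) set). norm (\<Prod>i\<in>UNIV. c (k i)) / real (M ^ CARD('d)) * norm (outer k q) powr (\<epsilon> - p)) \<le>
    (2 ^ CARD('n) * X powr \<kappa> * 2 powr (real CARD('n) + \<epsilon>) * \<Lambda>) * real M powr (\<tau> * \<kappa> + \<epsilon> - p)"
proof -
  define P where "P = PiE (UNIV :: 'n set) (\<lambda>_. {k. c k \<noteq> 0}) - {\<lambda>_. 0}"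
  have P: "finite P" unfolding P_def using fin by (intro finite_Diff finite_PiE) auto
  define v :: "('n \<Rightarrow> int) \<Rightarrow> real ^ 'n" where "v k = (\<chi> i. real_of_int (k i))" for k
  have injv: "inj_on v P" by (auto simp: inj_on_def v_def vec_eq_iff)
  have latv: "v k \<in> int_lattice" for k unfolding v_def by (rule vec_int_lattice)
  define Z where "Z = 2 ^ CARD('n) * X powr \<kappa> * real M powr (\<tau> * \<kappa> + \<epsilon> - p)"
  have X0: "X > 0" using K by (simp add: X)
  have Z0: "Z \<ge> 0" unfolding Z_def using X0 by simp
  have term_le: "norm (\<Prod>i\<in>UNIV. c (k i)) * norm (outer k q) powr (\<epsilon> - p) \<le> Z * (2 powr (real CARD('n) + \<epsilon>) * (1 + norm (0 - v k)) powr (- (real CARD('n) + \<epsilon>)))"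
    if k: "k \<in> P" and q: "q \<in> denominators M" for k and q :: "int ^ 'd"
  proof -
    have k0: "k \<noteq> (\<lambda>_. 0)" using k by (auto simp: P_def)
    have "v k \<noteq> 0" using k0 by (auto simp: v_def vec_eq_iff)
    then have v1: "norm (v k) \<ge> 1" using latv by (intro norm_ge_1_int_lattice)
    define \<delta> where "\<delta> = (2 * real M) powr (- \<tau>) / 2"
    have \<delta>: "\<delta> > 0" using M by (simp add: \<delta>_def)
    have "norm (\<Prod>i\<in>UNIV. c (k i)) \<le> 2 ^ CARD('n) * (real K * real CARD('n) / (\<delta> * norm (v k))) powr \<kappa>"
      unfolding v_def by (rule coeff_product_bound[OF c2 _ k0 \<delta> \<kappa>(2,3) K]) (use cK in \<open>simp add: \<delta>_def\<close>)
    also have "real K * real CARD('n) / (\<delta> * norm (v k)) = X * (real M powr \<tau> / norm (v k))"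
    proof -
      have "1 / \<delta> = 2 * 2 powr \<tau> * real M powr \<tau>" using M by (simp add: \<delta>_def powr_minus powr_mult divide_simps)
      then have "real K * real CARD('n) / (\<delta> * norm (v k)) = real K * real CARD('n) * (2 * 2 powr \<tau> * real M powr \<tau>) / norm (v k)"
        using \<delta> v1 by (simp add: divide_simps)
      then show ?thesis by (simp add: X mult_ac)
    qed
    also have "(X * (real M powr \<tau> / norm (v k))) powr \<kappa> = X powr \<kappa> * (real M powr (\<tau> * \<kappa>) * norm (v k) powr (- \<kappa>))"
      using X0 M by (simp add: powr_mult powr_divide powr_powr powr_minus_divide)
    finally have 1: "norm (\<Prod>i\<in>UNIV. c (k i)) \<le> 2 ^ CARD('n) * (X powr \<kappa> * (real M powr (\<tau> * \<kappa>) * norm (v k) powr (- \<kappa>)))" .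
    have "norm (outer k q) = norm (v k) * norm (real_vec q)" unfolding norm_outer_int v_def ..
    also have "\<dots> \<ge> norm (v k) * real M" using norm_denominators[OF q] by (intro mult_left_mono) auto
    finally have "norm (outer k q) powr (\<epsilon> - p) \<le> (norm (v k) * real M) powr (\<epsilon> - p)"

    proof (intro powr_mono2')
      have "norm (v k) > 0" using v1 by linarith
      then show "norm (v k) * real M > 0" using M by (intro mult_pos_pos) auto
    qed (use eps in auto)
    also have "\<dots> = norm (v k) powr (\<epsilon> - p) * real M powr (\<epsilon> - p)" by (simp add: powr_mult)
    finally have 2: "norm (outer k q) powr (\<epsilon> - p) \<le> norm (v k) powr (\<epsilon> - p) * real M powr (\<epsilon> - p)" .
    have "norm (\<Prod>i\<in>UNIV. c (k i)) * norm (outer k q) powr (\<epsilon> - p) \<le>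
        (2 ^ CARD('n) * (X powr \<kappa> * (real M powr (\<tau> * \<kappa>) * norm (v k) powr (- \<kappa>)))) * (norm (v k) powr (\<epsilon> - p) * real M powr (\<epsilon> - p))"
      by (rule mult_mono[OF 1 2]) auto
    also have "\<dots> = 2 ^ CARD('n) * X powr \<kappa> * (real M powr (\<tau> * \<kappa>) * real M powr (\<epsilon> - p)) * (norm (v k) powr (- \<kappa>) * norm (v k) powr (\<epsilon> - p))"
      by (simp add: mult_ac)
    also have "real M powr (\<tau> * \<kappa>) * real M powr (\<epsilon> - p) = real M powr (\<tau> * \<kappa> + \<epsilon> - p)" by (simp add: powr_add[symmetric] add_diff_eq)
    also have "norm (v k) powr (- \<kappa>) * norm (v k) powr (\<epsilon> - p) = norm (v k) powr (- (real CARD('n) + \<epsilon>))"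

    proof -
      have "- \<kappa> + (\<epsilon> - p) = - (real CARD('n) + \<epsilon>)" using \<kappa>(1) by simp
      then show ?thesis by (simp only: powr_add[symmetric])
    qed
    also have "2 ^ CARD('n) * X powr \<kappa> * real M powr (\<tau> * \<kappa> + \<epsilon> - p) = Z" by (simp add: Z_def)
    also have "Z * norm (v k) powr (- (real CARD('n) + \<epsilon>)) \<le> Z * (2 powr (real CARD('n) + \<epsilon>) * (1 + norm (0 - v k)) powr (- (real CARD('n) + \<epsilon>)))"
    proof (intro mult_left_mono Z0)
      have "(2 * norm (v k)) powr (- (real CARD('n) + \<epsilon>)) \<le> (1 + norm (v k)) powr (- (real CARD('n) + \<epsilon>))"
        using v1 eps by (intro powr_mono2') auto
      then have le: "2 powr (- (real CARD('n) + \<epsilon>)) * norm (v k) powr (- (real CARD('n) + \<epsilon>)) \<le> (1 + norm (v k)) powr (- (real CARD('n) + \<epsilon>))"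
        by (simp only: powr_mult)
      have "norm (v k) powr (- (real CARD('n) + \<epsilon>)) = 2 powr (real CARD('n) + \<epsilon>) * (2 powr (- (real CARD('n) + \<epsilon>)) * norm (v k) powr (- (real CARD('n) + \<epsilon>)))"
      proof -
        have "y = 2 powr t * (2 powr (- t) * y)" for t y :: real by (simp add: powr_minus)
        then show ?thesis .
      qed
      also have "\<dots> \<le> 2 powr (real CARD('n) + \<epsilon>) * (1 + norm (v k)) powr (- (real CARD('n) + \<epsilon>))"
        by (intro mult_left_mono le) simp
      finally show "norm (v k) powr (- (real CARD('n) + \<epsilon>)) \<le> 2 powr (real CARD('n) + \<epsilon>) * (1 + norm (0 - v k)) powr (- (real CARD('n) + \<epsilon>))" by simp
    qed
    finally show ?thesis .
  qed
  have m0: "real (M ^ CARD('d)) > 0" using M by simp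
  have "(\<Sum>(q, k)\<in>(frequencies M c :: ((int ^ 'd) \<times> ('n \<Rightarrow> int)) set). norm (\<Prod>i\<in>UNIV. c (k i)) / real (M ^ CARD('d)) * norm (outer k q) powr (\<epsilon> - p)) =
      (\<Sum>q\<in>(denominators M :: (int ^ 'd) set). \<Sum>k\<in>P. norm (\<Prod>i\<in>UNIV. c (k i)) * norm (outer k q) powr (\<epsilon> - p) / real (M ^ CARD('d)))"
    unfolding frequencies_def P_def by (subst sum.cartesian_product) simp
  also have "\<dots> \<le> (\<Sum>q\<in>(denominators M :: (int ^ 'd) set). \<Sum>k\<in>P. Z * (2 powr (real CARD('n) + \<epsilon>) * (1 + norm (0 - v k)) powr (- (real CARD('n) + \<epsilon>))) / real (M ^ CARD('d)))"
    using m0 by (intro sum_mono divide_right_mono term_le) auto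
  also have "\<dots> = Z * 2 powr (real CARD('n) + \<epsilon>) * (\<Sum>k\<in>P. (1 + norm (0 - v k)) powr (- (real CARD('n) + \<epsilon>)))"
    using M by (simp add: card_denominators sum_distrib_left[symmetric] sum_divide_distrib[symmetric] mult.assoc)
  also have "(\<Sum>k\<in>P. (1 + norm (0 - v k)) powr (- (real CARD('n) + \<epsilon>))) = (\<Sum>l\<in>v ` P. (1 + norm (0 - l)) powr (- (real CARD('n) + \<epsilon>)))"
    by (subst sum.reindex[OF injv]) simp
  also have "Z * 2 powr (real CARD('n) + \<epsilon>) * \<dots> \<le> Z * 2 powr (real CARD('n) + \<epsilon>) * \<Lambda>"
    using Z0 P latv by (intro mult_left_mono Lam) auto
  finally show ?thesis by (simp add: Z_def mult_ac)
qed

text \<open>The freedom lies in choosing \<open>M\<close> after \<open>C\<close> and \<eta>: both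
  increments are bounded by constants times negative powers of \<open>M\<close>. The hypotheses
  \<open>(1 + \<tau>) * a < d\<close> and \<open>p * (1 + \<tau>) > n * \<tau> - d\<close> say that
  these powers are negative once the loss \<epsilon> is small.\<close>

lemma multiplicative_step:
  fixes \<mu> :: "(real ^ 'd ^ 'n) measure"
  assumes tau: "\<tau> > 0" and a: "0 \<le> a" "(1 + \<tau>) * a < real CARD('d)"
    and p: "0 < p" "p < real CARD('n)" "p * (1 + \<tau>) > real CARD('n) * \<tau> - real CARD('d)"
    and A: "A \<ge> a + real DIM(real ^ 'd ^ 'n) + 1" "A \<ge> p + real DIM(real ^ 'd ^ 'n) + 1"
    and mu: "finite_measure \<mu>" "sets \<mu> = sets borel"
    and decay: "\<And>\<xi>. norm (fourier_transform \<mu> \<xi>) \<le> C * (1 + norm \<xi>) powr (- A)" and eta: "\<eta> > 0"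
  shows "\<exists>M F. M > M0 \<and> continuous_on UNIV F \<and> (\<forall>x. 0 \<le> F x) \<and> (\<exists>B. \<forall>x. F x \<le> B) \<and> (\<forall>x. F x \<noteq> 0 \<longrightarrow> x \<in> denominator_nbhd \<tau> M) \<and>
    (\<exists>C'. \<forall>\<xi>. norm (fourier_transform (density \<mu> (\<lambda>x. ennreal (F x))) \<xi>) \<le> C' * (1 + norm \<xi>) powr (- A)) \<and>
    (\<forall>\<xi>. norm (fourier_transform (density \<mu> (\<lambda>x. ennreal (F x))) \<xi> - fourier_transform \<mu> \<xi>) \<le> \<eta> * (1 + norm \<xi>) powr (- a)) \<and>
    (\<forall>T. finite T \<longrightarrow> T \<subseteq> int_lattice \<longrightarrow> (\<Sum>\<xi>\<in>T. (norm (fourier_transform (density \<mu> (\<lambda>x. ennreal (F x))) \<xi> - fourier_transform \<mu> \<xi>))\<^sup>2 * (1 + norm \<xi>) powr (- p)) \<le> \<eta>\<^sup>2)"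
proof -
  define d n m where "d = real CARD('d)" and "n = real CARD('n)" and "m = real DIM(real ^ 'd ^ 'n)"
  have dn: "d \<ge> 1" "n \<ge> 1" "m \<ge> 0" by (auto simp: d_def n_def m_def Suc_le_eq)
  \<comment> \<open>The total loss in the divisor bound. The last two entries use half of the slack
    in the conditions on \<open>a\<close> and \<open>p\<close>; they make \<open>e1\<close>, the
    power of \<open>M\<close> in the pointwise increment, and \<open>e2\<close>, the one in the
    energy increment, negative.\<close>
  define \<epsilon> where "\<epsilon> = min (min (p / 2) 1) (min ((d - (1 + \<tau>) * a) / (2 * (1 + \<tau>))) ((p * (1 + \<tau>) - (n * \<tau> - d)) / (2 * (1 + 2 * \<tau>))))"
  have eps0: "\<epsilon> > 0" using tau a p unfolding \<epsilon>_def d_def n_def by simp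
  have eps1: "\<epsilon> < p" "\<epsilon> \<le> 1" using p unfolding \<epsilon>_def by linarith+
  have half: "s * (w / (2 * s)) = w / 2" if "s > 0" for s w :: real using that by simp
  define e1 where "e1 = - d + (1 + \<tau>) * (a + \<epsilon>)"
  have e1: "e1 < 0"
  proof -
    have "(1 + \<tau>) * \<epsilon> \<le> (1 + \<tau>) * ((d - (1 + \<tau>) * a) / (2 * (1 + \<tau>)))" using tau by (intro mult_left_mono) (auto simp: \<epsilon>_def)
    also have "\<dots> = (d - (1 + \<tau>) * a) / 2" by (rule half) (use tau in simp)
    also have "\<dots> < d - (1 + \<tau>) * a"
    proof -
      have "y / 2 < y" if "y > 0" for y :: real using that by simp
      then show ?thesis using a(2) unfolding d_def by (simp only: diff_gt_0_iff_gt)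
    qed
    finally show ?thesis unfolding e1_def distrib_left by linarith
  qed
  define \<kappa>2 where "\<kappa>2 = n - p + 2 * \<epsilon>"
  define e2 where "e2 = - d + (\<tau> * \<kappa>2 + \<epsilon> - p)"
  have e2: "e2 < 0"
  proof -
    define w where "w = p * (1 + \<tau>) - (n * \<tau> - d)"
    have w: "w > 0" using p(3) by (simp add: w_def n_def d_def)
    have "(1 + 2 * \<tau>) * \<epsilon> \<le> (1 + 2 * \<tau>) * (w / (2 * (1 + 2 * \<tau>)))" using tau by (intro mult_left_mono) (auto simp: \<epsilon>_def w_def)
    also have "\<dots> = w / 2" by (rule half) (use tau in simp)
    also have "\<dots> < w" using w by simp
    finally have "(1 + 2 * \<tau>) * \<epsilon> < w" .
    moreover have "e2 = (1 + 2 * \<tau>) * \<epsilon> - w" by (simp add: e2_def \<kappa>2_def w_def algebra_simps)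
    ultimately show ?thesis by simp
  qed
  have A0: "A \<ge> 0" using A(1) a(1) dn(3) unfolding m_def[symmetric] by linarith
  \<comment> \<open>Enough averagings for all interpolation exponents below:
    \<open>a + \<epsilon>\<close>, \<open>\<kappa>2\<close> and \<open>\<kappa>3\<close>.\<close>
  define K where "K = nat \<lceil>A + m + n + 3\<rceil>"
  have KA: "real K \<ge> A + m + n + 3" unfolding K_def by linarith
  have K: "K > 0" using KA A0 dn by (intro Nat.gr0I) auto
  define \<kappa>3 where "\<kappa>3 = A + m + 1 + \<epsilon>"
  have kap: "0 \<le> a + \<epsilon>" "a + \<epsilon> \<le> real K" "0 \<le> \<kappa>2" "\<kappa>2 \<le> real K" "0 \<le> \<kappa>3" "\<kappa>3 \<le> real K"
    using KA A0 A(1) dn eps0 eps1 a(1) p(1,2) unfolding \<kappa>2_def \<kappa>3_def m_def[symmetric] n_def[symmetric] by linarith+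
  \<comment> \<open>One divisor count per column: \<open>d\<close> of them with exponent
    \<open>\<epsilon> / d\<close> lose \<open>norm l powr \<epsilon>\<close> altogether.\<close>
  have "\<epsilon> / d > 0" using eps0 dn by simp
  then obtain D where D: "D > 0" "\<And>n::nat. n > 0 \<Longrightarrow> real (card {a::nat. a dvd n}) \<le> D * real n powr (\<epsilon> / d)"
    by (rule divisor_bound) (rule that)
  have "m + 1 > m" by simp
  then have "\<exists>\<Lambda>>0. \<forall>(\<xi>::real ^ 'd ^ 'n) T. finite T \<longrightarrow> T \<subseteq> int_lattice \<longrightarrow> (\<Sum>l\<in>T. (1 + norm (\<xi> - l)) powr (- (m + 1))) \<le> \<Lambda>"
    unfolding m_def by (rule lattice_powr_sum_bound) blast
  then obtain \<Lambda> where Lam0: "\<Lambda> > 0" and Lam: "\<And>(\<xi>::real ^ 'd ^ 'n) T. finite T \<Longrightarrow> T \<subseteq> int_lattice \<Longrightarrow> (\<Sum>l\<in>T. (1 + norm (\<xi> - l)) powr (- (real DIM(real ^ 'd ^ 'n) + 1))) \<le> \<Lambda>"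
    unfolding m_def by blast
  have "n + \<epsilon> > real DIM(real ^ 'n)" using eps0 by (simp add: n_def)
  then have "\<exists>\<Lambda>>0. \<forall>(\<xi>::real ^ 'n) T. finite T \<longrightarrow> T \<subseteq> int_lattice \<longrightarrow> (\<Sum>l\<in>T. (1 + norm (\<xi> - l)) powr (- (n + \<epsilon>))) \<le> \<Lambda>"
    by (rule lattice_powr_sum_bound) blast
  then obtain \<Lambda>' where Lam'0: "\<Lambda>' > 0" and Lam': "\<And>(\<xi>::real ^ 'n) T. finite T \<Longrightarrow> T \<subseteq> int_lattice \<Longrightarrow> (\<Sum>l\<in>T. (1 + norm (\<xi> - l)) powr (- (real CARD('n) + \<epsilon>))) \<le> \<Lambda>'"
    unfolding n_def by blast
  have C0: "C \<ge> 0" using order_trans[OF norm_ge_zero decay[of 0]] by simp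
  define Y where "Y = 2 * real K * real CARD('n) * 2 powr \<tau> * (2 * real CARD('d))"
  define X where "X = 2 * real K * real CARD('n) * 2 powr \<tau>"
  define U where "U = 2 ^ CARD('n) * Y ^ K * D ^ CARD('d)"
  have U0: "U \<ge> 0" unfolding U_def Y_def using D(1) by simp
  define U2 where "U2 = 2 ^ CARD('n) * X powr \<kappa>2 * 2 powr (real CARD('n) + \<epsilon>) * \<Lambda>'"
  have U20: "U2 \<ge> 0" unfolding U2_def using Lam'0 by simp
  have "(\<lambda>M. C * (U * 2 powr a * real M powr e1 * \<Lambda>)) \<longlonglongrightarrow> C * (U * 2 powr a * 0 * \<Lambda>)"
    by (intro tendsto_intros tendsto_neg_powr[OF e1] filterlim_real_sequentially)
  then have ev1: "\<forall>\<^sub>F M in sequentially. C * (U * 2 powr a * real M powr e1 * \<Lambda>) < \<eta>" using eta by (intro order_tendstoD(2)) auto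
  have "(\<lambda>M. C\<^sup>2 * (\<Lambda>\<^sup>2 * (U * (U2 * real M powr e2)))) \<longlonglongrightarrow> C\<^sup>2 * (\<Lambda>\<^sup>2 * (U * (U2 * 0)))"
    by (intro tendsto_intros tendsto_neg_powr[OF e2] filterlim_real_sequentially)
  then have ev2: "\<forall>\<^sub>F M in sequentially. C\<^sup>2 * (\<Lambda>\<^sup>2 * (U * (U2 * real M powr e2))) < \<eta>\<^sup>2" using eta by (intro order_tendstoD(2)) auto
  from eventually_conj[OF ev1 eventually_conj[OF ev2 eventually_gt_at_top[of M0]]]
  obtain M where M1: "C * (U * 2 powr a * real M powr e1 * \<Lambda>) < \<eta>" and M2: "C\<^sup>2 * (\<Lambda>\<^sup>2 * (U * (U2 * real M powr e2))) < \<eta>\<^sup>2" and M0: "M > M0"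
    unfolding eventually_sequentially by blast
  have M: "M > 0" using M0 by simp
  define \<delta> where "\<delta> = (2 * real M) powr (- \<tau>) / 2"
  have delta: "0 < \<delta>" "\<delta> \<le> 1"
  proof -
    show "0 < \<delta>" using M by (simp add: \<delta>_def)
    have "(2 * real M) powr (- \<tau>) \<le> 1 powr (- \<tau>)" using M tau by (intro powr_mono2') auto
    then show "\<delta> \<le> 1" by (simp add: \<delta>_def)
  qed
  obtain F :: "real ^ 'd ^ 'n \<Rightarrow> real" and c :: "nat \<Rightarrow> int \<Rightarrow> complex" and B :: real
    where F: "continuous_on UNIV F" "\<And>x. F x \<ge> 0" "\<And>x. F x \<le> B"
    "\<And>x. F x \<noteq> 0 \<Longrightarrow> \<exists>q\<in>denominators M. \<forall>i. \<exists>r::int. \<bar>(x *v real_vec q) $ i - of_int r\<bar> \<le> \<delta>"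
    and c: "\<And>N. finite {k. c N k \<noteq> 0}" "\<And>N k. norm (c N k) \<le> 2"
    "\<And>N k. k \<noteq> 0 \<Longrightarrow> norm (c N k) \<le> 2 * (real K / (\<delta> * \<bar>of_int k\<bar>)) ^ K"
    and conv: "\<And>\<mu> \<xi>. finite_measure \<mu> \<Longrightarrow> sets \<mu> = sets borel \<Longrightarrow>
      (\<lambda>N. \<Sum>(q, k)\<in>frequencies M (c N). (\<Prod>i\<in>UNIV. c N (k i)) / of_nat (M ^ CARD('d)) * fourier_transform \<mu> (\<xi> - outer k q))
      \<longlonglongrightarrow> fourier_transform (density \<mu> (\<lambda>x. ennreal (F x))) \<xi> - fourier_transform \<mu> \<xi>"
    by (rule matrix_bump[OF delta K M]) (rule that)
  define g where "g N \<xi> = (\<Sum>(q, k)\<in>frequencies M (c N). (\<Prod>i\<in>UNIV. c N (k i)) / of_nat (M ^ CARD('d)) * fourier_transform \<mu> (\<xi> - outer k q))" for N \<xi>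
  define h where "h \<xi> = fourier_transform (density \<mu> (\<lambda>x. ennreal (F x))) \<xi> - fourier_transform \<mu> \<xi>" for \<xi>
  have gh: "(\<lambda>N. g N \<xi>) \<longlonglongrightarrow> h \<xi>" for \<xi> unfolding g_def h_def by (rule conv[OF mu])
  define J where "J N = (frequencies M (c N) :: ((int ^ 'd) \<times> ('n \<Rightarrow> int)) set)" for N
  have finJ: "finite (J N)" for N unfolding J_def by (rule finite_frequencies[OF c(1)])
  define o' where "o' z = outer (snd z) (fst z)" for z :: "(int ^ 'd) \<times> ('n \<Rightarrow> int)"
  define w where "w N z = norm (\<Prod>i\<in>UNIV. c N (snd z i)) / real (M ^ CARD('d))" for N and z :: "(int ^ 'd) \<times> ('n \<Rightarrow> int)"
  have w0: "w N z \<ge> 0" for N z by (simp add: w_def)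
  define L where "L N = o' ` J N" for N
  have finL: "finite (L N)" for N unfolding L_def using finJ by simp
  have latL: "L N \<subseteq> int_lattice" for N unfolding L_def o'_def using outer_int_lattice by auto
  \<comment> \<open>Different pairs can give the same matrix \<open>l\<close>; their coefficients
    are collected in absolute value.\<close>
  define b where "b N l = (\<Sum>z\<in>{z \<in> J N. o' z = l}. w N z)" for N l
  have group: "(\<Sum>z\<in>J N. w N z * f (o' z)) = (\<Sum>l\<in>L N. b N l * f l)" for N and f :: "real ^ 'd ^ 'n \<Rightarrow> real"
  proof -
    have "(\<Sum>z\<in>J N. w N z * f (o' z)) = (\<Sum>l\<in>L N. \<Sum>z\<in>{z \<in> J N. o' z = l}. w N z * f (o' z))"
      unfolding L_def by (rule sum.image_gen[OF finJ])
    also have "\<dots> = (\<Sum>l\<in>L N. b N l * f l)" unfolding b_def sum_distrib_right by (intro sum.cong) auto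
    finally show ?thesis .
  qed
  have L1: "norm l \<ge> 1" if l: "l \<in> L N" for N l
  proof (rule norm_ge_1_int_lattice)
    show "l \<in> int_lattice" using latL l by blast
    obtain z where z: "z \<in> J N" "l = o' z" using l unfolding L_def by blast
    define q k where "q = fst z" and "k = snd z"
    have qk: "q \<in> denominators M" "k \<noteq> (\<lambda>_. 0)" "l = outer k q"
      using z unfolding q_def k_def o'_def J_def frequencies_def by (auto simp: mem_Times_iff)
    have "norm (real_vec q) > 0" using norm_denominators(1)[OF qk(1)] M by (metis of_nat_0_less_iff order.strict_trans2)
    moreover have "norm (\<chi> i. real_of_int (k i)) > 0" using qk(2) by (auto simp: vec_eq_iff)
    ultimately have "norm l > 0" unfolding qk(3) norm_outer_int by (rule mult_pos_pos[rotated])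
    then show "l \<noteq> 0" by auto
  qed
  have b_bound: "b N l \<le> U * real M powr (- d) * norm l powr \<epsilon> * (real M powr (1 + \<tau>) / norm l) powr \<kappa>"
    if \<kappa>: "0 \<le> \<kappa>" "\<kappa> \<le> real K" for N l \<kappa>
  proof -
    have "b N l = (\<Sum>(q, k)\<in>{z \<in> J N. o' z = l}. norm (\<Prod>i\<in>UNIV. c N (k i)) / real (M ^ CARD('d)))"
      unfolding b_def w_def by (simp add: case_prod_unfold)
    also have "\<dots> \<le> (2 ^ CARD('n) * Y ^ K * D ^ CARD('d)) * real M powr (- real CARD('d)) * norm l powr (\<epsilon> / d * real CARD('d)) * (real M powr (1 + \<tau>) / norm l) powr \<kappa>"
    proof (rule coeff_sum_bound[OF D _ M tau c(2) _ \<kappa> K _ _ Y_def])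
      show "0 \<le> \<epsilon> / d" using eps0 dn by simp
      show "norm (c N k) \<le> 2 * (real K / ((2 * real M) powr (- \<tau>) / 2 * \<bar>of_int k\<bar>)) ^ K" if "k \<noteq> 0" for k
        using c(3)[OF that, of N] by (simp only: \<delta>_def)
      show "finite {z \<in> J N. o' z = l}" using finJ by simp
      show "{z \<in> J N. o' z = l} \<subseteq> {(q, k). q \<in> denominators M \<and> k \<noteq> (\<lambda>_. 0) \<and> outer k q = l}"
        unfolding J_def frequencies_def o'_def by auto
    qed
    also have "\<epsilon> / d * real CARD('d) = \<epsilon>" using dn by (simp add: d_def)
    finally show ?thesis by (simp only: U_def d_def)
  qed
  \<comment> \<open>The interpolation exponent \<open>t + \<epsilon>\<close> cancels the divisor
    loss \<open>norm l powr \<epsilon>\<close> and leaves decay of order \<open>t\<close>.\<close>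
  have b_bound': "b N l \<le> U * 2 powr t * real M powr (- d + (1 + \<tau>) * (t + \<epsilon>)) * (1 + norm l) powr (- t)"
    if t: "0 \<le> t" "t + \<epsilon> \<le> real K" and l: "l \<in> L N" for N l t
  proof -
    have l1: "norm l \<ge> 1" by (rule L1[OF l])
    have "b N l \<le> U * real M powr (- d) * norm l powr \<epsilon> * (real M powr (1 + \<tau>) / norm l) powr (t + \<epsilon>)"
      using t eps0 by (intro b_bound) auto
    also have "(real M powr (1 + \<tau>) / norm l) powr (t + \<epsilon>) = real M powr ((1 + \<tau>) * (t + \<epsilon>)) * norm l powr (- (t + \<epsilon>))"

    proof -
      have "(x / y) powr e = x powr e * y powr (- e)" if "x \<ge> 0" "y \<ge> 0" for x y e :: real
        using that by (simp add: powr_divide powr_minus_divide)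
      from this[OF powr_ge_zero norm_ge_zero] show ?thesis by (simp only: powr_powr)
    qed
    also have "U * real M powr (- d) * norm l powr \<epsilon> * (real M powr ((1 + \<tau>) * (t + \<epsilon>)) * norm l powr (- (t + \<epsilon>))) =
        U * (real M powr (- d) * real M powr ((1 + \<tau>) * (t + \<epsilon>))) * (norm l powr \<epsilon> * norm l powr (- (t + \<epsilon>)))" by (simp only: mult_ac)
    also have "real M powr (- d) * real M powr ((1 + \<tau>) * (t + \<epsilon>)) = real M powr (- d + (1 + \<tau>) * (t + \<epsilon>))" by (simp only: powr_add)
    also have "norm l powr \<epsilon> * norm l powr (- (t + \<epsilon>)) = norm l powr (- t)" by (simp add: powr_add[symmetric])
    also have "U * real M powr (- d + (1 + \<tau>) * (t + \<epsilon>)) * norm l powr (- t) \<le> U * real M powr (- d + (1 + \<tau>) * (t + \<epsilon>)) * (2 powr t * (1 + norm l) powr (- t))"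
    proof (intro mult_left_mono)
      have "(2 * norm l) powr (- t) \<le> (1 + norm l) powr (- t)" using l1 t by (intro powr_mono2') auto
      then have le: "2 powr (- t) * norm l powr (- t) \<le> (1 + norm l) powr (- t)" by (simp only: powr_mult)
      have "norm l powr (- t) = 2 powr t * (2 powr (- t) * norm l powr (- t))" by (simp add: powr_minus)
      also have "\<dots> \<le> 2 powr t * (1 + norm l) powr (- t)" by (intro mult_left_mono le) simp
      finally show "norm l powr (- t) \<le> 2 powr t * (1 + norm l) powr (- t)" .
    qed (use U0 in auto)
    finally show ?thesis by (simp only: mult_ac)
  qed
  have g_le: "norm (g N \<xi>) \<le> C * (\<Sum>l\<in>L N. b N l * (1 + norm (\<xi> - l)) powr (- A))" for N \<xi>
  proof -
    have "norm (g N \<xi>) \<le> (\<Sum>z\<in>J N. w N z * (C * (1 + norm (\<xi> - o' z)) powr (- A)))"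
      unfolding g_def J_def case_prod_unfold
    proof (intro order_trans[OF norm_sum] sum_mono)
      fix z :: "(int ^ 'd) \<times> ('n \<Rightarrow> int)"
      show "norm ((\<Prod>i\<in>UNIV. c N (snd z i)) / of_nat (M ^ CARD('d)) * fourier_transform \<mu> (\<xi> - outer (snd z) (fst z))) \<le> w N z * (C * (1 + norm (\<xi> - o' z)) powr (- A))"
        unfolding norm_mult norm_divide norm_of_nat w_def o'_def by (intro mult_left_mono decay) auto
    qed
    also have "\<dots> = (\<Sum>l\<in>L N. b N l * (C * (1 + norm (\<xi> - l)) powr (- A)))" by (rule group[of N "\<lambda>l. C * (1 + norm (\<xi> - l)) powr (- A)"])
    also have "\<dots> = C * (\<Sum>l\<in>L N. b N l * (1 + norm (\<xi> - l)) powr (- A))" by (simp add: sum_distrib_left mult_ac)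
    finally show ?thesis .
  qed
  have sum0: "(\<Sum>l\<in>L N. b N l * (1 + norm (\<xi> - l)) powr (- A)) \<ge> 0" for N \<xi>
    unfolding b_def by (intro sum_nonneg mult_nonneg_nonneg) (auto simp: w0)
  have pointwise: "norm (h \<xi>) \<le> \<eta> * (1 + norm \<xi>) powr (- a)" for \<xi>
  proof (rule Lim_bounded[OF tendsto_norm[OF gh]], intro allI impI)
    fix N
    have "(\<Sum>l\<in>L N. b N l * (1 + norm (\<xi> - l)) powr (- A)) \<le> (U * 2 powr a * real M powr e1) * \<Lambda> * (1 + norm \<xi>) powr (- a)"
      by (rule perturbation_pointwise[OF Lam finL latL a(1)])
        (use A U0 b_bound'[OF a(1) kap(2)] in \<open>auto simp: e1_def\<close>)
    then have "norm (g N \<xi>) \<le> C * ((U * 2 powr a * real M powr e1) * \<Lambda> * (1 + norm \<xi>) powr (- a))"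
      using g_le[of N \<xi>] C0 by (meson mult_left_mono order_trans)
    also have "\<dots> = C * (U * 2 powr a * real M powr e1 * \<Lambda>) * (1 + norm \<xi>) powr (- a)" by (simp only: mult_ac)
    also have "\<dots> \<le> \<eta> * (1 + norm \<xi>) powr (- a)" using M1 by (intro mult_right_mono) auto
    finally show "norm (g N \<xi>) \<le> \<eta> * (1 + norm \<xi>) powr (- a)" .
  qed
  \<comment> \<open>This factor grows with \<open>M\<close>, because the decay asked for is far
    beyond what the coefficients offer up to their natural scale. It only enters the constant from
    which the following step starts.\<close>
  define \<theta> where "\<theta> = U * 2 powr (A + m + 1) * real M powr (- d + (1 + \<tau>) * (A + m + 1 + \<epsilon>))"
  have class_h: "norm (h \<xi>) \<le> C * (\<theta> * \<Lambda>) * (1 + norm \<xi>) powr (- A)" for \<xi>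
  proof (rule Lim_bounded[OF tendsto_norm[OF gh]], intro allI impI)
    fix N
    have "(\<Sum>l\<in>L N. b N l * (1 + norm (\<xi> - l)) powr (- A)) \<le> \<theta> * \<Lambda> * (1 + norm \<xi>) powr (- A)"
    proof (rule perturbation_class[OF Lam finL latL A0])
      show "\<theta> \<ge> 0" unfolding \<theta>_def using U0 by simp
      show "b N l \<le> \<theta> * (1 + norm l) powr (- (A + real DIM(real ^ 'd ^ 'n) + 1))" if "l \<in> L N" for l
        unfolding \<theta>_def m_def[symmetric] using kap(6) A0 dn that by (intro b_bound') (auto simp: \<kappa>3_def)
    qed
    then have "norm (g N \<xi>) \<le> C * (\<theta> * \<Lambda> * (1 + norm \<xi>) powr (- A))"
      using g_le[of N \<xi>] C0 by (meson mult_left_mono order_trans)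
    then show "norm (g N \<xi>) \<le> C * (\<theta> * \<Lambda>) * (1 + norm \<xi>) powr (- A)" by (simp only: mult_ac)
  qed
  have class_nu: "norm (fourier_transform (density \<mu> (\<lambda>x. ennreal (F x))) \<xi>) \<le> (C + C * (\<theta> * \<Lambda>)) * (1 + norm \<xi>) powr (- A)" for \<xi>
  proof -
    have "norm (fourier_transform (density \<mu> (\<lambda>x. ennreal (F x))) \<xi>) = norm (fourier_transform \<mu> \<xi> + h \<xi>)" by (simp add: h_def)
    also have "\<dots> \<le> C * (1 + norm \<xi>) powr (- A) + C * (\<theta> * \<Lambda>) * (1 + norm \<xi>) powr (- A)"
      by (intro order_trans[OF norm_triangle_ineq] add_mono decay class_h)
    finally show ?thesis by (simp add: distrib_right)
  qed
  have energy_b: "(\<Sum>l\<in>L N. (b N l)\<^sup>2 * (1 + norm l) powr (- p)) \<le> U * (U2 * real M powr e2)" for N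
  \<comment> \<open>One factor \<open>b N l\<close> is replaced by its uniform bound (interpolation
    exponent 0). What remains is linear in \<open>b\<close>, so it can be ungrouped into a sum over
    pairs \<open>(q, k)\<close>.\<close>
  proof -
    have "(\<Sum>l\<in>L N. (b N l)\<^sup>2 * (1 + norm l) powr (- p)) \<le> (\<Sum>l\<in>L N. b N l * (U * real M powr (- d) * norm l powr (\<epsilon> - p)))"
    proof (intro sum_mono)
      fix l assume l: "l \<in> L N"
      have l1: "norm l \<ge> 1" by (rule L1[OF l])
      have b0: "b N l \<ge> 0" unfolding b_def by (intro sum_nonneg w0)
      have "norm l > 0" "real M powr (1 + \<tau>) / norm l \<noteq> 0" using l1 M by auto
      then have "(real M powr (1 + \<tau>) / norm l) powr 0 = 1" by (simp only: powr_zero_eq_one if_False)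
      then have "b N l \<le> U * real M powr (- d) * norm l powr \<epsilon>" using b_bound[of 0 N l] by simp
      moreover have "(1 + norm l) powr (- p) \<le> norm l powr (- p)" using l1 p by (intro powr_mono2') auto
      ultimately have "b N l * (1 + norm l) powr (- p) \<le> (U * real M powr (- d) * norm l powr \<epsilon>) * norm l powr (- p)"
        using U0 b0 by (intro mult_mono) auto
      also have "\<dots> = U * real M powr (- d) * norm l powr (\<epsilon> - p)" by (simp add: powr_add[symmetric] mult.assoc)
      finally have "b N l * (b N l * (1 + norm l) powr (- p)) \<le> b N l * (U * real M powr (- d) * norm l powr (\<epsilon> - p))"
        using b0 by (rule mult_left_mono)
      then show "(b N l)\<^sup>2 * (1 + norm l) powr (- p) \<le> b N l * (U * real M powr (- d) * norm l powr (\<epsilon> - p))"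
        by (simp only: power2_eq_square mult.assoc)
    qed
    also have "\<dots> = (\<Sum>z\<in>J N. w N z * (U * real M powr (- d) * norm (o' z) powr (\<epsilon> - p)))" by (rule group[symmetric])
    also have "\<dots> = U * real M powr (- d) * (\<Sum>z\<in>J N. w N z * norm (o' z) powr (\<epsilon> - p))" by (simp add: sum_distrib_left mult_ac)
    also have "(\<Sum>z\<in>J N. w N z * norm (o' z) powr (\<epsilon> - p)) \<le> U2 * real M powr (\<tau> * \<kappa>2 + \<epsilon> - p)"
    proof -
      have "(\<Sum>(q, k)\<in>(frequencies M (c N) :: ((int ^ 'd) \<times> ('n \<Rightarrow> int)) set). norm (\<Prod>i\<in>UNIV. c N (k i)) / real (M ^ CARD('d)) * norm (outer k q) powr (\<epsilon> - p)) \<le>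
        (2 ^ CARD('n) * X powr \<kappa>2 * 2 powr (real CARD('n) + \<epsilon>) * \<Lambda>') * real M powr (\<tau> * \<kappa>2 + \<epsilon> - p)"
        by (rule frequency_energy_bound[OF Lam' M tau c(1) c(2) _ K eps0 eps1(1) _ kap(3,4) X_def])
          (use c(3)[of _ N] in \<open>auto simp: \<delta>_def \<kappa>2_def n_def\<close>)
      then show ?thesis unfolding U2_def J_def w_def o'_def case_prod_unfold .
    qed
    also have "U * real M powr (- d) * (U2 * real M powr (\<tau> * \<kappa>2 + \<epsilon> - p)) = U * (U2 * real M powr e2)"
      unfolding e2_def powr_add[of _ "- d"] by (simp only: mult_ac)
    finally show ?thesis using U0 by (simp add: mult_left_mono)
  qed
  have energy: "(\<Sum>\<xi>\<in>T. (norm (h \<xi>))\<^sup>2 * (1 + norm \<xi>) powr (- p)) \<le> \<eta>\<^sup>2" if T: "finite T" "T \<subseteq> int_lattice" for T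
  proof (rule Lim_bounded)
    show "(\<lambda>N. \<Sum>\<xi>\<in>T. (norm (g N \<xi>))\<^sup>2 * (1 + norm \<xi>) powr (- p)) \<longlonglongrightarrow> (\<Sum>\<xi>\<in>T. (norm (h \<xi>))\<^sup>2 * (1 + norm \<xi>) powr (- p))"
      by (intro tendsto_intros gh)
    show "\<forall>N\<ge>0. (\<Sum>\<xi>\<in>T. (norm (g N \<xi>))\<^sup>2 * (1 + norm \<xi>) powr (- p)) \<le> \<eta>\<^sup>2"
    proof (intro allI impI)
      fix N :: nat
      have "(\<Sum>\<xi>\<in>T. (norm (g N \<xi>))\<^sup>2 * (1 + norm \<xi>) powr (- p)) \<le>
          (\<Sum>\<xi>\<in>T. C\<^sup>2 * ((\<Sum>l\<in>L N. b N l * (1 + norm (\<xi> - l)) powr (- A))\<^sup>2 * (1 + norm \<xi>) powr (- p)))"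
      proof (intro sum_mono)
        fix \<xi> :: "real ^ 'd ^ 'n"
        have "(norm (g N \<xi>))\<^sup>2 \<le> (C * (\<Sum>l\<in>L N. b N l * (1 + norm (\<xi> - l)) powr (- A)))\<^sup>2"
          using g_le[of N \<xi>] by (intro power_mono) auto
        then have "(norm (g N \<xi>))\<^sup>2 * (1 + norm \<xi>) powr (- p) \<le> (C\<^sup>2 * (\<Sum>l\<in>L N. b N l * (1 + norm (\<xi> - l)) powr (- A))\<^sup>2) * (1 + norm \<xi>) powr (- p)"
          unfolding power_mult_distrib by (rule mult_right_mono) simp
        then show "(norm (g N \<xi>))\<^sup>2 * (1 + norm \<xi>) powr (- p) \<le> C\<^sup>2 * ((\<Sum>l\<in>L N. b N l * (1 + norm (\<xi> - l)) powr (- A))\<^sup>2 * (1 + norm \<xi>) powr (- p))"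
          by (simp only: mult.assoc)
      qed
      also have "\<dots> = C\<^sup>2 * (\<Sum>\<xi>\<in>T. (\<Sum>l\<in>L N. b N l * (1 + norm (\<xi> - l)) powr (- A))\<^sup>2 * (1 + norm \<xi>) powr (- p))"
        by (simp only: sum_distrib_left)
      also have "\<dots> \<le> C\<^sup>2 * (\<Lambda>\<^sup>2 * (\<Sum>l\<in>L N. (b N l)\<^sup>2 * (1 + norm l) powr (- p)))"
        using p by (intro mult_left_mono perturbation_energy[OF Lam finL latL T _ A(2)]) auto
      also have "\<dots> \<le> C\<^sup>2 * (\<Lambda>\<^sup>2 * (U * (U2 * real M powr e2)))"
        by (intro mult_left_mono energy_b) auto
      also have "\<dots> \<le> \<eta>\<^sup>2" using M2 by simp
      finally show "(\<Sum>\<xi>\<in>T. (norm (g N \<xi>))\<^sup>2 * (1 + norm \<xi>) powr (- p)) \<le> \<eta>\<^sup>2" .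
    qed
  qed
  have supp: "x \<in> denominator_nbhd \<tau> M" if "F x \<noteq> 0" for x
    using F(4)[OF that] unfolding denominator_nbhd_def \<delta>_def by blast
  show ?thesis
    using M0 F(1-3) supp class_nu pointwise energy unfolding h_def by (intro exI[of _ M] exI[of _ F] conjI) blast+
qed

section \<open>Construction of the limit measure\<close>

lemma closed_near_int: "closed {t :: real. \<exists>r::int. \<bar>t - of_int r\<bar> \<le> c}"
proof -
  have "{t :: real. \<exists>r::int. \<bar>t - of_int r\<bar> \<le> c} = {t. infdist t (range real_of_int) \<le> c}"
  proof (intro set_eqI iffI; simp)
    fix t :: real assume "\<exists>r::int. \<bar>t - of_int r\<bar> \<le> c"
    then obtain r :: int where r: "\<bar>t - of_int r\<bar> \<le> c" by blast
    have "infdist t (range real_of_int) \<le> dist t (of_int r)" by (rule infdist_le) simp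
    then show "infdist t (range real_of_int) \<le> c" using r by (simp add: dist_real_def)
  next
    fix t :: real assume le: "infdist t (range real_of_int) \<le> c"
    have "closed (range real_of_int)" by (rule closed_of_int_image)
    then obtain z where "z \<in> range real_of_int" "infdist t (range real_of_int) = dist t z"
      using infdist_attains_inf[of "range real_of_int" t] by auto
    then show "\<exists>r::int. \<bar>t - of_int r\<bar> \<le> c" using le by (auto simp: dist_real_def)
  qed
  also have "closed \<dots>" by (intro closed_Collect_le continuous_intros)
  finally show ?thesis .
qed

lemma closed_denominator_nbhd: "closed (denominator_nbhd \<tau> M :: (real ^ 'd ^ 'n) set)"
proof -
  have eq: "(denominator_nbhd \<tau> M :: (real ^ 'd ^ 'n) set) =
      (\<Union>q\<in>denominators M. \<Inter>i. (\<lambda>x. (x *v real_vec q) $ i) -` {t. \<exists>r::int. \<bar>t - of_int r\<bar> \<le> (2 * real M) powr (- \<tau>) / 2})"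
    by (auto simp: denominator_nbhd_def)
  have lin: "continuous_on UNIV (\<lambda>x :: real ^ 'd ^ 'n. (x *v real_vec q) $ i)" for q i
    unfolding matrix_vector_mult_def by (simp, intro continuous_intros)
  show ?thesis unfolding eq
    by (intro closed_UN finite_denominators ballI closed_INT closed_vimage closed_near_int lin)
qed

lemma infnorm_le_cart:
  fixes x :: "real ^ 'n"
  assumes "\<And>i. \<bar>x $ i\<bar> \<le> c"
  shows "infnorm x \<le> c"
  unfolding infnorm_cart by (rule cSup_least) (use assms in auto)

text \<open>The entries of the denominator found for \<open>M k\<close> are at least
  \<open>M k > k\<close>, so the solutions have unbounded denominators and are infinite in
  number.\<close>

lemma denominator_nbhd_well_approximable:
  fixes x :: "real ^ 'd ^ 'n"
  assumes tau: "\<tau> > 0" and M: "\<And>k. M k > k" and x: "\<And>k. x \<in> denominator_nbhd \<tau> (M k)"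
  shows "x \<in> well_approximable \<tau>"
proof -
  define S where "S = {(q :: int ^ 'd, r :: int ^ 'n). q \<noteq> 0 \<and> infnorm (x *v real_vec q - real_vec r) < infnorm (real_vec q) powr (- \<tau>)}"
  have ex: "\<exists>z\<in>S. fst z $ undefined \<ge> int (M k)" for k
  proof -
    obtain q :: "int ^ 'd" where q: "q \<in> denominators (M k)" "\<And>i. \<exists>r::int. \<bar>(x *v real_vec q) $ i - of_int r\<bar> \<le> (2 * real (M k)) powr (- \<tau>) / 2"
      using x[of k] unfolding denominator_nbhd_def by blast
    have "\<exists>r. \<forall>i. \<bar>(x *v real_vec q) $ i - of_int (r i)\<bar> \<le> (2 * real (M k)) powr (- \<tau>) / 2" using q(2) by metis
    then obtain r where r: "\<And>i. \<bar>(x *v real_vec q) $ i - real_of_int (r i)\<bar> \<le> (2 * real (M k)) powr (- \<tau>) / 2" by blast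
    have qj: "int (M k) \<le> q $ j" "q $ j < 2 * int (M k)" for j using q(1) by (auto simp: denominators_def)
    have Mk: "M k > 0" using M[of k] by simp
    have "q $ undefined \<noteq> 0" using qj(1)[of undefined] Mk by linarith
    then have q0: "q \<noteq> 0" by auto
    have "infnorm (real_vec q) > 0" using q0 infnorm_pos_lt[of "real_vec q"] by simp
    moreover have "infnorm (real_vec q) \<le> 2 * real (M k)"
    proof (rule infnorm_le_cart)
      fix j
      have "real_of_int (q $ j) \<le> real_of_int (2 * int (M k))" using qj(2)[of j] by (simp only: of_int_le_iff less_imp_le)
      moreover have "0 \<le> q $ j" using qj(1)[of j] by linarith
      ultimately show "\<bar>real_vec q $ j\<bar> \<le> 2 * real (M k)" by (simp add: real_vec_def)
    qed
    ultimately have "(2 * real (M k)) powr (- \<tau>) \<le> infnorm (real_vec q) powr (- \<tau>)" using tau by (intro powr_mono2') auto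
    moreover have "(2 * real (M k)) powr (- \<tau>) > 0" using Mk by simp
    moreover have "infnorm (x *v real_vec q - real_vec (\<chi> i. r i)) \<le> (2 * real (M k)) powr (- \<tau>) / 2"
      by (rule infnorm_le_cart) (use r in \<open>simp add: real_vec_def\<close>)
    ultimately have "infnorm (x *v real_vec q - real_vec (\<chi> i. r i)) < infnorm (real_vec q) powr (- \<tau>)" by linarith
    then have "(q, \<chi> i. r i) \<in> S" using q0 by (simp add: S_def)
    then show ?thesis using qj(1)[of undefined] by force
  qed
  have "infinite S"
  proof
    assume fin: "finite S"
    define c where "c = Max ((\<lambda>z. fst z $ undefined) ` S)"
    obtain z where z: "z \<in> S" "fst z $ undefined \<ge> int (M (nat c))" using ex by blast
    have "fst z $ undefined \<le> c" unfolding c_def using fin z(1) by (intro Max_ge) auto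
    then show False using z(2) M[of "nat c"] by linarith
  qed
  then show ?thesis unfolding well_approximable_def S_def by simp
qed

text \<open>The truncated distance to \<open>S\<close> is a bounded continuous test function that
  vanishes exactly on the closed set \<open>S\<close>. Its integral is 0 from \<open>k0\<close> on,
  hence also in the limit.\<close>

lemma weak_limit_closed_support:
  fixes \<nu> :: "'a::euclidean_space measure" and \<pi> :: "nat \<Rightarrow> 'a measure"
  assumes nu: "prob_space \<nu>" "sets \<nu> = sets borel" and pi: "\<And>k. prob_space (\<pi> k)" "\<And>k. sets (\<pi> k) = sets borel"
    and lim: "\<And>h :: 'a \<Rightarrow> complex. continuous_on UNIV h \<Longrightarrow> (\<exists>B. \<forall>x. norm (h x) \<le> B) \<Longrightarrow> (\<lambda>k. LINT x|\<pi> k. h x) \<longlonglongrightarrow> (LINT x|\<nu>. h x)"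
    and S: "closed S" "\<And>k. k \<ge> k0 \<Longrightarrow> AE x in \<pi> k. x \<in> S"
  shows "emeasure \<nu> (UNIV - S) = 0"
proof -
  \<comment> \<open>By default \<open>infdist\<close> to the empty set is 0, so emptiness has to be
    excluded before a zero distance can mean membership.\<close>
  have Sne: "S \<noteq> {}"
  proof
    assume "S = {}"
    then have "AE x in \<pi> k0. False" using S(2)[of k0] by simp
    then show False using prob_space.AE_False[OF pi(1)] by blast
  qed
  define f where "f x = min 1 (infdist x S)" for x
  have fc: "continuous_on UNIV f" unfolding f_def by (intro continuous_intros)
  have fm: "f \<in> borel_measurable borel" by (rule borel_measurable_continuous_onI[OF fc])
  have f01: "0 \<le> f x" "f x \<le> 1" for x by (auto simp: f_def infdist_nonneg)
  have "(\<lambda>k. LINT x|\<pi> k. complex_of_real (f x)) \<longlonglongrightarrow> (LINT x|\<nu>. complex_of_real (f x))"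
    by (rule lim) (use f01 in \<open>auto intro!: continuous_intros fc exI[of _ 1]\<close>)
  moreover have "\<forall>\<^sub>F k in sequentially. (LINT x|\<pi> k. complex_of_real (f x)) = 0"
    unfolding eventually_sequentially
  proof (intro exI[of _ k0] allI impI)
    fix k assume "k \<ge> k0"
    then have "AE x in \<pi> k. complex_of_real (f x) = 0" using S(2)[of k] by (auto simp: f_def elim!: eventually_mono)
    then show "(LINT x|\<pi> k. complex_of_real (f x)) = 0" by (rule integral_eq_zero_AE)
  qed
  ultimately have "(LINT x|\<nu>. complex_of_real (f x)) = 0"
    using tendsto_unique[OF sequentially_bot _ tendsto_eventually] by blast
  then have "(LINT x|\<nu>. f x) = 0" unfolding integral_complex_of_real by simp
  moreover have "integrable \<nu> f"
    by (rule integrable_bounded_continuous[OF prob_space.axioms(1)[OF nu(1)] nu(2) fm, of 1]) (use f01 in auto)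
  ultimately have "AE x in \<nu>. f x = 0" using f01 by (subst (asm) integral_nonneg_eq_0_iff_AE) auto
  then have "AE x in \<nu>. x \<in> S"
  proof eventually_elim
    case (elim x)
    then have "infdist x S = 0" using infdist_nonneg[of x S] by (auto simp: f_def min_def split: if_splits)
    then show ?case using in_closed_iff_infdist_zero[OF S(1) Sne] by blast
  qed
  moreover have "{x \<in> space \<nu>. \<not> x \<in> S} = UNIV - S" using sets_eq_imp_space_eq[OF nu(2)] by auto
  moreover have "UNIV - S \<in> sets \<nu>" unfolding nu(2) using S(1) by auto
  ultimately show ?thesis using AE_iff_measurable[of "UNIV - S" \<nu> "\<lambda>x. x \<in> S"] by simp
qed

text \<open>One construction serves both halves of the theorem: \<open>a\<close> close to
  \<open>d / (1 + \<tau>)\<close> for the Fourier dimension, and \<open>p\<close> close to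
  \<open>(n * \<tau> - d) / (1 + \<tau>)\<close> for the Hausdorff dimension.\<close>

lemma limit_measure:
  fixes \<tau> :: real
  assumes tau: "\<tau> > 0" and a: "0 \<le> a" "(1 + \<tau>) * a < real CARD('d)"
    and p: "0 < p" "p < real CARD('n)" "p * (1 + \<tau>) > real CARD('n) * \<tau> - real CARD('d)"
  shows "\<exists>\<nu> \<in> prob_measures_on (well_approximable \<tau> :: (real ^ 'd ^ 'n) set). \<exists>C.
    (\<forall>\<xi>. norm (fourier_transform \<nu> \<xi>) \<le> C * (1 + norm \<xi>) powr (- a)) \<and>
    (\<forall>T. finite T \<longrightarrow> T \<subseteq> int_lattice \<longrightarrow> (\<Sum>l\<in>T. (norm (fourier_transform \<nu> l))\<^sup>2 * (1 + norm l) powr (- p)) \<le> C)"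
proof -
  define m where "m = real DIM(real ^ 'd ^ 'n)"
  \<comment> \<open>Large enough for both decay hypotheses of \<open>multiplicative_step\<close>,
    and a natural number because it counts convolutions in the initial measure.\<close>
  define A where "A = real (nat \<lceil>a + p + m + 1\<rceil>)"
  have "A \<ge> a + p + m + 1" unfolding A_def by linarith
  then have A: "A \<ge> a + real DIM(real ^ 'd ^ 'n) + 1" "A \<ge> p + real DIM(real ^ 'd ^ 'n) + 1" "A \<ge> a"

  proof -
    have "m \<ge> 0" by (simp add: m_def)
    then show "A \<ge> a + real DIM(real ^ 'd ^ 'n) + 1" "A \<ge> p + real DIM(real ^ 'd ^ 'n) + 1" "A \<ge> a"
      using \<open>A \<ge> a + p + m + 1\<close> a(1) p(1) unfolding m_def[symmetric] by linarith+
  qed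
  obtain \<mu>0 :: "(real ^ 'd ^ 'n) measure" and C0 R where mu0: "prob_space \<mu>0" "sets \<mu>0 = sets borel"
    "AE x in \<mu>0. norm x \<le> R" "C0 > 0" "\<And>\<xi>. norm (fourier_transform \<mu>0 \<xi>) \<le> C0 * (1 + norm \<xi>) powr (- A)"
    by (rule smooth_compact_measure[where A = "nat \<lceil>a + p + m + 1\<rceil>", folded A_def]) (rule that)
  define P where "P s \<longleftrightarrow> finite_measure (fst s) \<and> sets (fst s) = sets borel \<and> (AE x in fst s. norm x \<le> R) \<and>
      (\<exists>C. \<forall>\<xi>. norm (fourier_transform (fst s) \<xi>) \<le> C * (1 + norm \<xi>) powr (- A))" for s :: "(real ^ 'd ^ 'n) measure \<times> nat"
  \<comment> \<open>A state pairs a measure with the last \<open>M\<close>. The tolerances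
    \<open>(1 / 2) ^ (k + 2)\<close> add up to 1/2. The final clause says that sets of full measure
    keep full measure, so constraints imposed at earlier steps persist.\<close>
  define Q where "Q k s s' \<longleftrightarrow> snd s < snd s' \<and>
      (\<forall>\<xi>. norm (fourier_transform (fst s') \<xi> - fourier_transform (fst s) \<xi>) \<le> (1 / 2) ^ (k + 2) * (1 + norm \<xi>) powr (- a)) \<and>
      (\<forall>T. finite T \<longrightarrow> T \<subseteq> int_lattice \<longrightarrow> (\<Sum>\<xi>\<in>T. (norm (fourier_transform (fst s') \<xi> - fourier_transform (fst s) \<xi>))\<^sup>2 * (1 + norm \<xi>) powr (- p)) \<le> ((1 / 2) ^ (k + 2))\<^sup>2) \<and>
      (AE x in fst s'. x \<in> denominator_nbhd \<tau> (snd s')) \<and> (\<forall>S. (AE x in fst s. x \<in> S) \<longrightarrow> (AE x in fst s'. x \<in> S))"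
    for k and s s' :: "(real ^ 'd ^ 'n) measure \<times> nat"
  have "\<exists>f. f 0 = (\<mu>0, 0) \<and> (\<forall>k. P (f k) \<and> Q k (f k) (f (Suc k)))"
  proof -
    \<comment> \<open>Dependent choice gives some sequence satisfying an invariant; the prescribed
      starting point is made part of the invariant at \<open>k = 0\<close>.\<close>
    have "\<exists>f. \<forall>k. (P (f k) \<and> (k = 0 \<longrightarrow> f k = (\<mu>0, 0))) \<and> Q k (f k) (f (Suc k))"
    proof (rule dependent_nat_choice)
      have "P (\<mu>0, 0)" unfolding P_def fst_conv using mu0 prob_space.axioms(1)[OF mu0(1)] by blast
      then show "\<exists>s. P s \<and> (0 = (0::nat) \<longrightarrow> s = (\<mu>0, 0))" by blast
      fix s and k :: nat assume "P s \<and> (k = 0 \<longrightarrow> s = (\<mu>0, 0))"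
      then obtain C where s: "finite_measure (fst s)" "sets (fst s) = sets borel" "AE x in fst s. norm x \<le> R"
        "\<And>\<xi>. norm (fourier_transform (fst s) \<xi>) \<le> C * (1 + norm \<xi>) powr (- A)" unfolding P_def by blast
      have e: "(1 / 2 :: real) ^ (k + 2) > 0" by simp
      obtain M F B C' where MF: "M > snd s" "continuous_on UNIV F" "\<forall>x. 0 \<le> F x" "\<forall>x. F x \<le> B" "\<forall>x. F x \<noteq> 0 \<longrightarrow> x \<in> denominator_nbhd \<tau> M"
        "\<forall>\<xi>. norm (fourier_transform (density (fst s) (\<lambda>x. ennreal (F x))) \<xi>) \<le> C' * (1 + norm \<xi>) powr (- A)"
        "\<forall>\<xi>. norm (fourier_transform (density (fst s) (\<lambda>x. ennreal (F x))) \<xi> - fourier_transform (fst s) \<xi>) \<le> (1 / 2) ^ (k + 2) * (1 + norm \<xi>) powr (- a)"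
        "\<forall>T. finite T \<longrightarrow> T \<subseteq> int_lattice \<longrightarrow> (\<Sum>\<xi>\<in>T. (norm (fourier_transform (density (fst s) (\<lambda>x. ennreal (F x))) \<xi> - fourier_transform (fst s) \<xi>))\<^sup>2 * (1 + norm \<xi>) powr (- p)) \<le> ((1 / 2) ^ (k + 2))\<^sup>2"
        using multiplicative_step[OF tau a p A(1,2) s(1,2,4) e, of "snd s"] by (elim exE conjE) (rule that)
      define \<nu> where "\<nu> = density (fst s) (\<lambda>x. ennreal (F x))"
      have Fm: "(\<lambda>x. ennreal (F x)) \<in> borel_measurable (fst s)"

      proof -
        have "F \<in> borel_measurable (fst s)"
          unfolding measurable_cong_sets[OF s(2) refl] by (rule borel_measurable_continuous_onI[OF MF(2)])
        then show ?thesis by measurable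
      qed
      have B: "F x \<le> B" for x using MF(4) by blast
      have fin: "finite_measure \<nu>"
      proof
        have "emeasure \<nu> (space \<nu>) = (\<integral>\<^sup>+x. ennreal (F x) \<partial>fst s)"
          unfolding \<nu>_def using Fm by (simp add: emeasure_density)
        also have "\<dots> \<le> (\<integral>\<^sup>+x. ennreal B \<partial>fst s)" by (intro nn_integral_mono ennreal_leI B)
        also have "\<dots> = ennreal B * emeasure (fst s) (space (fst s))" by simp
        also have "\<dots> < \<top>" using finite_measure.emeasure_finite[OF s(1)] by (simp add: ennreal_mult_less_top less_top)
        finally show "emeasure \<nu> (space \<nu>) \<noteq> \<infinity>" by simp
      qed
      have ac: "AE x in \<nu>. x \<in> S" if "AE x in fst s. x \<in> S" for S
        unfolding \<nu>_def using that by (subst AE_density[OF Fm]) auto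
      have ap: "AE x in \<nu>. x \<in> denominator_nbhd \<tau> M"
        unfolding \<nu>_def using MF(5) by (subst AE_density[OF Fm]) (auto intro!: AE_I2)
      have R: "AE x in \<nu>. norm x \<le> R" using ac[of "{x. norm x \<le> R}"] s(3) by simp
      have "P (\<nu>, M)" unfolding P_def fst_conv using fin R MF(6) s(2) by (auto simp: \<nu>_def)
      moreover have "Q k s (\<nu>, M)" unfolding Q_def fst_conv snd_conv using MF(1,7,8) ap ac by (simp add: \<nu>_def)
      ultimately show "\<exists>s'. (P s' \<and> (Suc k = 0 \<longrightarrow> s' = (\<mu>0, 0))) \<and> Q k s s'" by blast
    qed
    then show ?thesis by metis
  qed
  then obtain f where f0: "f 0 = (\<mu>0, 0)" and fP: "\<And>k. P (f k)" and fQ: "\<And>k. Q k (f k) (f (Suc k))" by blast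
  define \<mu> where "\<mu> k = fst (f k)" for k
  define M where "M k = snd (f (Suc k))" for k
  have fin: "finite_measure (\<mu> k)" and sets: "sets (\<mu> k) = sets borel" and bR: "AE x in \<mu> k. norm x \<le> R" for k
    using fP[of k] unfolding P_def \<mu>_def by auto
  have step_p: "norm (fourier_transform (\<mu> (Suc k)) \<xi> - fourier_transform (\<mu> k) \<xi>) \<le> (1 / 2) ^ (k + 2) * (1 + norm \<xi>) powr (- a)" for k \<xi>
    using fQ[of k] unfolding Q_def \<mu>_def by blast
  have step_e: "(\<Sum>\<xi>\<in>T. (norm (fourier_transform (\<mu> (Suc k)) \<xi> - fourier_transform (\<mu> k) \<xi>))\<^sup>2 * (1 + norm \<xi>) powr (- p)) \<le> ((1 / 2) ^ (k + 2))\<^sup>2"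
    if "finite T" "T \<subseteq> int_lattice" for k T
    using fQ[of k] that unfolding Q_def \<mu>_def by blast
  have apx: "AE x in \<mu> k. x \<in> denominator_nbhd \<tau> (M j)" if "k > j" for k j
    using that
  proof (induction k)
    case (Suc k)
    show ?case
    proof (cases "k = j")
      case True
      then show ?thesis using fQ[of k] unfolding Q_def \<mu>_def M_def by blast
    next
      case False
      then have "AE x in \<mu> k. x \<in> denominator_nbhd \<tau> (M j)" using Suc by simp
      then show ?thesis using fQ[of k] unfolding Q_def \<mu>_def by blast
    qed
  qed simp
  have Mk: "M k > k" for k
  proof -
    have "snd (f k) \<ge> k" for k
    proof (induction k)
      case (Suc k)
      have "snd (f k) < snd (f (Suc k))" using fQ[of k] unfolding Q_def by blast
      then show ?case using Suc by simp
    qed simp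
    then show ?thesis unfolding M_def by (metis Suc_le_eq)
  qed
  define \<sigma> where "\<sigma> k = (\<Sum>j<k. (1 / 2 :: real) ^ (j + 2))" for k :: nat
  have sig: "\<sigma> k = 1 / 2 - (1 / 2) ^ Suc k" for k
    by (induction k) (auto simp: \<sigma>_def)
  have sig_le: "\<sigma> k \<le> 1 / 2" for k unfolding sig by simp
  have diff: "norm (fourier_transform (\<mu> k) \<xi> - fourier_transform \<mu>0 \<xi>) \<le> \<sigma> k * (1 + norm \<xi>) powr (- a)" for k \<xi>
  proof (induction k)
    case 0
    then show ?case by (simp add: \<mu>_def f0 \<sigma>_def)
  next
    case (Suc k)
    have "norm (fourier_transform (\<mu> (Suc k)) \<xi> - fourier_transform \<mu>0 \<xi>) \<le>
        norm (fourier_transform (\<mu> (Suc k)) \<xi> - fourier_transform (\<mu> k) \<xi>) + norm (fourier_transform (\<mu> k) \<xi> - fourier_transform \<mu>0 \<xi>)"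
      using norm_triangle_ineq[of "fourier_transform (\<mu> (Suc k)) \<xi> - fourier_transform (\<mu> k) \<xi>" "fourier_transform (\<mu> k) \<xi> - fourier_transform \<mu>0 \<xi>"] by simp
    also have "\<dots> \<le> (1 / 2) ^ (k + 2) * (1 + norm \<xi>) powr (- a) + \<sigma> k * (1 + norm \<xi>) powr (- a)"
      by (intro add_mono step_p Suc)
    also have "\<dots> = \<sigma> (Suc k) * (1 + norm \<xi>) powr (- a)" by (simp add: \<sigma>_def distrib_right)
    finally show ?case .
  qed
  define mass where "mass k = measure (\<mu> k) (space (\<mu> k))" for k
  have mass: "mass k \<ge> 1 / 2" for k
  \<comment> \<open>The mass is the transform at frequency 0, where the weight is 1; the initial
    mass 1 has changed by at most \<open>\<sigma> k \<le> 1 / 2\<close>.\<close>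
  proof -
    have "norm (complex_of_real (mass k) - 1) \<le> \<sigma> k"
      using diff[of k 0] fourier_transform_0[OF fin[of k]] fourier_transform_0[OF prob_space.axioms(1)[OF mu0(1)]] prob_space.prob_space[OF mu0(1)]
      by (simp add: mass_def)
    then have "\<bar>mass k - 1\<bar> \<le> \<sigma> k" by (metis norm_of_real of_real_1 of_real_diff)
    then show ?thesis using sig_le[of k] by linarith
  qed
  have pt: "norm (fourier_transform (\<mu> k) \<xi>) \<le> (C0 + 1) * (1 + norm \<xi>) powr (- a)" for k \<xi>
  proof -
    have "norm (fourier_transform (\<mu> k) \<xi>) \<le> norm (fourier_transform \<mu>0 \<xi>) + norm (fourier_transform (\<mu> k) \<xi> - fourier_transform \<mu>0 \<xi>)"
      by (rule norm_triangle_sub)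
    also have "\<dots> \<le> C0 * (1 + norm \<xi>) powr (- a) + 1 * (1 + norm \<xi>) powr (- a)"
    proof (intro add_mono)
      have "(1 + norm \<xi>) powr (- A) \<le> (1 + norm \<xi>) powr (- a)" using A(3) by (intro powr_mono) auto
      then have "C0 * (1 + norm \<xi>) powr (- A) \<le> C0 * (1 + norm \<xi>) powr (- a)" using mu0(4) by (intro mult_left_mono) auto
      then show "norm (fourier_transform \<mu>0 \<xi>) \<le> C0 * (1 + norm \<xi>) powr (- a)" using mu0(5)[of \<xi>] by linarith
      have "\<sigma> k * (1 + norm \<xi>) powr (- a) \<le> 1 * (1 + norm \<xi>) powr (- a)" using sig_le[of k] by (intro mult_right_mono) auto
      then show "norm (fourier_transform (\<mu> k) \<xi> - fourier_transform \<mu>0 \<xi>) \<le> 1 * (1 + norm \<xi>) powr (- a)" using diff[of k \<xi>] by linarith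
    qed
    also have "\<dots> = (C0 + 1) * (1 + norm \<xi>) powr (- a)" by (simp only: distrib_right)
    finally show ?thesis .
  qed
  have "m + 1 > m" by simp
  then have "\<exists>\<Lambda>>0. \<forall>(\<xi>::real ^ 'd ^ 'n) T. finite T \<longrightarrow> T \<subseteq> int_lattice \<longrightarrow> (\<Sum>l\<in>T. (1 + norm (\<xi> - l)) powr (- (m + 1))) \<le> \<Lambda>"
    unfolding m_def by (rule lattice_powr_sum_bound) blast
  then obtain \<Lambda> where Lam0: "\<Lambda> > 0" and Lam: "\<And>(\<xi>::real ^ 'd ^ 'n) T. finite T \<Longrightarrow> T \<subseteq> int_lattice \<Longrightarrow> (\<Sum>l\<in>T. (1 + norm (\<xi> - l)) powr (- (m + 1))) \<le> \<Lambda>"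
    by blast
  \<comment> \<open>With the square root of the weight built in, the energy over \<open>T\<close> is
    a squared \<open>L2_set\<close>, and Minkowski's inequality adds up the increments without cross
    terms.\<close>
  define \<phi> where "\<phi> F \<xi> = norm (F \<xi>) * (1 + norm \<xi>) powr (- p / 2)" for F :: "real ^ 'd ^ 'n \<Rightarrow> complex" and \<xi> :: "real ^ 'd ^ 'n"
  have phi2: "(\<phi> F \<xi>)\<^sup>2 = (norm (F \<xi>))\<^sup>2 * (1 + norm \<xi>) powr (- p)" for F \<xi>
    unfolding \<phi>_def power_mult_distrib by (simp add: power2_eq_square powr_add[symmetric])
  have L2: "L2_set (\<phi> (fourier_transform (\<mu> k))) T \<le> C0 * sqrt \<Lambda> + \<sigma> k" if T: "finite T" "T \<subseteq> int_lattice" for k T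
  proof (induction k)
    case 0
    have "(\<Sum>\<xi>\<in>T. (\<phi> (fourier_transform \<mu>0) \<xi>)\<^sup>2) \<le> (\<Sum>\<xi>\<in>T. C0\<^sup>2 * (1 + norm (0 - \<xi>)) powr (- (m + 1)))"
    proof (intro sum_mono)
      fix \<xi> :: "real ^ 'd ^ 'n"
      have Am: "A \<ge> m + 1" using A(1) a(1) unfolding m_def by linarith
      have "(norm (fourier_transform \<mu>0 \<xi>))\<^sup>2 * (1 + norm \<xi>) powr (- p) \<le> (C0 * (1 + norm \<xi>) powr (- A))\<^sup>2 * 1"
      proof (intro mult_mono power_mono mu0(5))
        have "(1 + norm \<xi>) powr (- p) \<le> (1 + norm \<xi>) powr 0" using p by (intro powr_mono) auto
        moreover have "1 + norm \<xi> \<noteq> 0" using norm_ge_zero[of \<xi>] by linarith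
        ultimately show "(1 + norm \<xi>) powr (- p) \<le> 1" by simp
      qed auto
      also have "\<dots> = C0\<^sup>2 * (1 + norm \<xi>) powr (- (2 * A))"
        unfolding power_mult_distrib by (simp add: power2_eq_square powr_add[symmetric])
      also have "\<dots> \<le> C0\<^sup>2 * (1 + norm \<xi>) powr (- (m + 1))"
      proof (intro mult_left_mono powr_mono)
        have "A \<ge> 0" using A(3) a(1) by linarith
        then show "- (2 * A) \<le> - (m + 1)" using Am by linarith
      qed auto
      finally show "(\<phi> (fourier_transform \<mu>0) \<xi>)\<^sup>2 \<le> C0\<^sup>2 * (1 + norm (0 - \<xi>)) powr (- (m + 1))" unfolding phi2 by simp
    qed
    also have "\<dots> \<le> C0\<^sup>2 * \<Lambda>" unfolding sum_distrib_left[symmetric] by (intro mult_left_mono Lam T) auto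
    finally have "L2_set (\<phi> (fourier_transform \<mu>0)) T \<le> sqrt (C0\<^sup>2 * \<Lambda>)" unfolding L2_set_def by (rule real_sqrt_le_mono)
    also have "\<dots> = C0 * sqrt \<Lambda>" using mu0(4) by (simp add: real_sqrt_mult)
    finally show ?case by (simp add: \<mu>_def f0 \<sigma>_def)
  next
    case (Suc k)
    let ?g = "\<lambda>\<xi>. fourier_transform (\<mu> (Suc k)) \<xi> - fourier_transform (\<mu> k) \<xi>"
    have "L2_set (\<phi> (fourier_transform (\<mu> (Suc k)))) T \<le> L2_set (\<lambda>\<xi>. \<phi> (fourier_transform (\<mu> k)) \<xi> + \<phi> ?g \<xi>) T"
    proof (rule L2_set_mono)
      fix \<xi>
      have "norm (fourier_transform (\<mu> (Suc k)) \<xi>) \<le> norm (fourier_transform (\<mu> k) \<xi>) + norm (?g \<xi>)" by (rule norm_triangle_sub)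
      then have "norm (fourier_transform (\<mu> (Suc k)) \<xi>) * (1 + norm \<xi>) powr (- p / 2) \<le> (norm (fourier_transform (\<mu> k) \<xi>) + norm (?g \<xi>)) * (1 + norm \<xi>) powr (- p / 2)"
        by (intro mult_right_mono) auto
      then show "\<phi> (fourier_transform (\<mu> (Suc k))) \<xi> \<le> \<phi> (fourier_transform (\<mu> k)) \<xi> + \<phi> ?g \<xi>"
        unfolding \<phi>_def distrib_right .
    qed (simp add: \<phi>_def)
    also have "\<dots> \<le> L2_set (\<phi> (fourier_transform (\<mu> k))) T + L2_set (\<phi> ?g) T" by (rule L2_set_triangle_ineq)
    also have "L2_set (\<phi> ?g) T \<le> (1 / 2) ^ (k + 2)"
    proof -
      have "(\<Sum>\<xi>\<in>T. (\<phi> ?g \<xi>)\<^sup>2) \<le> ((1 / 2) ^ (k + 2))\<^sup>2" unfolding phi2 by (rule step_e[OF T])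
      then have "L2_set (\<phi> ?g) T \<le> sqrt (((1 / 2) ^ (k + 2))\<^sup>2)" unfolding L2_set_def by (rule real_sqrt_le_mono)
      then show ?thesis by (simp only: real_sqrt_abs) simp
    qed
    finally show ?case using Suc by (simp add: \<sigma>_def)
  qed
  define E where "E = (C0 * sqrt \<Lambda> + 1)\<^sup>2"
  have en: "(\<Sum>\<xi>\<in>T. (norm (fourier_transform (\<mu> k) \<xi>))\<^sup>2 * (1 + norm \<xi>) powr (- p)) \<le> E" if T: "finite T" "T \<subseteq> int_lattice" for k T
  proof -
    have "sqrt (\<Sum>\<xi>\<in>T. (norm (fourier_transform (\<mu> k) \<xi>))\<^sup>2 * (1 + norm \<xi>) powr (- p)) \<le> C0 * sqrt \<Lambda> + 1"
      using L2[OF T, of k] sig_le[of k] unfolding L2_set_def phi2 by linarith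
    then have "(sqrt (\<Sum>\<xi>\<in>T. (norm (fourier_transform (\<mu> k) \<xi>))\<^sup>2 * (1 + norm \<xi>) powr (- p)))\<^sup>2 \<le> E"
      unfolding E_def by (intro power_mono real_sqrt_ge_zero sum_nonneg) auto
    moreover have "(\<Sum>\<xi>\<in>T. (norm (fourier_transform (\<mu> k) \<xi>))\<^sup>2 * (1 + norm \<xi>) powr (- p)) \<ge> 0" by (intro sum_nonneg) auto
    ultimately show ?thesis by simp
  qed
  \<comment> \<open>Normalisation at most doubles the transforms, because the masses are at least
    1/2.\<close>
  define \<pi> where "\<pi> k = density (\<mu> k) (\<lambda>_. ennreal (1 / mass k))" for k
  have mass0: "mass k > 0" for k using mass[of k] by linarith
  have pi_sets: "sets (\<pi> k) = sets borel" for k by (simp add: \<pi>_def sets)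
  have pi_prob: "prob_space (\<pi> k)" for k
  proof
    have "emeasure (\<pi> k) (space (\<pi> k)) = ennreal (1 / mass k) * emeasure (\<mu> k) (space (\<mu> k))"
      unfolding \<pi>_def by (simp add: emeasure_density_const)
    also have "\<dots> = ennreal (1 / mass k * mass k)"
      unfolding mass_def finite_measure.emeasure_eq_measure[OF fin] by (rule ennreal_mult''[symmetric]) simp
    finally show "emeasure (\<pi> k) (space (\<pi> k)) = 1" using mass0[of k] by simp
  qed
  have pi_ft: "fourier_transform (\<pi> k) \<xi> = fourier_transform (\<mu> k) \<xi> / mass k" for k \<xi>
  proof -
    have um: "(\<lambda>x. unit_exp (- (x \<bullet> \<xi>))) \<in> borel_measurable (\<mu> k)"
      unfolding measurable_cong_sets[OF sets refl] by measurable
    have "fourier_transform (\<pi> k) \<xi> = (LINT x|\<mu> k. (1 / mass k) *\<^sub>R unit_exp (- (x \<bullet> \<xi>)))"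
      unfolding fourier_transform_unit_exp \<pi>_def by (rule integral_density[OF um]) (use mass0[of k] in auto)
    then show ?thesis unfolding fourier_transform_unit_exp by (simp add: scaleR_conv_of_real)
  qed
  have pi_le: "norm (fourier_transform (\<pi> k) \<xi>) \<le> 2 * norm (fourier_transform (\<mu> k) \<xi>)" for k \<xi>
  proof -
    have "norm (fourier_transform (\<pi> k) \<xi>) = norm (fourier_transform (\<mu> k) \<xi>) / mass k" unfolding pi_ft using mass0[of k] by (simp add: norm_divide)
    also have "\<dots> \<le> norm (fourier_transform (\<mu> k) \<xi>) / (1 / 2)" using mass[of k] by (intro divide_left_mono) auto
    finally show ?thesis by simp
  qed
  have pi_AE: "AE x in \<pi> k. x \<in> S" if "AE x in \<mu> k. x \<in> S" for k S
    unfolding \<pi>_def using that by (subst AE_density) auto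
  have pi_R: "AE x in \<pi> k. norm x \<le> R" for k using pi_AE[where k = k and S = "{x. norm x \<le> R}"] bR[of k] by simp
  obtain \<nu> r where nu: "prob_space \<nu>" "sets \<nu> = sets borel" and r: "strict_mono (r :: nat \<Rightarrow> nat)"
    and lim: "\<And>h :: real ^ 'd ^ 'n \<Rightarrow> complex. continuous_on UNIV h \<Longrightarrow> (\<exists>B. \<forall>x. norm (h x) \<le> B) \<Longrightarrow>
        (\<lambda>k. LINT x|\<pi> (r k). h x) \<longlonglongrightarrow> (LINT x|\<nu>. h x)"
    by (rule weak_compactness[of \<pi> R, OF pi_prob pi_sets pi_R]) (rule that)
  have ft_lim: "(\<lambda>k. fourier_transform (\<pi> (r k)) \<xi>) \<longlonglongrightarrow> fourier_transform \<nu> \<xi>" for \<xi>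
    unfolding fourier_transform_unit_exp by (rule lim) (auto intro!: continuous_intros exI[of _ 1])
  have nu_pt: "norm (fourier_transform \<nu> \<xi>) \<le> 2 * (C0 + 1) * (1 + norm \<xi>) powr (- a)" for \<xi>
  proof (rule Lim_bounded[OF tendsto_norm[OF ft_lim]], intro allI impI)
    fix k show "norm (fourier_transform (\<pi> (r k)) \<xi>) \<le> 2 * (C0 + 1) * (1 + norm \<xi>) powr (- a)"
      using pi_le[of "r k" \<xi>] pt[of "r k" \<xi>] by linarith
  qed
  have nu_en: "(\<Sum>\<xi>\<in>T. (norm (fourier_transform \<nu> \<xi>))\<^sup>2 * (1 + norm \<xi>) powr (- p)) \<le> 4 * E" if T: "finite T" "T \<subseteq> int_lattice" for T
  proof (rule Lim_bounded)
    show "(\<lambda>k. \<Sum>\<xi>\<in>T. (norm (fourier_transform (\<pi> (r k)) \<xi>))\<^sup>2 * (1 + norm \<xi>) powr (- p)) \<longlonglongrightarrow> (\<Sum>\<xi>\<in>T. (norm (fourier_transform \<nu> \<xi>))\<^sup>2 * (1 + norm \<xi>) powr (- p))"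
      by (intro tendsto_intros ft_lim)
    show "\<forall>k\<ge>0. (\<Sum>\<xi>\<in>T. (norm (fourier_transform (\<pi> (r k)) \<xi>))\<^sup>2 * (1 + norm \<xi>) powr (- p)) \<le> 4 * E"
    proof (intro allI impI)
      fix k :: nat
      have "(\<Sum>\<xi>\<in>T. (norm (fourier_transform (\<pi> (r k)) \<xi>))\<^sup>2 * (1 + norm \<xi>) powr (- p)) \<le>
          (\<Sum>\<xi>\<in>T. 4 * ((norm (fourier_transform (\<mu> (r k)) \<xi>))\<^sup>2 * (1 + norm \<xi>) powr (- p)))"
      proof (intro sum_mono)
        fix \<xi> :: "real ^ 'd ^ 'n"
        have "(norm (fourier_transform (\<pi> (r k)) \<xi>))\<^sup>2 \<le> (2 * norm (fourier_transform (\<mu> (r k)) \<xi>))\<^sup>2"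
          using pi_le by (intro power_mono) auto
        then have "(norm (fourier_transform (\<pi> (r k)) \<xi>))\<^sup>2 \<le> 4 * (norm (fourier_transform (\<mu> (r k)) \<xi>))\<^sup>2" by (simp add: power_mult_distrib)
        from mult_right_mono[OF this powr_ge_zero]
        show "(norm (fourier_transform (\<pi> (r k)) \<xi>))\<^sup>2 * (1 + norm \<xi>) powr (- p) \<le> 4 * ((norm (fourier_transform (\<mu> (r k)) \<xi>))\<^sup>2 * (1 + norm \<xi>) powr (- p))"
          by (simp only: mult.assoc)
      qed
      also have "\<dots> \<le> 4 * E" unfolding sum_distrib_left[symmetric] using en[OF T] by simp
      finally show "(\<Sum>\<xi>\<in>T. (norm (fourier_transform (\<pi> (r k)) \<xi>))\<^sup>2 * (1 + norm \<xi>) powr (- p)) \<le> 4 * E" .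
    qed
  qed
  \<comment> \<open>Full measure along a tail suffices, which matters because the constraint for
    \<open>M j\<close> holds only from step \<open>Suc j\<close> on.\<close>
  have supp_sub: "measure_support \<nu> \<subseteq> S" if "closed S" "\<And>k. k \<ge> k0 \<Longrightarrow> AE x in \<pi> (r k). x \<in> S" for S k0
    using weak_limit_closed_support[OF nu pi_prob pi_sets lim that] that(1) unfolding measure_support_def by blast
  have "measure_support \<nu> \<subseteq> cball 0 R"
    by (rule supp_sub[of _ 0]) (use pi_R in auto)
  then have "compact (measure_support \<nu>)"
    using measure_support_null(2)[OF nu(2)] bounded_subset[OF bounded_cball] compact_eq_bounded_closed by blast
  moreover have "measure_support \<nu> \<subseteq> well_approximable \<tau>"
  proof
    fix x assume x: "x \<in> measure_support \<nu>"
    have "x \<in> denominator_nbhd \<tau> (M j)" for j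
    proof -
      have "measure_support \<nu> \<subseteq> denominator_nbhd \<tau> (M j)"
      proof (rule supp_sub[OF closed_denominator_nbhd, of "Suc j"])
        fix k assume "k \<ge> Suc j"
        then have "r k > j" using seq_suble[OF r, of k] by linarith
        then show "AE x in \<pi> (r k). x \<in> denominator_nbhd \<tau> (M j)" by (intro pi_AE apx)
      qed
      then show ?thesis using x by blast
    qed
    then show "x \<in> well_approximable \<tau>" by (rule denominator_nbhd_well_approximable[OF tau Mk])
  qed
  ultimately have "\<nu> \<in> prob_measures_on (well_approximable \<tau>)" unfolding prob_measures_on_def using nu by simp
  moreover have "norm (fourier_transform \<nu> \<xi>) \<le> max (2 * (C0 + 1)) (4 * E) * (1 + norm \<xi>) powr (- a)" for \<xi>
    by (rule order_trans[OF nu_pt]) (intro mult_right_mono, auto)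
  moreover have "(\<Sum>\<xi>\<in>T. (norm (fourier_transform \<nu> \<xi>))\<^sup>2 * (1 + norm \<xi>) powr (- p)) \<le> max (2 * (C0 + 1)) (4 * E)" if "finite T" "T \<subseteq> int_lattice" for T
    using nu_en[OF that] by linarith
  ultimately show ?thesis by blast
qed

theorem theorem1:
  fixes \<tau> :: real
  assumes "\<tau> > real CARD('d) / real CARD('n)"
  shows "fourier_dim (well_approximable \<tau> :: (real ^ 'd ^ 'n) set) = 2 * real CARD('d) / (1 + \<tau>) \<and>
    (\<not> (CARD('n) = 1 \<and> CARD('d) = 1) \<longrightarrow>
       \<not> salem_set (well_approximable \<tau> :: (real ^ 'd ^ 'n) set))"
proof -
  define d n where "d = real CARD('d)" and "n = real CARD('n)"
  have dn: "d \<ge> 1" "n \<ge> 1" by (auto simp: d_def n_def Suc_le_eq)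
  have taun: "n * \<tau> > d" using assms dn by (simp add: d_def n_def field_simps)
  have tau: "\<tau> > 0"
  proof -
    have "n * \<tau> > 0" using taun dn by linarith
    then show ?thesis using dn by (simp add: zero_less_mult_iff)
  qed
  let ?E = "well_approximable \<tau> :: (real ^ 'd ^ 'n) set"
  have upper: "fourier_dim_measure \<mu> \<le> 2 * d / (1 + \<tau>)" if "\<mu> \<in> prob_measures_on ?E" for \<mu>
    using fourier_dim_measure_le[OF assms that] by (simp add: d_def)
  have nonneg: "0 \<le> 2 * d / (1 + \<tau>)" using dn tau by simp
  have bdd: "bdd_above (insert 0 (fourier_dim_measure ` prob_measures_on ?E))"
    using upper nonneg by (intro bdd_aboveI[of _ "2 * d / (1 + \<tau>)"]) auto
  have dimE: "real DIM(real ^ 'd ^ 'n) = n * d" by (simp add: d_def n_def)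
  have pstar: "(n * \<tau> - d) / (1 + \<tau>) > 0" "(n * \<tau> - d) / (1 + \<tau>) < n"
    using taun tau dn by (auto simp: divide_simps algebra_simps)
  have lower: "2 * a \<le> fourier_dim ?E" if a: "0 \<le> a" "(1 + \<tau>) * a < d" for a
  proof -
    obtain p where p: "(n * \<tau> - d) / (1 + \<tau>) < p" "p < n" using dense[OF pstar(2)] by blast
    have p3: "p * (1 + \<tau>) > n * \<tau> - d" using p(1) tau by (simp add: divide_less_eq)
    have p0: "0 < p" using p(1) pstar(1) by linarith
    obtain \<nu> C where nu: "\<nu> \<in> prob_measures_on ?E" "\<And>\<xi>. norm (fourier_transform \<nu> \<xi>) \<le> C * (1 + norm \<xi>) powr (- a)"

      using limit_measure[where ?'d = 'd and ?'n = 'n, OF tau a(1) a(2)[unfolded d_def] p0 p(2)[unfolded n_def] p3[unfolded d_def n_def]] by blast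
    have C0: "C \<ge> 0" using order_trans[OF norm_ge_zero nu(2)[of 0]] by simp
    let ?S = "{s \<in> {0..real DIM(real ^ 'd ^ 'n)}. \<exists>C. \<forall>\<xi>. \<xi> \<noteq> 0 \<longrightarrow> norm (fourier_transform \<nu> \<xi>) \<le> C * norm \<xi> powr (- s / 2)}"
    have "2 * a \<in> ?S"
    proof (intro CollectI conjI exI allI impI)
      \<comment> \<open>The definition of \<open>fourier_dim_measure\<close> caps exponents at the
        dimension, so \<open>2 * a \<le> n * d\<close> must be checked; it follows from
        \<open>n \<ge> 1\<close> and \<open>n * \<tau> > d \<ge> 1\<close>.\<close>
      have "(1 + \<tau>) * (n * d) \<ge> 2 * d"
      proof -
        have "n + n * \<tau> \<ge> 2" using taun dn by linarith
        then have "(n + n * \<tau>) * d \<ge> 2 * d" using dn by (intro mult_right_mono) auto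
        then show ?thesis by (simp add: algebra_simps)
      qed
      then have "(1 + \<tau>) * (2 * a) \<le> (1 + \<tau>) * (n * d)" using a(2) by linarith
      then have "2 * a \<le> n * d" using tau by simp
      then show "2 * a \<in> {0..real DIM(real ^ 'd ^ 'n)}" using a(1) unfolding dimE by simp
      fix \<xi> :: "real ^ 'd ^ 'n" assume xi: "\<xi> \<noteq> 0"
      have "(1 + norm \<xi>) powr (- a) \<le> norm \<xi> powr (- a)" using a(1) xi by (intro powr_mono2') auto
      then have "C * (1 + norm \<xi>) powr (- a) \<le> C * norm \<xi> powr (- a)" using C0 by (rule mult_left_mono)
      moreover have "- (2 * a) / 2 = - a" by simp
      ultimately show "norm (fourier_transform \<nu> \<xi>) \<le> C * norm \<xi> powr (- (2 * a) / 2)" using nu(2)[of \<xi>] by simp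
    qed
    moreover have "bdd_above ?S" by (intro bdd_aboveI[of _ "real DIM(real ^ 'd ^ 'n)"]) auto
    ultimately have "2 * a \<le> fourier_dim_measure \<nu>" unfolding fourier_dim_measure_def by (rule cSup_upper)
    also have "\<dots> \<le> fourier_dim ?E" unfolding fourier_dim_def using nu(1) by (intro cSup_upper bdd) auto
    finally show ?thesis .
  qed
  have dimF: "fourier_dim ?E = 2 * d / (1 + \<tau>)"
  proof (rule antisym)
    show "fourier_dim ?E \<le> 2 * d / (1 + \<tau>)"
      unfolding fourier_dim_def using upper nonneg by (intro cSup_least) auto
    show "2 * d / (1 + \<tau>) \<le> fourier_dim ?E"
    \<comment> \<open>The construction realises exponents strictly below the critical one, so the
      value is reached only as a supremum.\<close>
    proof (rule dense_le)
      fix x assume x: "x < 2 * d / (1 + \<tau>)"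
      show "x \<le> fourier_dim ?E"
      proof (cases "x \<ge> 0")
        case True
        have "(1 + \<tau>) * (x / 2) < d" using x tau by (simp add: field_simps)
        then show ?thesis using lower[of "x / 2"] True by simp
      next
        case False
        have "0 \<le> fourier_dim ?E" using lower[of 0] dn by simp
        then show ?thesis using False by simp
      qed
    qed
  qed
  moreover have "\<not> salem_set ?E" if ns: "\<not> (CARD('n) = 1 \<and> CARD('d) = 1)"
  proof -
    \<comment> \<open>Times \<open>1 + \<tau>\<close>, the difference of the two sides is
      \<open>d * (n - 1) + n * \<tau> * (d - 1)\<close>, which vanishes exactly when
      \<open>n = d = 1\<close>.\<close>
    have "(n * \<tau> - d) / (1 + \<tau>) < n * d - 2 * d / (1 + \<tau>)"
    proof -
      have "d * (n - 1) + n * \<tau> * (d - 1) > 0"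
      proof (cases "CARD('d) = 1")
        case True
        then have "CARD('n) \<noteq> 1" using ns by blast
        then have "CARD('n) \<ge> 2" using zero_less_card_finite[where 'a = 'n] by linarith
        then have "n \<ge> 2" by (simp add: n_def)
        then show ?thesis using True dn by (simp add: d_def)
      next
        case False
        then have "CARD('d) \<ge> 2" using zero_less_card_finite[where 'a = 'd] by linarith
        then have "d \<ge> 2" by (simp add: d_def)
        then have "n * \<tau> * (d - 1) > 0" using tau dn by (intro mult_pos_pos) auto
        moreover have "d * (n - 1) \<ge> 0" using dn by (intro mult_nonneg_nonneg) auto
        ultimately show ?thesis by linarith
      qed
      then have "n * \<tau> - d < (n * d) * (1 + \<tau>) - 2 * d" by (simp add: algebra_simps)
      then have "(n * \<tau> - d) / (1 + \<tau>) < ((n * d) * (1 + \<tau>) - 2 * d) / (1 + \<tau>)" using tau by (intro divide_strict_right_mono) auto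
      also have "\<dots> = n * d - 2 * d / (1 + \<tau>)" using tau by (simp add: diff_divide_distrib)
      finally show ?thesis .
    qed
    then have "(n * \<tau> - d) / (1 + \<tau>) < min n (n * d - 2 * d / (1 + \<tau>))" using pstar(2) by simp
    from dense[OF this] obtain p where p: "(n * \<tau> - d) / (1 + \<tau>) < p" "p < n" "p < n * d - 2 * d / (1 + \<tau>)" by auto
    have p3: "p * (1 + \<tau>) > n * \<tau> - d" using p(1) tau by (simp add: divide_less_eq)
    have p0: "0 < p" using p(1) pstar(1) by linarith
    obtain \<nu> C where nu: "\<nu> \<in> prob_measures_on ?E"
      and en: "\<And>T. finite T \<Longrightarrow> T \<subseteq> int_lattice \<Longrightarrow> (\<Sum>l\<in>T. (norm (fourier_transform \<nu> l))\<^sup>2 * (1 + norm l) powr (- p)) \<le> C"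

    proof -
      \<comment> \<open>The decay exponent is taken to be \<open>a = 0\<close>: here the measure is
        wanted for its energy.\<close>
      have "(1 + \<tau>) * 0 < real CARD('d)" by simp
      from limit_measure[where ?'d = 'd and ?'n = 'n, OF tau order_refl this p0 p(2)[unfolded n_def] p3[unfolded d_def n_def]]
      show thesis using that by blast
    qed
    have nu': "prob_space \<nu>" "sets \<nu> = sets borel" "measure_support \<nu> \<subseteq> ?E" using nu by (auto simp: prob_measures_on_def)
    have "AE x in \<nu>. x \<in> measure_support \<nu>"
      using measure_support_null[OF nu'(2)] nu'(2) sets_eq_imp_space_eq[OF nu'(2)]
      by (intro AE_I[of _ _ "UNIV - measure_support \<nu>"]) auto
    then have "AE x in \<nu>. x \<in> ?E" using nu'(3) by (auto elim!: eventually_mono)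
    from hausdorff_dim_ge[OF nu'(1,2) less_imp_le[OF p0] en this]
    have "hausdorff_dim ?E \<ge> n * d - p" unfolding dimE by simp
    then have "hausdorff_dim ?E > fourier_dim ?E" using p(3) unfolding dimF by linarith
    then show ?thesis by (simp add: salem_set_def)
  qed
  ultimately show ?thesis unfolding d_def by blast
qed

end
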